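(* Let $p$ be a prime and $\alpha>0$. Let $\mathbb{T}_p^o$ be the rooted tree with root $o$ in which every vertex has $p$ forward neighbours, with $\partial\mathbb{T}_p^o$ identified with $\mathbb{Z}_p$, and consider the nearest neighbour random walk on $\mathbb{T}_p^o$ with transition probabilities $$p(v,v^-)=1-c\quad\text{and}\quad p(v^-,v)=\begin{cases}1/p&\text{if }v^-=o,\\c/p&\text{otherwise,}\end{cases}\qquad v\neq o,$$ with parameter $c=(1+p^{-\alpha})^{-1}$. Then the boundary process $\{X_t\}_{t>0}$ associated with this random walk and the isotropic jump process $\{X_t^\alpha\}_{t>0}$ on $\mathbb{Z}_p$ driven by the operator $\mathbb{D}^\alpha$ are related by the linear time change $X_{t/C}=X_t^\alpha$ (equality of the Markov processes in law), where $C=p^{-\alpha}(1-p^{-\alpha})$.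
   Context: $\mathbb{T}_p^o$ is the tree of balls of $(\mathbb{Z}_p,\|x-y\|_p)$: its vertices are the balls in $\mathbb{Z}_p$, the root $o$ is $\mathbb{Z}_p$ itself, and the predecessor $v^-$ of a ball $v\ne\mathbb{Z}_p$ is the smallest ball properly containing it. An end of the tree corresponds to the point of $\mathbb{Z}_p$ that is the intersection of the balls along the ray from $o$; this identifies $\partial\mathbb{T}_p^o$ with $\mathbb{Z}_p$. Operator $\mathbb{D}^\alpha$. The dual group of $\mathbb{Z}_p$ is identified with $Z(p^\infty)=\{p^{-n}m:0\le m<p^n,\ n=1,2,\dots\}$ with addition mod $1$. On locally constant functions $f$ on $\mathbb{Z}_p$, $\mathbb{D}^\alpha$ is defined through the Fourier transform of $\mathbb{Z}_p$ by $\widehat{\mathbb{D}^\alpha f}(\xi)=\|\xi\|_p^\alpha\,\widehat f(\xi)$, $\xi\in Z(p^\infty)\subset\mathbb{Q}_p$; its closure is a non-negative definite self-adjoint operator in $L^2(\mathbb{Z}_p,\mu_p)$ ($\mu_p$ the normalized Haar measure), and $\exp(-t\,\mathbb{D}^\alpha)$ is a symmetric Markov semigroup. The process driven by $\mathbb{D}^\alpha$ is the Markov process with this semigroup. Boundary process. The random walk $(Z_n)$ is transient and converges almost surely to a random end $Z_\infty$; let $\nu_u$ be the law of $Z_\infty$ for the walk started at $u$ (here $\nu_o=\mu_p$). Let $\mathsf{m}(o)=1$ and $\mathsf{m}(v)=\prod_{i=1}^k\frac{p(v_{i-1},v_i)}{p(v_i,v_{i-1})}$ if $[o=v_0,\dots,v_k=v]$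 is the geodesic; $a(v^-,v)=\mathsf{m}(v)p(v,v^-)$; $\mathcal{E}_T(f,g)=\sum_{v\ne o}(f(v)-f(v^-))(g(v)-g(v^-))a(v^-,v)$ for functions on the tree. For $\varphi\in L^1(\partial\mathbb{T}_p^o,\nu_o)$ let $h_\varphi(u)=\int\varphi\,d\nu_u$. The boundary process is the symmetric Markov process on $\partial\mathbb{T}_p^o=\mathbb{Z}_p$ determined by the Dirichlet form $\mathcal{E}_{\mathcal{HD}}(\varphi,\psi)=\mathcal{E}_T(h_\varphi,h_\psi)$ on $L^2(\partial\mathbb{T}_p^o,\nu_o)$ with domain $\{\varphi:\mathcal{E}_T(h_\varphi,h_\varphi)<\infty\}$. *)

theory Defs
  imports "HOL-Probability.Probability" "HOL-Computational_Algebra.Computational_Algebra"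
begin

section \<open>The \<open>p\<close>-adic integers\<close>

text \<open>\<open>\<int>\<^sub>p\<close> is the inverse limit of the rings \<open>\<int>/p\<^sup>n\<int>\<close>: \<open>x n\<close> is the residue of \<open>x\<close> modulo \<open>p\<^sup>n\<close>.\<close>

type_synonym padic = "nat \<Rightarrow> int"

definition Zp :: "nat \<Rightarrow> padic set" where
  "Zp p = {x. \<forall>n. 0 \<le> x n \<and> x n < int p ^ n \<and> x (Suc n) mod int p ^ n = x n}"

definition padic_add :: "nat \<Rightarrow> padic \<Rightarrow> padic \<Rightarrow> padic" where
  "padic_add p x y = (\<lambda>n. (x n + y n) mod int p ^ n)"

definition padic_diff :: "nat \<Rightarrow> padic \<Rightarrow> padic \<Rightarrow> padic" where
  "padic_diff p x y = (\<lambda>n. (x n - y n) mod int p ^ n)"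

text \<open>For \<open>x \<noteq> 0\<close> the \<open>LEAST\<close> below is the \<open>p\<close>-adic valuation of \<open>x\<close>, since \<open>x n = 0\<close> iff
  \<open>p\<^sup>n\<close> divides \<open>x\<close>.\<close>

definition padic_norm :: "nat \<Rightarrow> padic \<Rightarrow> real" where
  "padic_norm p x = (if x = (\<lambda>_. 0) then 0 else inverse (real p ^ (LEAST n. x (Suc n) \<noteq> 0)))"

definition padic_dist :: "nat \<Rightarrow> padic \<Rightarrow> padic \<Rightarrow> real" where
  "padic_dist p x y = padic_norm p (padic_diff p x y)"

lemma Zp_mod:
  assumes "x \<in> Zp p" "k \<le> n"
  shows "x n mod int p ^ k = x k"
  using assms(2)
proof (induction n rule: dec_induct)
  case base
  show ?case using assms(1) by (simp add: Zp_def)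
next
  case (step n)
  have "x (Suc n) mod int p ^ k = x (Suc n) mod int p ^ n mod int p ^ k"
    using step(1) by (simp add: mod_mod_cancel le_imp_power_dvd)
  also have "x (Suc n) mod int p ^ n = x n"
    using assms(1) by (simp add: Zp_def)
  finally show ?case using step by simp
qed

lemma padic_diff_in_Zp:
  assumes "p > 0" "x \<in> Zp p" "y \<in> Zp p"
  shows "padic_diff p x y \<in> Zp p"
proof -
  have "(x (Suc n) - y (Suc n)) mod int p ^ Suc n mod int p ^ n = (x n - y n) mod int p ^ n" for n
  proof -
    have "(x (Suc n) - y (Suc n)) mod int p ^ Suc n mod int p ^ n =
          (x (Suc n) mod int p ^ n - y (Suc n) mod int p ^ n) mod int p ^ n"
      by (simp add: mod_mod_cancel mod_diff_eq)
    also have "\<dots> = (x n - y n) mod int p ^ n"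
      using assms by (simp add: Zp_mod)
    finally show ?thesis .
  qed
  then show ?thesis using assms(1) by (simp add: Zp_def padic_diff_def)
qed

lemma padic_norm_le_iff:
  assumes "p > 1" "z \<in> Zp p"
  shows "padic_norm p z \<le> inverse (real p ^ k) \<longleftrightarrow> z k = 0"
proof (cases "z = (\<lambda>_. 0)")
  case True
  then show ?thesis by (simp add: padic_norm_def)
next
  case False
  then obtain m where m: "z m \<noteq> 0" by auto
  have z0: "z 0 = 0" using assms(2) by (auto simp: Zp_def dest: spec[of _ 0])
  have mono: "z j = 0" if "z n = 0" "j \<le> n" for j n
    using Zp_mod[OF assms(2) that(2)] that(1) by simp
  define L where "L = (LEAST n. z (Suc n) \<noteq> 0)"
  have "\<exists>n. z (Suc n) \<noteq> 0" using m z0 by (cases m) auto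
  then have L: "z (Suc L) \<noteq> 0" unfolding L_def by (rule LeastI_ex)
  have "z L = 0"
  proof (cases L)
    case 0 then show ?thesis using z0 by simp
  next
    case (Suc j)
    then have "\<not> z (Suc j) \<noteq> 0" using not_less_Least[of j "\<lambda>n. z (Suc n) \<noteq> 0"] L_def by auto
    then show ?thesis using Suc by simp
  qed
  then have "z k = 0 \<longleftrightarrow> k \<le> L" using mono L by (meson not_less_eq_eq)
  moreover have "padic_norm p z = inverse (real p ^ L)" using False by (simp add: padic_norm_def L_def)
  ultimately show ?thesis using assms(1) by simp
qed

lemma padic_dist_le_iff:
  assumes "p > 1" "x \<in> Zp p" "y \<in> Zp p"
  shows "padic_dist p x y \<le> inverse (real p ^ k) \<longleftrightarrow> x k = y k"
proof -
  have "(x k - y k) mod int p ^ k = 0 \<longleftrightarrow> x k mod int p ^ k = y k mod int p ^ k"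
    by (simp add: mod_eq_dvd_iff mod_eq_0_iff_dvd)
  then show ?thesis
    using padic_norm_le_iff[OF assms(1) padic_diff_in_Zp[OF _ assms(2,3)], of k] assms Zp_mod[of _ p k k]
    by (simp add: padic_dist_def padic_diff_def)
qed

lemma padic_dist_cases:
  obtains "padic_dist p x y = 0" | k where "padic_dist p x y = inverse (real p ^ k)"
  by (metis padic_dist_def padic_norm_def)

lemma padic_dist_ultrametric:
  assumes "p > 1" "x \<in> Zp p" "y \<in> Zp p" "z \<in> Zp p"
  shows "padic_dist p x z \<le> max (padic_dist p x y) (padic_dist p y z)"
proof -
  have eq: "u = v" if "padic_dist p u v = 0" "u \<in> Zp p" "v \<in> Zp p" for u v
  proof
    fix k
    show "u k = v k" using padic_dist_le_iff[OF assms(1) that(2,3), of k] that(1) by simp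
  qed
  show ?thesis
  proof (cases rule: padic_dist_cases[of p x y])
    case 1
    then have "x = y" using eq assms by blast
    then show ?thesis by simp
  next
    case (2 k)
    show ?thesis
    proof (cases rule: padic_dist_cases[of p y z])
      case 1
      then have "y = z" using eq assms by blast
      then show ?thesis by simp
    next
      case *: (2 l)
      let ?m = "min k l"
      have le: "inverse (real p ^ k) \<le> inverse (real p ^ ?m)" "inverse (real p ^ l) \<le> inverse (real p ^ ?m)"
        using assms(1) by simp_all
      have "x ?m = y ?m" "y ?m = z ?m"
        using le 2 * padic_dist_le_iff[of p] assms by (metis)+
      then have "padic_dist p x z \<le> inverse (real p ^ ?m)"
        using padic_dist_le_iff[of p x z ?m] assms by simp
      moreover have "inverse (real p ^ ?m) = max (padic_dist p x y) (padic_dist p y z)"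
        using 2 * le by (auto simp: min_def max_def)
      ultimately show ?thesis by simp
    qed
  qed
qed

lemma Metric_space_Zp:
  assumes "p > 1"
  shows "Metric_space (Zp p) (padic_dist p)"
proof
  have nonneg: "0 \<le> padic_dist p x y" for x y
    by (cases rule: padic_dist_cases[of p x y]) simp_all
  show "0 \<le> padic_dist p x y" for x y by (fact nonneg)
  show "padic_dist p x y = padic_dist p y x" for x y
  proof -
    have "(x n - y n) mod int p ^ n = 0 \<longleftrightarrow> (y n - x n) mod int p ^ n = 0" for n
      by (metis dvd_diff_commute mod_eq_0_iff_dvd)
    then have "padic_diff p x y n = 0 \<longleftrightarrow> padic_diff p y x n = 0" for n
      by (simp add: padic_diff_def)
    then show ?thesis by (simp add: padic_dist_def padic_norm_def fun_eq_iff)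
  qed
  show "padic_dist p x y = 0 \<longleftrightarrow> x = y" if "x \<in> Zp p" "y \<in> Zp p" for x y
  proof
    assume 0: "padic_dist p x y = 0"
    show "x = y"
    proof
      fix k show "x k = y k" using padic_dist_le_iff[OF assms that, of k] 0 by simp
    qed
  qed (simp add: padic_dist_def padic_norm_def padic_diff_def)
  show "padic_dist p x z \<le> padic_dist p x y + padic_dist p y z"
    if "x \<in> Zp p" "y \<in> Zp p" "z \<in> Zp p" for x y z
    using padic_dist_ultrametric[OF assms that] nonneg[of x y] nonneg[of y z] by linarith
qed

abbreviation Zp_topology :: "nat \<Rightarrow> padic topology" where
  "Zp_topology p \<equiv> Metric_space.mtopology (Zp p) (padic_dist p)"

definition Zp_borel :: "nat \<Rightarrow> padic measure" where
  "Zp_borel p = sigma (Zp p) {U. openin (Zp_topology p) U}"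

definition haar_prob :: "nat \<Rightarrow> padic measure \<Rightarrow> bool" where
  "haar_prob p \<mu> \<longleftrightarrow> prob_space \<mu> \<and> sets \<mu> = sets (Zp_borel p) \<and>
     (\<forall>a\<in>Zp p. distr \<mu> (Zp_borel p) (padic_add p a) = \<mu>)"


section \<open>The tree of balls and the random walk\<close>

type_synonym vertex = "padic set"

definition balls :: "nat \<Rightarrow> vertex set" where
  "balls p = {B. \<exists>x\<in>Zp p. \<exists>r>0. B = Metric_space.mcball (Zp p) (padic_dist p) x r}"

abbreviation (input) tree_root :: "nat \<Rightarrow> vertex" where
  "tree_root p \<equiv> Zp p"

text \<open>Meaningful for vertices other than the root.\<close>

definition pred :: "nat \<Rightarrow> vertex \<Rightarrow> vertex" where
  "pred p v = (THE w. w \<in> balls p \<and> v \<subset> w \<and> (\<forall>w'\<in>balls p. v \<subset> w' \<longrightarrow> w \<subseteq> w'))"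

definition walk_prob :: "nat \<Rightarrow> real \<Rightarrow> vertex \<Rightarrow> vertex \<Rightarrow> real" where
  "walk_prob p c u v =
     (if u \<in> balls p \<and> u \<noteq> tree_root p \<and> v = pred p u then 1 - c
      else if v \<in> balls p \<and> v \<noteq> tree_root p \<and> u = pred p v
        then (if u = tree_root p then 1 / real p else c / real p)
      else 0)"

text \<open>\<open>P u\<close> is the law of the walk started at \<open>u\<close>, and \<open>q\<close> its transition probabilities.\<close>

definition random_walk ::
  "nat \<Rightarrow> (vertex \<Rightarrow> vertex \<Rightarrow> real) \<Rightarrow> (vertex \<Rightarrow> 'w measure) \<Rightarrow> (nat \<Rightarrow> 'w \<Rightarrow> vertex) \<Rightarrow> bool" where
  "random_walk p q P Z \<longleftrightarrow> (\<forall>u\<in>balls p.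
     prob_space (P u) \<and>
     (\<forall>n. Z n \<in> P u \<rightarrow>\<^sub>M count_space (balls p)) \<and>
     (\<forall>n v. (\<forall>i\<le>n. v i \<in> balls p) \<longrightarrow>
        measure (P u) {\<omega> \<in> space (P u). \<forall>i\<le>n. Z i \<omega> = v i} =
          (if v 0 = u then (\<Prod>i<n. q (v i) (v (Suc i))) else 0)))"

text \<open>Convergence to the end identified with \<open>\<xi>\<close>: the walk finally stays in every
  subtree whose boundary contains \<open>\<xi>\<close>; the subtree rooted at a ball \<open>B\<close> consists of the balls
  contained in \<open>B\<close>.\<close>

definition tends_to_end :: "nat \<Rightarrow> (nat \<Rightarrow> vertex) \<Rightarrow> padic \<Rightarrow> bool" where
  "tends_to_end p z \<xi> \<longleftrightarrow> \<xi> \<in> Zp p \<and> (\<forall>B\<in>balls p. \<xi> \<in> B \<longrightarrow> (\<forall>\<^sub>F n in sequentially. z n \<subseteq> B))"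

text \<open>The value \<open>0\<close> is a dummy for trajectories that do not converge to an end.\<close>

definition limit_end :: "nat \<Rightarrow> (nat \<Rightarrow> 'w \<Rightarrow> vertex) \<Rightarrow> 'w \<Rightarrow> padic" where
  "limit_end p Z \<omega> =
     (if \<exists>\<xi>. tends_to_end p (\<lambda>n. Z n \<omega>) \<xi> then THE \<xi>. tends_to_end p (\<lambda>n. Z n \<omega>) \<xi> else (\<lambda>_. 0))"

definition exit_law ::
  "nat \<Rightarrow> (vertex \<Rightarrow> 'w measure) \<Rightarrow> (nat \<Rightarrow> 'w \<Rightarrow> vertex) \<Rightarrow> vertex \<Rightarrow> padic measure" where
  "exit_law p P Z u = distr (P u) (Zp_borel p) (limit_end p Z)"


section \<open>Operators and semigroups in \<open>L\<^sup>2\<close>\<close>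

text \<open>Elements of \<open>L\<^sup>2\<close> are represented by functions, and operators by their graphs, which are sets
  of pairs of such functions.\<close>

definition L2 :: "'s measure \<Rightarrow> ('s \<Rightarrow> 'b::{banach, second_countable_topology}) set" where
  "L2 \<mu> = {f \<in> borel_measurable \<mu>. integrable \<mu> (\<lambda>x. (norm (f x))\<^sup>2)}"

definition L2_norm ::
  "'s measure \<Rightarrow> ('s \<Rightarrow> 'b::{banach, second_countable_topology}) \<Rightarrow> real" where
  "L2_norm \<mu> f = sqrt (\<integral>x. (norm (f x))\<^sup>2 \<partial>\<mu>)"

definition operator_closure ::
  "'s measure \<Rightarrow> (('s \<Rightarrow> 'b::{banach, second_countable_topology}) \<times> ('s \<Rightarrow> 'b)) set
     \<Rightarrow> (('s \<Rightarrow> 'b) \<times> ('s \<Rightarrow> 'b)) set" where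
  "operator_closure \<mu> A = {(f, g). f \<in> L2 \<mu> \<and> g \<in> L2 \<mu> \<and>
     (\<exists>F G. (\<forall>n::nat. (F n, G n) \<in> A) \<and>
        (\<lambda>n. L2_norm \<mu> (\<lambda>x. F n x - f x)) \<longlonglongrightarrow> 0 \<and>
        (\<lambda>n. L2_norm \<mu> (\<lambda>x. G n x - g x)) \<longlonglongrightarrow> 0)}"

definition transition_function :: "'s measure \<Rightarrow> (real \<Rightarrow> 's \<Rightarrow> 's measure) \<Rightarrow> bool" where
  "transition_function S K \<longleftrightarrow>
     (\<forall>t>0. K t \<in> S \<rightarrow>\<^sub>M prob_algebra S) \<and>
     (\<forall>s>0. \<forall>t>0. \<forall>x\<in>space S. K (s + t) x = K s x \<bind> K t)"

definition kernel_apply ::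
  "(real \<Rightarrow> 's \<Rightarrow> 's measure) \<Rightarrow> real \<Rightarrow> ('s \<Rightarrow> 'b::{banach, second_countable_topology}) \<Rightarrow> 's \<Rightarrow> 'b"
  where "kernel_apply K t f x = (\<integral>y. f y \<partial>K t x)"

text \<open>The operators \<open>f \<mapsto> kernel_apply K t f\<close> form the semigroup \<open>exp(-t A)\<close> in \<open>L\<^sup>2(\<mu>)\<close>, that is, the
  strongly continuous contraction semigroup whose infinitesimal generator, with its full domain, is
  \<open>-A\<close>.  Contractivity also makes the operators well-defined on almost everywhere classes; the
  semigroup law is part of \<open>transition_function\<close>.\<close>

definition is_exp_semigroup ::
  "'s measure \<Rightarrow> (real \<Rightarrow> 's \<Rightarrow> 's measure)
     \<Rightarrow> (('s \<Rightarrow> 'b::{banach, second_countable_topology}) \<times> ('s \<Rightarrow> 'b)) set \<Rightarrow> bool" where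
  "is_exp_semigroup \<mu> K A \<longleftrightarrow>
     (\<forall>t>0. \<forall>f\<in>(L2 \<mu> :: ('s \<Rightarrow> 'b) set).
        kernel_apply K t f \<in> L2 \<mu> \<and> L2_norm \<mu> (kernel_apply K t f) \<le> L2_norm \<mu> f) \<and>
     (\<forall>f\<in>(L2 \<mu> :: ('s \<Rightarrow> 'b) set).
        ((\<lambda>t. L2_norm \<mu> (\<lambda>x. kernel_apply K t f x - f x)) \<longlongrightarrow> 0) (at_right 0)) \<and>
     A = {(f, g). f \<in> L2 \<mu> \<and> g \<in> L2 \<mu> \<and>
        ((\<lambda>t. L2_norm \<mu> (\<lambda>x. (f x - kernel_apply K t f x) /\<^sub>R t - g x)) \<longlongrightarrow> 0) (at_right 0)}"


section \<open>Markov processes\<close>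

definition natural_filtration :: "'w measure \<Rightarrow> 's measure \<Rightarrow> (real \<Rightarrow> 'w \<Rightarrow> 's) \<Rightarrow> real \<Rightarrow> 'w measure"
  where "natural_filtration M S X s =
     sigma (space M) {X r -` B \<inter> space M | r B. 0 < r \<and> r \<le> s \<and> B \<in> sets S}"

text \<open>A time-homogeneous Markov process \<open>(X t)\<close>, \<open>t > 0\<close>, with transition function \<open>K\<close>; \<open>P x\<close> is the law
  of the process started at \<open>x\<close>.\<close>

definition markov_process ::
  "'s measure \<Rightarrow> (real \<Rightarrow> 's \<Rightarrow> 's measure) \<Rightarrow> ('s \<Rightarrow> 'w measure) \<Rightarrow> (real \<Rightarrow> 'w \<Rightarrow> 's) \<Rightarrow> bool" where
  "markov_process S K P X \<longleftrightarrow> transition_function S K \<and> (\<forall>x\<in>space S.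
     prob_space (P x) \<and>
     (\<forall>t>0. X t \<in> P x \<rightarrow>\<^sub>M S) \<and>
     (\<forall>t>0. distr (P x) S (X t) = K t x) \<and>
     (\<forall>s>0. \<forall>t>0. \<forall>B\<in>sets S. AE \<omega> in P x.
        real_cond_exp (P x) (natural_filtration (P x) S X s)
          (\<lambda>\<omega>'. indicator B (X (s + t) \<omega>')) \<omega> = measure (K t (X s \<omega>)) B))"

text \<open>The law of a process \<open>(X t)\<close>, \<open>t > 0\<close>, on the product \<open>\<sigma>\<close>-algebra of the path space.\<close>

definition process_law :: "'s measure \<Rightarrow> 'w measure \<Rightarrow> (real \<Rightarrow> 'w \<Rightarrow> 's) \<Rightarrow> (real \<Rightarrow> 's) measure" where
  "process_law S M X = distr M (\<Pi>\<^sub>M t\<in>{0<..}. S) (\<lambda>\<omega>. \<lambda>t\<in>{0<..}. X t \<omega>)"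

definition feller :: "nat \<Rightarrow> (real \<Rightarrow> padic \<Rightarrow> padic measure) \<Rightarrow> bool" where
  "feller p K \<longleftrightarrow> (\<forall>t>0. \<forall>f :: padic \<Rightarrow> real. continuous_map (Zp_topology p) euclideanreal f \<longrightarrow>
     continuous_map (Zp_topology p) euclideanreal (kernel_apply K t f))"


section \<open>The boundary process\<close>

definition harmonic_ext :: "(vertex \<Rightarrow> padic measure) \<Rightarrow> (padic \<Rightarrow> real) \<Rightarrow> vertex \<Rightarrow> real" where
  "harmonic_ext \<nu> \<phi> u = (\<integral>x. \<phi> x \<partial>\<nu> u)"

text \<open>The edges of the geodesic from the root to \<open>v\<close> are those joining \<open>pred p w\<close> and \<open>w\<close>, where \<open>w\<close>
  runs through the balls containing \<open>v\<close> other than the root.\<close>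

definition vertex_weight :: "nat \<Rightarrow> (vertex \<Rightarrow> vertex \<Rightarrow> real) \<Rightarrow> vertex \<Rightarrow> real" where
  "vertex_weight p q v =
     (\<Prod>w\<in>{w\<in>balls p. v \<subseteq> w \<and> w \<noteq> tree_root p}. q (pred p w) w / q w (pred p w))"

definition conductance :: "nat \<Rightarrow> (vertex \<Rightarrow> vertex \<Rightarrow> real) \<Rightarrow> vertex \<Rightarrow> real" where
  "conductance p q v = vertex_weight p q v * q v (pred p v)"

definition tree_summand :: "nat \<Rightarrow> (vertex \<Rightarrow> vertex \<Rightarrow> real)
    \<Rightarrow> (vertex \<Rightarrow> real) \<Rightarrow> (vertex \<Rightarrow> real) \<Rightarrow> vertex \<Rightarrow> real" where
  "tree_summand p q f g v = (f v - f (pred p v)) * (g v - g (pred p v)) * conductance p q v"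

definition tree_form :: "nat \<Rightarrow> (vertex \<Rightarrow> vertex \<Rightarrow> real) \<Rightarrow> (vertex \<Rightarrow> real) \<Rightarrow> (vertex \<Rightarrow> real) \<Rightarrow> real"
  where "tree_form p q f g = (\<Sum>\<^sub>\<infinity>v\<in>balls p - {tree_root p}. tree_summand p q f g v)"

definition HD_form :: "nat \<Rightarrow> (vertex \<Rightarrow> vertex \<Rightarrow> real) \<Rightarrow> (vertex \<Rightarrow> padic measure)
    \<Rightarrow> (padic \<Rightarrow> real) \<Rightarrow> (padic \<Rightarrow> real) \<Rightarrow> real" where
  "HD_form p q \<nu> \<phi> \<psi> = tree_form p q (harmonic_ext \<nu> \<phi>) (harmonic_ext \<nu> \<psi>)"

text \<open>Summability expresses finiteness of the energy, whose summands are nonnegative.\<close>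

definition HD_domain :: "nat \<Rightarrow> (vertex \<Rightarrow> vertex \<Rightarrow> real) \<Rightarrow> (vertex \<Rightarrow> padic measure)
    \<Rightarrow> (padic \<Rightarrow> real) set" where
  "HD_domain p q \<nu> = {\<phi> \<in> L2 (\<nu> (tree_root p)).
     tree_summand p q (harmonic_ext \<nu> \<phi>) (harmonic_ext \<nu> \<phi>) summable_on (balls p - {tree_root p})}"

text \<open>The operator associated with a closed symmetric form \<open>E\<close> with domain \<open>D\<close>.\<close>

definition form_operator :: "'s measure \<Rightarrow> ('s \<Rightarrow> real) set \<Rightarrow> (('s \<Rightarrow> real) \<Rightarrow> ('s \<Rightarrow> real) \<Rightarrow> real)
    \<Rightarrow> (('s \<Rightarrow> real) \<times> ('s \<Rightarrow> real)) set" where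
  "form_operator \<mu> D E =
     {(\<phi>, g). \<phi> \<in> D \<and> g \<in> L2 \<mu> \<and> (\<forall>\<psi>\<in>D. E \<phi> \<psi> = (\<integral>x. g x * \<psi> x \<partial>\<mu>))}"

text \<open>\<open>(X t)\<close> is the boundary process of the walk \<open>Z\<close> with transition probabilities \<open>q\<close>.\<close>

definition boundary_process :: "nat \<Rightarrow> (vertex \<Rightarrow> vertex \<Rightarrow> real)
    \<Rightarrow> (vertex \<Rightarrow> 'v measure) \<Rightarrow> (nat \<Rightarrow> 'v \<Rightarrow> vertex)
    \<Rightarrow> (real \<Rightarrow> padic \<Rightarrow> padic measure) \<Rightarrow> (padic \<Rightarrow> 'w measure) \<Rightarrow> (real \<Rightarrow> 'w \<Rightarrow> padic) \<Rightarrow> bool" where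
  "boundary_process p q P Z K Q X \<longleftrightarrow>
     (let \<nu> = exit_law p P Z in
        markov_process (Zp_borel p) K Q X \<and>
        is_exp_semigroup (\<nu> (tree_root p)) K
          (form_operator (\<nu> (tree_root p)) (HD_domain p q \<nu>) (HD_form p q \<nu>)))"


section \<open>The operator \<open>\<bbbD>\<^sup>\<alpha>\<close>\<close>

definition dual_group :: "nat \<Rightarrow> rat set" where
  "dual_group p = {of_nat m / of_nat p ^ n | m n. m < p ^ n \<and> 1 \<le> n}"

definition rat_padic_norm :: "nat \<Rightarrow> rat \<Rightarrow> real" where
  "rat_padic_norm p \<xi> = (if \<xi> = 0 then 0 else
     real p powr (real (multiplicity (int p) (snd (quotient_of \<xi>))) -
                  real (multiplicity (int p) (fst (quotient_of \<xi>)))))"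

text \<open>If \<open>\<xi>\<close> has denominator \<open>p\<^sup>n\<close>, then \<open>\<xi> x\<close> is congruent to \<open>\<xi> (x n)\<close> modulo \<open>\<int>\<^sub>p\<close>, and
  the character below is \<open>exp (2 \<pi> \<i> {\<xi> x})\<close> with \<open>{\<cdot>}\<close> the \<open>p\<close>-adic fractional part.\<close>

definition character :: "nat \<Rightarrow> rat \<Rightarrow> padic \<Rightarrow> complex" where
  "character p \<xi> x =
     cis (2 * pi * real_of_rat \<xi> * real_of_int (x (multiplicity (int p) (snd (quotient_of \<xi>)))))"

definition fourier :: "nat \<Rightarrow> padic measure \<Rightarrow> (padic \<Rightarrow> complex) \<Rightarrow> rat \<Rightarrow> complex" where
  "fourier p \<mu> f \<xi> = (\<integral>x. f x * cnj (character p \<xi> x) \<partial>\<mu>)"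

definition locally_constant :: "nat \<Rightarrow> (padic \<Rightarrow> 'b) \<Rightarrow> bool" where
  "locally_constant p f \<longleftrightarrow>
     (\<forall>x\<in>Zp p. \<exists>r>0. \<forall>y\<in>Metric_space.mball (Zp p) (padic_dist p) x r. f y = f x)"

text \<open>By uniqueness of Fourier coefficients this is the graph of an operator on \<open>L\<^sup>2(\<mu>)\<close>.\<close>

definition D_alpha :: "nat \<Rightarrow> padic measure \<Rightarrow> real \<Rightarrow> ((padic \<Rightarrow> complex) \<times> (padic \<Rightarrow> complex)) set" where
  "D_alpha p \<mu> \<alpha> = {(f, g). locally_constant p f \<and> g \<in> L2 \<mu> \<and>
     (\<forall>\<xi>\<in>dual_group p. fourier p \<mu> g \<xi> = of_real (rat_padic_norm p \<xi> powr \<alpha>) * fourier p \<mu> f \<xi>)}"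

definition driven_by_D_alpha :: "nat \<Rightarrow> padic measure \<Rightarrow> real
    \<Rightarrow> (real \<Rightarrow> padic \<Rightarrow> padic measure) \<Rightarrow> (padic \<Rightarrow> 'w measure) \<Rightarrow> (real \<Rightarrow> 'w \<Rightarrow> padic) \<Rightarrow> bool" where
  "driven_by_D_alpha p \<mu> \<alpha> K Q Y \<longleftrightarrow>
     markov_process (Zp_borel p) K Q Y \<and>
     is_exp_semigroup \<mu> K (operator_closure \<mu> (D_alpha p \<mu> \<alpha>))"

end

(* Both generators are diagonalized by the wavelets 1_B - 1_{B^-} / p, where B runs through the balls
   other than Z_p. A character whose conductor differs from p^n is orthogonal to the wavelet of a ball
   of level n, so the wavelet is an eigenfunction of D^alpha with eigenvalue p^(alpha n).
   For the walk, put F = (1 - c) / c = p^(-alpha), the probability of ever reaching v^- from v. By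
   symmetry the exit laws satisfy nu_v = F nu_{v^-} + (1 - F) mu_v, with mu_v the uniform law on the
   ball v; this turns the energy of the harmonic extension of a wavelet into a geometric series, and
   the eigenvalue for the Dirichlet form is (1 - F) F^(1 - n) = C p^(alpha n).
   Hence the two semigroups agree on indicators of balls after the time change, and the kernels agree
   almost everywhere for each fixed time. Since the heat trace is finite, the kernels have densities,
   and the Chapman-Kolmogorov equation removes the dependence of the null set on the time. *)

theory Submission
  imports Defs
begin

section \<open>Balls of the \<open>p\<close>-adic integers and Haar measure\<close>

text \<open>The semigroup hypotheses concern \<open>L2\<close> classes: at each fixed time they
  determine a kernel up to a null set of starting points, and the times are uncountable. So a point
  \<open>x\<close> is fixed that is good at all rational times. For arbitrary \<open>t\<close> and a
  rational \<open>r\<close> between \<open>0\<close> and \<open>t\<close>, \<open>K t x\<close>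
  averages \<open>K (t - r) y\<close> over \<open>y\<close> with law \<open>K r x\<close>; this law
  has a density, so the null set of \<open>y\<close> bad at the one time \<open>t - r\<close> is
  invisible. The same splitting makes \<open>K s x\<close> absolutely continuous for all
  \<open>s\<close>, as finite-dimensional distributions require: they evaluate later kernels at
  random positions. Each generator enters through the eigenpairs formed by the wavelets. An
  eigenpair passes to the semigroup by a telescoping sum over steps of length \<open>t / n\<close>,
  contractivity keeping the errors from growing. The ball masses of \<open>K t x\<close> then follow
  by recursion on the level, as a wavelet compares a ball with its parent. Wavelets are indexed by
  the level \<open>m\<close> of the parent ball, so the level \<open>n\<close> of the overview is
  \<open>Suc m\<close> here.\<close>

definition cyl :: "nat \<Rightarrow> nat \<Rightarrow> int \<Rightarrow> vertex" where
  "cyl p n r = {x \<in> Zp p. x n = r}"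

abbreviation residues_upto :: "nat \<Rightarrow> nat \<Rightarrow> int set" where
  "residues_upto p n \<equiv> {0..<int p ^ n}"

locale padic =
  fixes p :: nat
  assumes p_gt_1: "p > 1"
begin

lemma p_pos [simp]: "p > 0"
  using p_gt_1 by simp

lemma mod_pow_bounds [simp]: "0 \<le> r mod int p ^ n" "r mod int p ^ n < int p ^ n"
  using p_gt_1 by simp_all

sublocale Zp: Metric_space "Zp p" "padic_dist p"
  using p_gt_1 by (rule Metric_space_Zp)

lemma Zp_bounds: "x \<in> Zp p \<Longrightarrow> x n \<in> residues_upto p n"
  by (auto simp: Zp_def)

lemma Zp_0: "x \<in> Zp p \<Longrightarrow> x 0 = 0"
  using Zp_bounds[of x 0] by simp

text \<open>This is the image of the integer \<open>r\<close> in the \<open>p\<close>-adic integers.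
  It supplies points of cylinders and the translations used with Haar measure.\<close>

lemma residue_in_Zp: "(\<lambda>k. r mod int p ^ k) \<in> Zp p"
  by (simp add: Zp_def mod_mod_cancel)

lemma Zp_residue: "x \<in> Zp p \<Longrightarrow> x n mod int p ^ n = x n"
  by (simp add: Zp_mod)

lemma cyl_nonempty:
  assumes "r \<in> residues_upto p n"
  shows "(\<lambda>k. r mod int p ^ k) \<in> cyl p n r"
  using assms residue_in_Zp by (simp add: cyl_def)

lemma cyl_0: "cyl p 0 0 = Zp p"
  by (auto simp: cyl_def Zp_0)

lemma cyl_sub_Zp: "cyl p n r \<subseteq> Zp p"
  by (auto simp: cyl_def)

lemma mcball_eq_cyl:
  assumes "x \<in> Zp p"
  shows "Zp.mcball x (inverse (real p ^ n)) = cyl p n (x n)"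
  using assms padic_dist_le_iff[OF p_gt_1] by (auto simp: cyl_def)

lemma inverse_pow_le_iff: "inverse (real p ^ k) \<le> inverse (real p ^ n) \<longleftrightarrow> n \<le> k"
  using p_gt_1 by simp

text \<open>Distances take only the value zero and the values \<open>p^(-k)\<close>, so
  \<open>r\<close> can be lowered to the largest \<open>p^(-n)\<close> not exceeding it without
  changing any closed ball. Radii of at least one give \<open>n = 0\<close>.\<close>

lemma ball_radius:
  assumes "r > 0"
  obtains n where "\<And>x. Zp.mcball x r = Zp.mcball x (inverse (real p ^ n))"
proof -
  have "inverse (real p) < 1" using p_gt_1 by (simp add: field_simps)
  then obtain N where N: "inverse (real p ^ N) < r"
    using real_arch_pow_inv[OF assms, of "inverse (real p)"] by (auto simp: power_inverse)
  define n where "n = (LEAST n. inverse (real p ^ n) \<le> r)"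
  have n: "inverse (real p ^ n) \<le> r"
    unfolding n_def using less_imp_le[OF N] by (rule LeastI)
  have le: "inverse (real p ^ k) \<le> r \<longleftrightarrow> n \<le> k" for k
  proof
    assume "inverse (real p ^ k) \<le> r" then show "n \<le> k" unfolding n_def by (rule Least_le)
  next
    assume "n \<le> k" then show "inverse (real p ^ k) \<le> r"
      using inverse_pow_le_iff[of k n] n by linarith
  qed
  have "padic_dist p x y \<le> r \<longleftrightarrow> padic_dist p x y \<le> inverse (real p ^ n)" for x y
    by (cases rule: padic_dist_cases[of p x y]) (use assms le inverse_pow_le_iff in auto)
  then show ?thesis using that by (auto simp: Zp.mcball_def)
qed

lemma balls_eq: "balls p = {cyl p n r | n r. r \<in> residues_upto p n}"
proof (intro equalityI subsetI)
  fix B assume "B \<in> balls p"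
  then obtain x r where x: "x \<in> Zp p" "r > 0" "B = Zp.mcball x r" by (auto simp: balls_def)
  from ball_radius[OF x(2)] obtain n where "B = Zp.mcball x (inverse (real p ^ n))" using x by metis
  then have "B = cyl p n (x n)" using mcball_eq_cyl x by simp
  then show "B \<in> {cyl p n r | n r. r \<in> residues_upto p n}" using Zp_bounds[OF x(1)] by blast
next
  fix B assume "B \<in> {cyl p n r | n r. r \<in> residues_upto p n}"
  then obtain n r where B: "B = cyl p n r" "r \<in> residues_upto p n" by blast
  have "B = Zp.mcball (\<lambda>k. r mod int p ^ k) (inverse (real p ^ n))"
    using mcball_eq_cyl[OF residue_in_Zp, of r n] B by simp
  then show "B \<in> balls p" using residue_in_Zp[of r] p_gt_1 unfolding balls_def
    by (intro CollectI bexI[of _ "\<lambda>k. r mod int p ^ k"] exI[of _ "inverse (real p ^ n)"]) auto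
qed

lemma cyl_in_balls: "r \<in> residues_upto p n \<Longrightarrow> cyl p n r \<in> balls p"
  by (auto simp: balls_eq)

lemma ballsE:
  assumes "B \<in> balls p"
  obtains n r where "B = cyl p n r" "r \<in> residues_upto p n"
  using assms by (auto simp: balls_eq)

lemma root_in_balls: "Zp p \<in> balls p"
  using cyl_in_balls[of 0 0] by (simp add: cyl_0)

lemma countable_balls: "countable (balls p)"
proof -
  have "balls p \<subseteq> (\<lambda>(n, r). cyl p n r) ` UNIV" by (auto simp: balls_eq)
  then show ?thesis by (rule countable_subset) simp
qed

lemma residue_mod: "r mod int p ^ n \<in> residues_upto p n"
  by simp

lemma cyl_subset_iff:
  assumes "r \<in> residues_upto p n"
  shows "cyl p n r \<subseteq> cyl p m s \<longleftrightarrow> m \<le> n \<and> r mod int p ^ m = s"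
proof
  assume sub: "cyl p n r \<subseteq> cyl p m s"
  have s: "r mod int p ^ m = s" using sub cyl_nonempty[OF assms] by (auto simp: cyl_def)
  moreover have "m \<le> n"
  proof (rule ccontr)
    assume "\<not> m \<le> n"
    then have nm: "Suc n \<le> m" by simp
    \<comment> \<open>The integer \<open>r + p^n\<close> lies in the same level \<open>n\<close>
      cylinder as \<open>r\<close>, but the two differ modulo \<open>p^(n + 1)\<close>; a containing
      cylinder of greater level would have to identify them.\<close>
    have "(\<lambda>k. (r + int p ^ n) mod int p ^ k) \<in> cyl p n r"
      using residue_in_Zp[of "r + int p ^ n"] assms by (simp add: cyl_def)
    then have s2: "(r + int p ^ n) mod int p ^ m = s" using sub by (auto simp: cyl_def)
    have "(r + int p ^ n) mod int p ^ Suc n = r mod int p ^ Suc n"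
    proof -
      have "(r + int p ^ n) mod int p ^ m mod int p ^ Suc n = r mod int p ^ m mod int p ^ Suc n"
        using s s2 by simp
      then show ?thesis using nm by (simp add: mod_mod_cancel le_imp_power_dvd del: power_Suc)
    qed
    then have "int p ^ Suc n dvd int p ^ n"
      by (metis add_diff_cancel_left' mod_eq_dvd_iff)
    then show False using p_gt_1 by (simp add: dvd_power_iff_le)
  qed
  ultimately show "m \<le> n \<and> r mod int p ^ m = s" by simp
next
  assume "m \<le> n \<and> r mod int p ^ m = s"
  then show "cyl p n r \<subseteq> cyl p m s" by (auto simp: cyl_def Zp_mod)
qed

lemma cyl_eq_iff:
  assumes "r \<in> residues_upto p n" "s \<in> residues_upto p m"
  shows "cyl p n r = cyl p m s \<longleftrightarrow> n = m \<and> r = s"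
proof
  assume "cyl p n r = cyl p m s"
  then have "cyl p n r \<subseteq> cyl p m s" "cyl p m s \<subseteq> cyl p n r" by simp_all
  then show "n = m \<and> r = s"
    unfolding cyl_subset_iff[OF assms(1)] cyl_subset_iff[OF assms(2)] using assms by auto
qed simp

lemma cyl_eq_root_iff:
  assumes "r \<in> residues_upto p n"
  shows "cyl p n r = Zp p \<longleftrightarrow> n = 0"
  using cyl_eq_iff[OF assms, of 0 0] assms by (simp add: cyl_0) auto

lemma residue_mod_Suc: "(r mod int p ^ Suc n) mod int p ^ n = r mod int p ^ n"
  by (rule mod_mod_cancel) simp

text \<open>By \<open>cyl_subset_iff\<close> the balls around a given one form a chain with exactly
  one ball per level, so the smallest proper one is that whose level is smaller by one.\<close>

lemma pred_cyl:
  assumes "r \<in> residues_upto p (Suc n)"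
  shows "pred p (cyl p (Suc n) r) = cyl p n (r mod int p ^ n)"
  unfolding pred_def
proof (rule the_equality)
  let ?w = "cyl p n (r mod int p ^ n)"
  have m: "r mod int p ^ n \<in> residues_upto p n" by simp
  have sub: "cyl p (Suc n) r \<subset> ?w"
    using cyl_subset_iff[OF assms, of n] cyl_eq_iff[OF assms m] by (auto simp: psubset_eq)
  have min: "?w \<subseteq> w'" if w'b: "w' \<in> balls p" and sub': "cyl p (Suc n) r \<subset> w'" for w'
  proof -
    obtain k s where w': "w' = cyl p k s" "s \<in> residues_upto p k" by (rule ballsE[OF w'b])
    then have k: "k \<le> Suc n" "r mod int p ^ k = s" using cyl_subset_iff[OF assms, of k s] sub' by auto
    moreover have "k \<noteq> Suc n" using k sub' w' assms by auto
    ultimately have "k \<le> n" by simp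
    then show ?thesis using k w' cyl_subset_iff[OF m, of k s]
      by (simp add: mod_mod_cancel le_imp_power_dvd)
  qed
  show "?w \<in> balls p \<and> cyl p (Suc n) r \<subset> ?w \<and> (\<forall>w'\<in>balls p. cyl p (Suc n) r \<subset> w' \<longrightarrow> ?w \<subseteq> w')"
    using cyl_in_balls[OF m] sub min by blast
  show "w = ?w" if "w \<in> balls p \<and> cyl p (Suc n) r \<subset> w \<and> (\<forall>w'\<in>balls p. cyl p (Suc n) r \<subset> w' \<longrightarrow> w \<subseteq> w')" for w
    using that min[of w] cyl_in_balls[OF m] sub by blast
qed

lemma cyl_disjoint_or_subset:
  assumes "m \<le> n"
  shows "cyl p n r \<subseteq> cyl p m s \<or> cyl p n r \<inter> cyl p m s = {}"
proof -
  have *: "x m = r mod int p ^ m" if "x \<in> cyl p n r" for x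
    using that Zp_mod[OF _ assms, of x p] by (auto simp: cyl_def)
  show ?thesis
  proof (cases "r mod int p ^ m = s")
    case True
    then have "x \<in> cyl p m s" if "x \<in> cyl p n r" for x
      using *[OF that] that by (simp add: cyl_def)
    then show ?thesis by blast
  next
    case False
    then have "x \<notin> cyl p m s" if "x \<in> cyl p n r" for x
      using *[OF that] by (simp add: cyl_def)
    then show ?thesis by blast
  qed
qed

lemma openin_cyl: "openin Zp.mtopology (cyl p n r)"
  unfolding Zp.openin_mtopology
proof (intro conjI allI impI)
  show "cyl p n r \<subseteq> Zp p" by (rule cyl_sub_Zp)
  fix x assume x: "x \<in> cyl p n r"
  then have "Zp.mcball x (inverse (real p ^ n)) = cyl p n r"
    using mcball_eq_cyl[of x n] by (auto simp: cyl_def)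
  moreover have "Zp.mball x (inverse (real p ^ n)) \<subseteq> Zp.mcball x (inverse (real p ^ n))"
    by (rule Zp.mball_subset_mcball)
  ultimately show "\<exists>e>0. Zp.mball x e \<subseteq> cyl p n r"
    using p_gt_1 by (intro exI[of _ "inverse (real p ^ n)"]) auto
qed

lemma open_contains_cyl:
  assumes "openin Zp.mtopology U" "x \<in> U"
  obtains n where "cyl p n (x n) \<subseteq> U"
proof -
  from assms obtain e where e: "e > 0" "Zp.mcball x e \<subseteq> U" and U: "U \<subseteq> Zp p"
    unfolding Zp.openin_mtopology_mcball by blast
  obtain n where "Zp.mcball x e = Zp.mcball x (inverse (real p ^ n))"
    using ball_radius[OF e(1)] by metis
  then have "cyl p n (x n) \<subseteq> U" using e mcball_eq_cyl[of x n] U assms(2) by auto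
  then show ?thesis by (rule that)
qed

lemma space_Zp_borel [simp]: "space (Zp_borel p) = Zp p"
  unfolding Zp_borel_def by (rule space_measure_of) (use openin_subset in fastforce)

text \<open>Every open set is a union of balls, and this union is countable because there are only
  countably many balls.\<close>

lemma sets_Zp_borel: "sets (Zp_borel p) = sigma_sets (Zp p) (balls p)"
proof -
  have eq: "sets (Zp_borel p) = sigma_sets (Zp p) {U. openin Zp.mtopology U}"
    unfolding Zp_borel_def by (rule sets_measure_of) (use openin_subset in fastforce)
  also have "\<dots> = sigma_sets (Zp p) (balls p)"
  proof (rule sigma_sets_eqI)
    fix U assume U: "U \<in> {U. openin Zp.mtopology U}"
    then have oU: "openin Zp.mtopology U" by simp
    then have sub: "U \<subseteq> Zp p" using openin_subset by fastforce
    define \<B> where "\<B> = {B \<in> balls p. B \<subseteq> U}"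
    have "U = \<Union>\<B>"
    proof (intro equalityI subsetI)
      fix x assume x: "x \<in> U"
      then have xZ: "x \<in> Zp p" using sub by blast
      obtain n where "cyl p n (x n) \<subseteq> U" using open_contains_cyl[OF oU x] by blast
      moreover have "x \<in> cyl p n (x n)" using xZ by (simp add: cyl_def)
      ultimately show "x \<in> \<Union>\<B>"
        unfolding \<B>_def using cyl_in_balls[OF Zp_bounds[OF xZ]] by blast
    qed (auto simp: \<B>_def)
    moreover have "countable \<B>" unfolding \<B>_def using countable_balls by (rule countable_subset[rotated]) auto
    moreover have "\<B> \<subseteq> sigma_sets (Zp p) (balls p)" unfolding \<B>_def by auto
    ultimately show "U \<in> sigma_sets (Zp p) (balls p)"
      using sigma_sets_UNION[of \<B>] by (metis subsetD)
  next
    fix B assume "B \<in> balls p"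
    then show "B \<in> sigma_sets (Zp p) {U. openin Zp.mtopology U}"
      using openin_cyl by (auto elim!: ballsE)
  qed
  finally show ?thesis .
qed

lemma balls_sub: "balls p \<subseteq> Pow (Zp p)"
  using cyl_sub_Zp by (auto elim!: ballsE)

lemma ball_in_sets [measurable]: "B \<in> balls p \<Longrightarrow> B \<in> sets (Zp_borel p)"
  by (auto simp: sets_Zp_borel)

lemma cyl_in_sets [measurable, simp]: "cyl p n r \<in> sets (Zp_borel p)"
proof (cases "r \<in> residues_upto p n")
  case False
  then have "cyl p n r = {}" using Zp_bounds by (force simp: cyl_def)
  then show ?thesis by simp
qed (simp add: ball_in_sets cyl_in_balls del: atLeastLessThan_iff)

text \<open>Two balls are nested or disjoint, so the balls together with the empty set form an
  intersection-stable generator; the whole space is itself a ball, of finite measure.\<close>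

lemma Zp_measure_eqI:
  assumes "sets M = sets (Zp_borel p)" "sets N = sets (Zp_borel p)" "finite_measure M"
    and eq: "\<And>n r. r \<in> residues_upto p n \<Longrightarrow> emeasure M (cyl p n r) = emeasure N (cyl p n r)"
  shows "M = N"
proof (rule measure_eqI_generator_eq[where E = "insert {} (balls p)" and \<Omega> = "Zp p" and A = "\<lambda>_. Zp p"])
  have gen: "sigma_sets (Zp p) (insert {} (balls p)) = sets (Zp_borel p)"
    unfolding sets_Zp_borel by (rule sigma_sets_eqI) (auto intro: sigma_sets.Empty)
  then show "sets M = sigma_sets (Zp p) (insert {} (balls p))" "sets N = sigma_sets (Zp p) (insert {} (balls p))"
    using assms by simp_all
  show "Int_stable (insert {} (balls p))"
  proof (rule Int_stableI)
    fix A B assume AB: "A \<in> insert {} (balls p)" "B \<in> insert {} (balls p)"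
    show "A \<inter> B \<in> insert {} (balls p)"
    proof (cases "A = {} \<or> B = {}")
      case False
      then have "A \<in> balls p" "B \<in> balls p" using AB by auto
      then obtain n r m s where *: "A = cyl p n r" "B = cyl p m s"
        by (metis ballsE)
      have "A \<subseteq> B \<or> B \<subseteq> A \<or> A \<inter> B = {}"
        using cyl_disjoint_or_subset[of m n r s] cyl_disjoint_or_subset[of n m s r] * by (cases "m \<le> n") auto
      then show ?thesis using AB by (metis Int_absorb1 Int_absorb2 insertI1)
    qed auto
  qed
  show "insert {} (balls p) \<subseteq> Pow (Zp p)" using balls_sub by auto
  show "range (\<lambda>_. Zp p) \<subseteq> insert {} (balls p)" using root_in_balls by auto
  show "emeasure M X = emeasure N X" if "X \<in> insert {} (balls p)" for X
    using that eq by (auto elim!: ballsE)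
  show "emeasure M (Zp p) \<noteq> \<infinity>" using assms(3) by (simp add: finite_measure.emeasure_eq_measure)
qed auto

lemma cyl_split:
  assumes "m \<le> n"
  shows "cyl p m r = (\<Union>s\<in>{s \<in> residues_upto p n. s mod int p ^ m = r}. cyl p n s)"
proof (intro equalityI subsetI)
  fix x assume x: "x \<in> cyl p m r"
  then have xZ: "x \<in> Zp p" by (simp add: cyl_def)
  show "x \<in> (\<Union>s\<in>{s \<in> residues_upto p n. s mod int p ^ m = r}. cyl p n s)"
  proof (rule UN_I[of "x n"])
    show "x n \<in> {s \<in> residues_upto p n. s mod int p ^ m = r}"
      using Zp_bounds[OF xZ, of n] Zp_mod[OF xZ assms] x by (simp add: cyl_def)
    show "x \<in> cyl p n (x n)" using xZ by (simp add: cyl_def)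
  qed
next
  fix x assume "x \<in> (\<Union>s\<in>{s \<in> residues_upto p n. s mod int p ^ m = r}. cyl p n s)"
  then show "x \<in> cyl p m r" using assms by (auto simp: cyl_def Zp_mod)
qed

lemma disjoint_cyl: "disjoint_family_on (cyl p n) A"
  by (auto simp: disjoint_family_on_def cyl_def)

end

section \<open>Haar measure of cylinders\<close>

locale padic_haar = padic +
  fixes \<mu> :: "padic measure"
  assumes haar: "haar_prob p \<mu>"
begin

sublocale prob_space \<mu>
  using haar by (simp add: haar_prob_def)

lemma sets_haar [measurable_cong, simp]: "sets \<mu> = sets (Zp_borel p)"
  using haar by (simp add: haar_prob_def)

lemma space_haar [simp]: "space \<mu> = Zp p"
  using sets_eq_imp_space_eq[OF sets_haar] by simp

lemma padic_add_in_Zp: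
  assumes "a \<in> Zp p" "x \<in> Zp p"
  shows "padic_add p a x \<in> Zp p"
proof -
  have "(a (Suc n) + x (Suc n)) mod int p ^ Suc n mod int p ^ n = (a n + x n) mod int p ^ n" for n
  proof -
    have "(a (Suc n) + x (Suc n)) mod int p ^ Suc n mod int p ^ n
        = (a (Suc n) mod int p ^ n + x (Suc n) mod int p ^ n) mod int p ^ n"
      by (simp add: residue_mod_Suc mod_add_eq del: power_Suc)
    then show ?thesis using assms by (simp add: Zp_mod)
  qed
  then show ?thesis by (simp add: Zp_def padic_add_def)
qed

lemma padic_add_vimage:
  assumes "a \<in> Zp p" "r \<in> residues_upto p n"
  shows "padic_add p a -` cyl p n r \<inter> Zp p = cyl p n ((r - a n) mod int p ^ n)"
proof -
  have "(a n + x n) mod int p ^ n = r \<longleftrightarrow> x n = (r - a n) mod int p ^ n" if "x \<in> Zp p" for x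
  proof
    assume "(a n + x n) mod int p ^ n = r"
    then have "(r - a n) mod int p ^ n = (a n + x n - a n) mod int p ^ n"
      by (metis mod_diff_left_eq)
    then show "x n = (r - a n) mod int p ^ n" using Zp_residue[OF that] by simp
  next
    assume "x n = (r - a n) mod int p ^ n"
    then have "(a n + x n) mod int p ^ n = (a n + (r - a n)) mod int p ^ n"
      by (simp add: mod_add_right_eq)
    then show "(a n + x n) mod int p ^ n = r" using assms by simp
  qed
  then have "padic_add p a x n = r \<longleftrightarrow> x n = (r - a n) mod int p ^ n" if "x \<in> Zp p" for x
    using that by (simp add: padic_add_def)
  then show ?thesis using padic_add_in_Zp[OF assms(1)] by (auto simp: cyl_def)
qed

lemma measurable_padic_add [measurable]:
  assumes "a \<in> Zp p"
  shows "padic_add p a \<in> Zp_borel p \<rightarrow>\<^sub>M Zp_borel p"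
proof (rule measurable_sigma_sets[OF sets_Zp_borel balls_sub])
  show "padic_add p a \<in> space (Zp_borel p) \<rightarrow> Zp p" using padic_add_in_Zp[OF assms] by auto
  show "padic_add p a -` B \<inter> space (Zp_borel p) \<in> sets (Zp_borel p)" if "B \<in> balls p" for B
    using that padic_add_vimage[OF assms] by (auto elim!: ballsE)
qed

lemma measure_cyl_shift:
  assumes "r \<in> residues_upto p n" "a \<in> Zp p"
  shows "measure \<mu> (cyl p n ((r - a n) mod int p ^ n)) = measure \<mu> (cyl p n r)"
proof -
  have "measure \<mu> (cyl p n r) = measure (distr \<mu> (Zp_borel p) (padic_add p a)) (cyl p n r)"
    using haar assms(2) by (simp add: haar_prob_def)
  also have "\<dots> = measure \<mu> (padic_add p a -` cyl p n r \<inter> Zp p)"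
    using assms(2) by (subst measure_distr) auto
  finally show ?thesis using padic_add_vimage[OF assms(2,1)] by simp
qed

text \<open>Translations by integers carry the cylinders of one level into each other, so these have
  equal measure, and \<open>p^n\<close> of them partition the space.\<close>

lemma measure_cyl:
  assumes "r \<in> residues_upto p n"
  shows "measure \<mu> (cyl p n r) = inverse (real p ^ n)"
proof -
  have eq: "measure \<mu> (cyl p n s) = measure \<mu> (cyl p n 0)" if "s \<in> residues_upto p n" for s
    using measure_cyl_shift[OF that residue_in_Zp[of s]] that by simp
  have "1 = measure \<mu> (cyl p 0 0)" using prob_space by (simp add: cyl_0)
  also have "cyl p 0 0 = (\<Union>s\<in>residues_upto p n. cyl p n s)"
  proof -
    have *: "{s \<in> residues_upto p n. s mod int p ^ 0 = 0} = residues_upto p n" by auto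
    show ?thesis using cyl_split[OF le0, of 0 n] unfolding * .
  qed
  also have "measure \<mu> \<dots> = (\<Sum>s\<in>residues_upto p n. measure \<mu> (cyl p n s))"
    by (rule finite_measure_finite_Union) (auto simp: disjoint_cyl)
  also have "\<dots> = (\<Sum>s\<in>residues_upto p n. measure \<mu> (cyl p n 0))"
    by (rule sum.cong[OF refl eq])
  also have "\<dots> = real p ^ n * measure \<mu> (cyl p n 0)"
    by simp
  finally have "measure \<mu> (cyl p n 0) = inverse (real p ^ n)"
    by (metis inverse_unique)
  then show ?thesis using eq[OF assms] by metis
qed

end

section \<open>Eigenfunctions of contraction semigroups\<close>

lemma L2_norm_nonneg [simp]: "L2_norm \<mu> f \<ge> 0"
  by (simp add: L2_norm_def)

lemma L2_norm_power2: "(L2_norm \<mu> f)\<^sup>2 = (\<integral>x. (norm (f x))\<^sup>2 \<partial>\<mu>)"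
  by (simp add: L2_norm_def)

lemma L2_norm_cmult:
  fixes f :: "'s \<Rightarrow> real"
  shows "L2_norm \<mu> (\<lambda>x. k * f x) = \<bar>k\<bar> * L2_norm \<mu> f"
  by (simp add: L2_norm_def power_mult_distrib real_sqrt_mult)

text \<open>Young's inequality: the two sides differ by \<open>(b * u - a * v)^2 / (a * b)\<close>.
  When \<open>a\<close> and \<open>b\<close> are the norms of \<open>u\<close> and \<open>v\<close>,
  the right-hand side integrates to \<open>(a + b)^2\<close>.\<close>

lemma weighted_square_sum_le:
  fixes u v a b :: real
  assumes "a > 0" "b > 0"
  shows "(u + v)\<^sup>2 \<le> (1 + b / a) * u\<^sup>2 + (1 + a / b) * v\<^sup>2"
proof -
  have "0 \<le> (b * u - a * v)\<^sup>2 / (a * b)" using assms by simp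
  also have "\<dots> = (1 + b / a) * u\<^sup>2 + (1 + a / b) * v\<^sup>2 - (u + v)\<^sup>2"
    using assms by (simp add: field_simps power2_eq_square)
  finally show ?thesis by simp
qed

lemma L2_add:
  fixes f g :: "'s \<Rightarrow> real"
  assumes "f \<in> L2 \<mu>" "g \<in> L2 \<mu>"
  shows "(\<lambda>x. f x + g x) \<in> L2 \<mu>"
proof -
  have m: "f \<in> borel_measurable \<mu>" "g \<in> borel_measurable \<mu>"
    and i: "integrable \<mu> (\<lambda>x. (f x)\<^sup>2)" "integrable \<mu> (\<lambda>x. (g x)\<^sup>2)"
    using assms by (simp_all add: L2_def)
  have "integrable \<mu> (\<lambda>x. (f x + g x)\<^sup>2)"
  proof (rule Bochner_Integration.integrable_bound)
    show "integrable \<mu> (\<lambda>x. 2 * (f x)\<^sup>2 + 2 * (g x)\<^sup>2)" using i by simp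
    show "AE x in \<mu>. norm ((f x + g x)\<^sup>2) \<le> norm (2 * (f x)\<^sup>2 + 2 * (g x)\<^sup>2)"
      using weighted_square_sum_le[of 1 1] by simp
  qed (use m in simp)
  then show ?thesis using m by (simp add: L2_def)
qed

lemma L2_cmult:
  fixes f :: "'s \<Rightarrow> real"
  assumes "f \<in> L2 \<mu>"
  shows "(\<lambda>x. k * f x) \<in> L2 \<mu>"
  using assms by (auto simp: L2_def power_mult_distrib)

text \<open>Minkowski's inequality follows from the weighted bound, the weights being chosen from upper
  bounds of the two norms.\<close>

lemma L2_norm_triangle:
  fixes f g :: "'s \<Rightarrow> real"
  assumes "f \<in> L2 \<mu>" "g \<in> L2 \<mu>"
  shows "L2_norm \<mu> (\<lambda>x. f x + g x) \<le> L2_norm \<mu> f + L2_norm \<mu> g"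
proof (rule field_le_epsilon)
  fix e :: real assume e: "e > 0"
  define a b where "a = L2_norm \<mu> f + e / 2" and "b = L2_norm \<mu> g + e / 2"
  have pos: "a > 0" "b > 0" using e by (simp_all add: a_def b_def add_nonneg_pos)
  have i: "integrable \<mu> (\<lambda>x. (f x)\<^sup>2)" "integrable \<mu> (\<lambda>x. (g x)\<^sup>2)" "integrable \<mu> (\<lambda>x. (f x + g x)\<^sup>2)"
    using assms L2_add[OF assms] by (simp_all add: L2_def)
  have le: "(L2_norm \<mu> f)\<^sup>2 \<le> a\<^sup>2" "(L2_norm \<mu> g)\<^sup>2 \<le> b\<^sup>2"
    using e by (auto intro!: power_mono simp: a_def b_def)
  have "(L2_norm \<mu> (\<lambda>x. f x + g x))\<^sup>2 = (\<integral>x. (f x + g x)\<^sup>2 \<partial>\<mu>)"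
    by (simp add: L2_norm_power2)
  also have "\<dots> \<le> (\<integral>x. (1 + b / a) * (f x)\<^sup>2 + (1 + a / b) * (g x)\<^sup>2 \<partial>\<mu>)"
    using i by (intro integral_mono weighted_square_sum_le pos) auto
  also have "\<dots> = (1 + b / a) * (L2_norm \<mu> f)\<^sup>2 + (1 + a / b) * (L2_norm \<mu> g)\<^sup>2"
    using i by (simp add: L2_norm_power2)
  also have "\<dots> \<le> (1 + b / a) * a\<^sup>2 + (1 + a / b) * b\<^sup>2"
    using pos le by (intro add_mono mult_left_mono) auto
  also have "\<dots> = (a + b)\<^sup>2"
  proof -
    have "(1 + b / a) * a\<^sup>2 = a * a + a * b" "(1 + a / b) * b\<^sup>2 = b * b + a * b"
      using pos by (simp_all add: power2_eq_square distrib_right)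
    then show ?thesis by (simp add: power2_eq_square ring_distribs)
  qed
  finally have "L2_norm \<mu> (\<lambda>x. f x + g x) \<le> a + b"
    by (rule power2_le_imp_le) (use pos in simp)
  then show "L2_norm \<mu> (\<lambda>x. f x + g x) \<le> L2_norm \<mu> f + L2_norm \<mu> g + e" by (simp add: a_def b_def)
qed

text \<open>Unlike general elements of \<open>L2\<close>, bounded functions are integrable against
  every single measure \<open>K t x\<close>, so semigroup identities for them hold at every point
  and not only almost everywhere.\<close>

definition bounded_measurable :: "'s measure \<Rightarrow> ('s \<Rightarrow> real) \<Rightarrow> bool" where
  "bounded_measurable S f \<longleftrightarrow> f \<in> borel_measurable S \<and> (\<exists>M. \<forall>x\<in>space S. \<bar>f x\<bar> \<le> M)"

lemma bounded_measurable_add: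
  assumes "bounded_measurable S f" "bounded_measurable S g"
  shows "bounded_measurable S (\<lambda>x. a * f x + b * g x)"
proof -
  from assms obtain M N where f: "f \<in> borel_measurable S" "\<And>x. x \<in> space S \<Longrightarrow> \<bar>f x\<bar> \<le> M"
    and g: "g \<in> borel_measurable S" "\<And>x. x \<in> space S \<Longrightarrow> \<bar>g x\<bar> \<le> N"
    unfolding bounded_measurable_def by blast
  have "\<bar>a * f x + b * g x\<bar> \<le> \<bar>a\<bar> * M + \<bar>b\<bar> * N" if "x \<in> space S" for x
  proof -
    have "\<bar>a * f x + b * g x\<bar> \<le> \<bar>a\<bar> * \<bar>f x\<bar> + \<bar>b\<bar> * \<bar>g x\<bar>"
      by (metis abs_mult abs_triangle_ineq)
    also have "\<dots> \<le> \<bar>a\<bar> * M + \<bar>b\<bar> * N"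
      using f(2)[OF that] g(2)[OF that] by (intro add_mono mult_left_mono) auto
    finally show ?thesis .
  qed
  then show ?thesis using f(1) g(1) unfolding bounded_measurable_def by auto
qed

lemma (in finite_measure) bounded_measurable_integrable:
  assumes "bounded_measurable M f"
  shows "integrable M f"
proof -
  from assms obtain B where "f \<in> borel_measurable M" "\<And>x. x \<in> space M \<Longrightarrow> \<bar>f x\<bar> \<le> B"
    unfolding bounded_measurable_def by blast
  then show ?thesis by (intro integrable_const_bound[where B = B]) auto
qed

lemma bounded_measurable_cong: "sets M = sets N \<Longrightarrow> bounded_measurable M f \<longleftrightarrow> bounded_measurable N f"
  unfolding bounded_measurable_def using sets_eq_imp_space_eq[of M N] measurable_cong_sets[of M N borel borel]
  by auto

lemma (in finite_measure) bounded_measurable_L2: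
  assumes "bounded_measurable M f"
  shows "f \<in> L2 M"
proof -
  from assms obtain B where B: "f \<in> borel_measurable M" "\<And>x. x \<in> space M \<Longrightarrow> \<bar>f x\<bar> \<le> B"
    unfolding bounded_measurable_def by blast
  have "integrable M (\<lambda>x. (f x)\<^sup>2)"
  proof (rule integrable_const_bound[where B = "B\<^sup>2"])
    show "AE x in M. norm ((f x)\<^sup>2) \<le> B\<^sup>2"
    proof (rule AE_I2)
      fix x assume "x \<in> space M"
      then have "\<bar>f x\<bar>\<^sup>2 \<le> B\<^sup>2" using B(2) by (intro power_mono) auto
      then show "norm ((f x)\<^sup>2) \<le> B\<^sup>2" by simp
    qed
  qed (use B in simp)
  then show ?thesis using B by (simp add: L2_def)
qed

section \<open>Transition kernels acting on bounded functions\<close>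

locale transition =
  fixes S :: "'s measure" and K :: "real \<Rightarrow> 's \<Rightarrow> 's measure"
  assumes tf: "transition_function S K"
begin

lemma K_measurable: "t > 0 \<Longrightarrow> K t \<in> S \<rightarrow>\<^sub>M prob_algebra S"
  using tf by (simp add: transition_function_def)

lemma K_subprob: "t > 0 \<Longrightarrow> K t \<in> S \<rightarrow>\<^sub>M subprob_algebra S"
  using K_measurable by (rule measurable_prob_algebraD)

lemma K_prob: "t > 0 \<Longrightarrow> x \<in> space S \<Longrightarrow> prob_space (K t x)"
  using measurable_space[OF K_measurable] by (auto simp: space_prob_algebra)

lemma K_sets: "t > 0 \<Longrightarrow> x \<in> space S \<Longrightarrow> sets (K t x) = sets S"
  using measurable_space[OF K_measurable] by (auto simp: space_prob_algebra)

lemma K_space: "t > 0 \<Longrightarrow> x \<in> space S \<Longrightarrow> space (K t x) = space S"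
  using K_sets sets_eq_imp_space_eq by blast

lemma K_add: "s > 0 \<Longrightarrow> t > 0 \<Longrightarrow> x \<in> space S \<Longrightarrow> K (s + t) x = K s x \<bind> K t"
  using tf by (simp add: transition_function_def)

lemma emeasure_K_add:
  assumes "s > 0" "t > 0" "x \<in> space S" "B \<in> sets S"
  shows "emeasure (K (s + t) x) B = (\<integral>\<^sup>+y. emeasure (K t y) B \<partial>K s x)"
proof -
  have "K t \<in> K s x \<rightarrow>\<^sub>M subprob_algebra S"
    using K_subprob[OF assms(2)] measurable_cong_sets[OF K_sets[OF assms(1,3)] refl] by blast
  then show ?thesis
    unfolding K_add[OF assms(1-3)]
    by (rule emeasure_bind[rotated]) (use assms prob_space.not_empty[OF K_prob] in auto)
qed

lemma kernel_apply_bounded_measurable: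
  assumes "t > 0" "bounded_measurable S f"
  shows "bounded_measurable S (kernel_apply K t f)"
proof -
  from assms obtain M where f: "f \<in> borel_measurable S" "\<And>x. x \<in> space S \<Longrightarrow> \<bar>f x\<bar> \<le> M"
    unfolding bounded_measurable_def by blast
  have "kernel_apply K t f \<in> borel_measurable S"
    unfolding kernel_apply_def
    using measurable_compose[OF K_subprob[OF assms(1)] integral_measurable_subprob_algebra[OF f(1)]] .
  moreover have "\<bar>kernel_apply K t f x\<bar> \<le> M" if x: "x \<in> space S" for x
  proof -
    interpret prob_space "K t x" using K_prob assms(1) x .
    have m: "integrable (K t x) f"
      using bounded_measurable_integrable bounded_measurable_cong[OF K_sets] assms x by blast
    have "\<bar>\<integral>y. f y \<partial>K t x\<bar> \<le> (\<integral>y. \<bar>f y\<bar> \<partial>K t x)" by (rule integral_abs_bound)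
    also have "\<dots> \<le> (\<integral>y. M \<partial>K t x)"
      using m f(2) K_space[OF assms(1) x] by (intro integral_mono) auto
    finally show ?thesis by (simp add: kernel_apply_def prob_space)
  qed
  ultimately show ?thesis unfolding bounded_measurable_def by blast
qed

lemma kernel_apply_linear:
  assumes "t > 0" "bounded_measurable S f" "bounded_measurable S g" "x \<in> space S"
  shows "kernel_apply K t (\<lambda>x. a * f x + b * g x) x = a * kernel_apply K t f x + b * kernel_apply K t g x"
proof -
  interpret prob_space "K t x" using K_prob assms(1,4) .
  have "integrable (K t x) f" "integrable (K t x) g"
    using bounded_measurable_integrable bounded_measurable_cong[OF K_sets] assms by blast+
  then show ?thesis by (simp add: kernel_apply_def)
qed

lemma kernel_apply_add:
  assumes "s > 0" "t > 0" "bounded_measurable S f" "x \<in> space S"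
  shows "kernel_apply K (s + t) f x = kernel_apply K s (kernel_apply K t f) x"
proof -
  from assms(3) obtain M where f: "f \<in> borel_measurable S" "\<And>x. x \<in> space S \<Longrightarrow> \<bar>f x\<bar> \<le> M"
    unfolding bounded_measurable_def by blast
  \<comment> \<open>The integral formula for \<open>bind\<close> is for nonnegative functions.
    Adding the bound \<open>M\<close> makes \<open>f\<close> nonnegative, and since the kernels are
    Markov the shift reappears unchanged as the constant \<open>M\<close>.\<close>
  define g where "g x = 1 * f x + M * 1" for x
  have one: "bounded_measurable S (\<lambda>_. 1)" unfolding bounded_measurable_def by auto
  have g: "bounded_measurable S g" unfolding g_def by (rule bounded_measurable_add[OF assms(3) one])
  have g0: "g x \<ge> 0" if "x \<in> space S" for x using f(2)[OF that] by (simp add: g_def)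
  have const: "kernel_apply K r (\<lambda>_. 1::real) y = 1" if "r > 0" "y \<in> space S" for r y
    using prob_space.prob_space[OF K_prob[OF that]] by (simp add: kernel_apply_def)
  have nn: "ennreal (kernel_apply K r h y) = (\<integral>\<^sup>+z. ennreal (h z) \<partial>K r y)"
    if "r > 0" "y \<in> space S" "bounded_measurable S h" "\<And>z. z \<in> space S \<Longrightarrow> h z \<ge> 0" for r y h
  proof -
    interpret prob_space "K r y" using K_prob that(1,2) .
    have "integrable (K r y) h"
      using bounded_measurable_integrable bounded_measurable_cong[OF K_sets] that by blast
    then show ?thesis unfolding kernel_apply_def
      by (subst nn_integral_eq_integral) (use that K_space in auto)
  qed
  have g0': "kernel_apply K t g z \<ge> 0" if "z \<in> space S" for z
    unfolding kernel_apply_def using g0 K_space[OF assms(2) that] by (intro integral_nonneg_AE) auto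
  have g0'': "kernel_apply K s (kernel_apply K t g) x \<ge> 0"
    unfolding kernel_apply_def[of K s] using g0' K_space[OF assms(1,4)] by (intro integral_nonneg_AE) auto
  have g0''': "kernel_apply K (s + t) g x \<ge> 0"
    unfolding kernel_apply_def using g0 K_space[of "s + t" x] assms by (intro integral_nonneg_AE) auto
  have "ennreal (kernel_apply K (s + t) g x) = (\<integral>\<^sup>+z. ennreal (g z) \<partial>K (s + t) x)"
    using assms g g0 by (intro nn) auto
  also have "\<dots> = (\<integral>\<^sup>+y. \<integral>\<^sup>+z. ennreal (g z) \<partial>K t y \<partial>K s x)"
    unfolding K_add[OF assms(1,2,4)]
  proof (rule nn_integral_bind)
    show "(\<lambda>z. ennreal (g z)) \<in> borel_measurable S" using g by (auto simp: bounded_measurable_def)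
    show "K t \<in> K s x \<rightarrow>\<^sub>M subprob_algebra S"
      using K_subprob[OF assms(2)] measurable_cong_sets[OF K_sets[OF assms(1,4)] refl] by blast
  qed
  also have "\<dots> = (\<integral>\<^sup>+y. ennreal (kernel_apply K t g y) \<partial>K s x)"
    using assms g g0 K_space[OF assms(1,4)] by (intro nn_integral_cong nn[symmetric]) auto
  also have "\<dots> = ennreal (kernel_apply K s (kernel_apply K t g) x)"
    using assms g g0' by (intro nn[symmetric] kernel_apply_bounded_measurable) auto
  finally have eq: "kernel_apply K (s + t) g x = kernel_apply K s (kernel_apply K t g) x"
    using g0'' g0''' by simp
  have cg: "kernel_apply K r h y = kernel_apply K r h' y"
    if "r > 0" "y \<in> space S" "\<And>z. z \<in> space S \<Longrightarrow> h z = h' z" for r y and h h' :: "'s \<Rightarrow> real"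
    unfolding kernel_apply_def using that K_space by (intro Bochner_Integration.integral_cong) auto
  have lin: "kernel_apply K r g y = kernel_apply K r f y + M" if "r > 0" "y \<in> space S" for r y
    unfolding g_def kernel_apply_linear[OF that(1) assms(3) one that(2)] using const[OF that] by simp
  have "kernel_apply K s (kernel_apply K t g) x
     = kernel_apply K s (\<lambda>y. 1 * kernel_apply K t f y + M * 1) x"
    using lin assms by (intro cg) auto
  also have "\<dots> = kernel_apply K s (kernel_apply K t f) x + M"
    using kernel_apply_linear[OF assms(1) kernel_apply_bounded_measurable[OF assms(2,3)] one assms(4), of 1 M]
      const assms by simp
  finally show ?thesis using eq lin[of "s + t" x] assms by simp
qed

end

text \<open>Contractivity is asked of bounded real functions only, so that the form semigroup on
  real \<open>L2\<close> and the semigroup of \<open>D_alpha\<close> on complex \<open>L2\<close>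
  can both be instances.\<close>

locale contraction_semigroup = transition S K + finite_measure \<mu>
  for S :: "'s measure" and K and \<mu> :: "'s measure" +
  assumes sets_mu: "sets \<mu> = sets S"
    and contraction: "\<And>t f. t > 0 \<Longrightarrow> bounded_measurable S f \<Longrightarrow>
          L2_norm \<mu> (kernel_apply K t f) \<le> L2_norm \<mu> f"
begin

lemma space_mu: "space \<mu> = space S"
  using sets_mu by (rule sets_eq_imp_space_eq)

lemma L2_bm: "bounded_measurable S f \<Longrightarrow> f \<in> L2 \<mu>"
  using bounded_measurable_L2 bounded_measurable_cong[OF sets_mu] by blast

lemma L2_norm_cong:
  assumes "\<And>x. x \<in> space S \<Longrightarrow> f x = g x"
  shows "L2_norm \<mu> f = L2_norm \<mu> g"
  unfolding L2_norm_def using assms space_mu by (metis (no_types, lifting) Bochner_Integration.integral_cong)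

text \<open>Let \<open>e = K h f - exp (- l * h) * f\<close> be the defect of one step. Then
  \<open>exp (l * (m + h)) * K (m + h) f - f\<close> equals
  \<open>exp (l * (m + h)) * K m e + (exp (l * m) * K m f - f)\<close>. Contractivity bounds
  \<open>K m e\<close> by \<open>e\<close>, so every further step adds at most one defect times the
  exponential.\<close>

lemma eigenfunction_iterate:
  fixes l h :: real
  assumes "h > 0" "l \<ge> 0" and f: "bounded_measurable S f"
  shows "L2_norm \<mu> (\<lambda>x. exp (l * (real (Suc n) * h)) * kernel_apply K (real (Suc n) * h) f x - f x)
       \<le> real (Suc n) * exp (l * (real (Suc n) * h)) * L2_norm \<mu> (\<lambda>x. kernel_apply K h f x - exp (- l * h) * f x)"
    (is "_ \<le> _ * _ * ?d")
proof (induction n)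
  case 0
  have "L2_norm \<mu> (\<lambda>x. exp (l * h) * kernel_apply K h f x - f x)
      = L2_norm \<mu> (\<lambda>x. exp (l * h) * (kernel_apply K h f x - exp (- l * h) * f x))"
    by (intro L2_norm_cong) (simp add: right_diff_distrib flip: mult.assoc exp_add)
  then show ?case by (simp add: L2_norm_cmult)
next
  case (Suc n)
  define m where "m = real (Suc n) * h"
  have m: "m > 0" using assms by (simp add: m_def)
  have m': "real (Suc (Suc n)) * h = m + h" by (simp add: m_def algebra_simps)
  define e where "e x = 1 * kernel_apply K h f x + (- exp (- l * h)) * f x" for x
  have bm: "bounded_measurable S (kernel_apply K h f)" "bounded_measurable S (kernel_apply K m f)"
    using kernel_apply_bounded_measurable f assms m by blast+
  have e: "bounded_measurable S e"
    unfolding e_def by (rule bounded_measurable_add[OF bm(1) f])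
  have Ke: "kernel_apply K m e x = kernel_apply K (m + h) f x - exp (- l * h) * kernel_apply K m f x"
    if "x \<in> space S" for x
    unfolding e_def kernel_apply_linear[OF m bm(1) f that]
    using kernel_apply_add[OF m assms(1) f that] by simp
  have "L2_norm \<mu> (\<lambda>x. exp (l * (m + h)) * kernel_apply K (m + h) f x - f x)
      = L2_norm \<mu> (\<lambda>x. exp (l * (m + h)) * kernel_apply K m e x + (exp (l * m) * kernel_apply K m f x + (-1) * f x))"
    by (intro L2_norm_cong) (simp add: Ke right_diff_distrib distrib_left flip: mult.assoc exp_add)
  also have "\<dots> \<le> L2_norm \<mu> (\<lambda>x. exp (l * (m + h)) * kernel_apply K m e x)
      + L2_norm \<mu> (\<lambda>x. exp (l * m) * kernel_apply K m f x + (-1) * f x)"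
    by (intro L2_norm_triangle L2_cmult L2_bm kernel_apply_bounded_measurable bounded_measurable_add m e f bm)
  also have "\<dots> \<le> exp (l * (m + h)) * ?d + real (Suc n) * exp (l * m) * ?d"
  proof (rule add_mono)
    have "L2_norm \<mu> (\<lambda>x. exp (l * (m + h)) * kernel_apply K m e x) = exp (l * (m + h)) * L2_norm \<mu> (kernel_apply K m e)"
      by (simp add: L2_norm_cmult)
    also have "\<dots> \<le> exp (l * (m + h)) * L2_norm \<mu> e"
      using contraction[OF m e] by simp
    finally show "L2_norm \<mu> (\<lambda>x. exp (l * (m + h)) * kernel_apply K m e x) \<le> exp (l * (m + h)) * ?d"
      by (simp add: e_def[abs_def])
    show "L2_norm \<mu> (\<lambda>x. exp (l * m) * kernel_apply K m f x + (-1) * f x) \<le> real (Suc n) * exp (l * m) * ?d"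
      using Suc by (simp add: m_def)
  qed
  also have "\<dots> \<le> exp (l * (m + h)) * ?d + real (Suc n) * exp (l * (m + h)) * ?d"
    using assms by (intro add_left_mono mult_right_mono mult_left_mono) (auto intro: mult_left_mono)
  also have "\<dots> = real (Suc (Suc n)) * exp (l * (m + h)) * ?d" by (simp add: algebra_simps)
  finally show ?case unfolding m' .
qed

text \<open>The assumption \<open>gen\<close> makes the one-step defect \<open>?d h\<close> of
  smaller order than \<open>h\<close>. In steps of length \<open>h = t / (n + 1)\<close> the total
  error is at most \<open>exp (l * t) * t * (?d h / h)\<close>, which tends to zero.\<close>

lemma eigenfunction_semigroup:
  fixes l t :: real
  assumes "t > 0" "l \<ge> 0" and f: "bounded_measurable S f"
    and gen: "((\<lambda>t. L2_norm \<mu> (\<lambda>x. (f x - kernel_apply K t f x) /\<^sub>R t - l * f x)) \<longlongrightarrow> 0) (at_right 0)"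
  shows "AE x in \<mu>. kernel_apply K t f x = exp (- l * t) * f x"
proof -
  let ?d = "\<lambda>h. L2_norm \<mu> (\<lambda>x. kernel_apply K h f x - exp (- l * h) * f x)"
  let ?G = "\<lambda>t. L2_norm \<mu> (\<lambda>x. (f x - kernel_apply K t f x) /\<^sub>R t - l * f x)"
  \<comment> \<open>The defect is measured against \<open>exp (- l * h) * f\<close>, the generator
    against \<open>f - h * l * f\<close>. The last term is the discrepancy; it vanishes with
    \<open>h\<close> because the exponential has derivative \<open>- l\<close> at zero.\<close>
  have d_le: "?d h / h \<le> ?G h + \<bar>(exp (- l * h) - 1) / h + l\<bar> * L2_norm \<mu> f" if h: "h > 0" for h
  proof -
    have bm: "bounded_measurable S (kernel_apply K h f)"
      using kernel_apply_bounded_measurable f h by blast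
    have gb: "bounded_measurable S (\<lambda>x. (f x - kernel_apply K h f x) /\<^sub>R h - l * f x)"
    proof -
      have "(\<lambda>x. (f x - kernel_apply K h f x) /\<^sub>R h - l * f x)
          = (\<lambda>x. (1 / h - l) * f x + (- 1 / h) * kernel_apply K h f x)"
        by (simp add: fun_eq_iff divide_inverse algebra_simps)
      then show ?thesis using bounded_measurable_add[OF f bm] by (simp only:)
    qed
    have "?d h / h = L2_norm \<mu> (\<lambda>x. (1 / h) * (kernel_apply K h f x - exp (- l * h) * f x))"
      using h by (simp only: L2_norm_cmult) simp
    also have "\<dots> = L2_norm \<mu> (\<lambda>x. (-1) * ((f x - kernel_apply K h f x) /\<^sub>R h - l * f x)
         + (- ((exp (- l * h) - 1) / h + l)) * f x)"
      using h by (intro L2_norm_cong) (simp add: field_simps)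
    also have "\<dots> \<le> L2_norm \<mu> (\<lambda>x. (-1) * ((f x - kernel_apply K h f x) /\<^sub>R h - l * f x))
         + L2_norm \<mu> (\<lambda>x. (- ((exp (- l * h) - 1) / h + l)) * f x)"
      by (intro L2_norm_triangle L2_cmult L2_bm f gb)
    also have "\<dots> = ?G h + \<bar>(exp (- l * h) - 1) / h + l\<bar> * L2_norm \<mu> f"
      by (simp only: L2_norm_cmult abs_minus_cancel abs_one mult_1)
    finally show ?thesis .
  qed
  have "((\<lambda>h. (exp (- l * h) - exp (- l * 0)) / (h - 0)) \<longlongrightarrow> - l) (at_right 0)"
  proof -
    have "((\<lambda>h. exp (- l * h)) has_real_derivative - l) (at 0)"
      by (auto intro!: derivative_eq_intros)
    then show ?thesis
      unfolding has_field_derivative_iff by (rule tendsto_within_subset) simp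
  qed
  then have "((\<lambda>h. \<bar>(exp (- l * h) - 1) / h + l\<bar> * L2_norm \<mu> f) \<longlongrightarrow> \<bar>- l + l\<bar> * L2_norm \<mu> f) (at_right 0)"
    by (intro tendsto_intros) simp
  from tendsto_add[OF gen this]
  have "((\<lambda>h. ?G h + \<bar>(exp (- l * h) - 1) / h + l\<bar> * L2_norm \<mu> f) \<longlongrightarrow> 0) (at_right 0)"
    by simp
  then have lim: "((\<lambda>h. ?d h / h) \<longlongrightarrow> 0) (at_right 0)"
  proof (rule tendsto_sandwich[rotated 2, OF tendsto_const])
    show "\<forall>\<^sub>F h in at_right 0. 0 \<le> ?d h / h"
      using eventually_at_right_less[of 0] by eventually_elim simp
    show "\<forall>\<^sub>F h in at_right 0. ?d h / h \<le> ?G h + \<bar>(exp (- l * h) - 1) / h + l\<bar> * L2_norm \<mu> f"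
      using eventually_at_right_less[of 0] by eventually_elim (rule d_le)
  qed
  have "filterlim (\<lambda>n. t / real (Suc n)) (at_right 0) sequentially"
    unfolding filterlim_at
    using assms(1) LIMSEQ_Suc[OF lim_const_over_n[of t]] by auto
  from filterlim_compose[OF lim this]
  have "(\<lambda>n. exp (l * t) * t * (?d (t / real (Suc n)) / (t / real (Suc n)))) \<longlonglongrightarrow> exp (l * t) * t * 0"
    by (intro tendsto_intros)
  moreover have "L2_norm \<mu> (\<lambda>x. exp (l * t) * kernel_apply K t f x - f x)
      \<le> exp (l * t) * t * (?d (t / real (Suc n)) / (t / real (Suc n)))" for n
    using eigenfunction_iterate[of "t / real (Suc n)" l f n] assms by (simp add: field_simps del: of_nat_Suc)
  ultimately have "L2_norm \<mu> (\<lambda>x. exp (l * t) * kernel_apply K t f x - f x) \<le> 0"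
    by (intro LIMSEQ_le_const[where a = "L2_norm \<mu> (\<lambda>x. exp (l * t) * kernel_apply K t f x - f x)"]) auto
  then have "L2_norm \<mu> (\<lambda>x. exp (l * t) * kernel_apply K t f x + (-1) * f x) = 0"
    by (simp add: order_antisym)
  then have "(\<integral>x. (exp (l * t) * kernel_apply K t f x + (-1) * f x)\<^sup>2 \<partial>\<mu>) = 0"
    by (simp add: L2_norm_def)
  moreover have "(\<lambda>x. exp (l * t) * kernel_apply K t f x + (-1) * f x) \<in> L2 \<mu>"
    by (intro L2_bm bounded_measurable_add kernel_apply_bounded_measurable assms f)
  ultimately have "AE x in \<mu>. (exp (l * t) * kernel_apply K t f x + (-1) * f x)\<^sup>2 = 0"
    by (subst (asm) integral_nonneg_eq_0_iff_AE) (auto simp: L2_def)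
  then show ?thesis
  proof eventually_elim
    case (elim x)
    then have "exp (l * t) * kernel_apply K t f x = f x" by simp
    then have "exp (- l * t) * (exp (l * t) * kernel_apply K t f x) = exp (- l * t) * f x" by simp
    then show ?case by (simp flip: mult.assoc exp_add)
  qed
qed

end

section \<open>Countable Markov chains\<close>

locale countable_chain = prob_space M
  for M :: "'w measure" and V :: "'v set" and q :: "'v \<Rightarrow> 'v \<Rightarrow> real" and u :: 'v and Z :: "nat \<Rightarrow> 'w \<Rightarrow> 'v" +
  assumes countable_V: "countable V"
    and q_nonneg: "\<And>x y. q x y \<ge> 0"
    and Z_meas: "\<And>n. Z n \<in> M \<rightarrow>\<^sub>M count_space V"
    and cylinder_prob: "\<And>n v. (\<And>i. i \<le> n \<Longrightarrow> v i \<in> V) \<Longrightarrow>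
        measure M {\<omega> \<in> space M. \<forall>i\<le>n. Z i \<omega> = v i} =
          (if v 0 = u then (\<Prod>i<n. q (v i) (v (Suc i))) else 0)"
begin

lemma Z_in_V: "\<omega> \<in> space M \<Longrightarrow> Z n \<omega> \<in> V"
  using measurable_space[OF Z_meas] by simp

lemma Z_event: "x \<in> V \<Longrightarrow> {\<omega> \<in> space M. Z n \<omega> = x} \<in> sets M"
proof -
  assume "x \<in> V"
  then have "Z n -` {x} \<inter> space M \<in> sets M" by (intro measurable_sets[OF Z_meas]) simp
  also have "Z n -` {x} \<inter> space M = {\<omega> \<in> space M. Z n \<omega> = x}" by auto
  finally show ?thesis .
qed

lemma path_sets:
  assumes "\<And>i. i < n \<Longrightarrow> v i \<in> V"
  shows "{\<omega> \<in> space M. \<forall>i<n. Z i \<omega> = v i} \<in> sets M"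
  using assms
proof (induction n)
  case (Suc n)
  have "{\<omega> \<in> space M. \<forall>i<Suc n. Z i \<omega> = v i} = {\<omega> \<in> space M. \<forall>i<n. Z i \<omega> = v i} \<inter> {\<omega> \<in> space M. Z n \<omega> = v n}"
    by (auto simp: less_Suc_eq)
  moreover have "{\<omega> \<in> space M. \<forall>i<n. Z i \<omega> = v i} \<in> sets M"
    by (rule Suc.IH) (simp add: Suc.prems)
  moreover have "{\<omega> \<in> space M. Z n \<omega> = v n} \<in> sets M"
    by (rule Z_event) (simp add: Suc.prems)
  ultimately show ?case by (simp only: sets.Int)
qed simp

text \<open>The first \<open>n\<close> states follow one of countably many paths, which partition
  the space. This reduces statements about the state at time \<open>n\<close> to the product formula
  for fully specified paths.\<close>

lemma split_paths:
  assumes "A \<in> sets M"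
  shows "emeasure M A = (\<integral>\<^sup>+v. emeasure M (A \<inter> {\<omega> \<in> space M. \<forall>i<n. Z i \<omega> = v i}) \<partial>count_space (Pi\<^sub>E {..<n} (\<lambda>_. V)))"
proof -
  have "A = (\<Union>v\<in>Pi\<^sub>E {..<n} (\<lambda>_. V). A \<inter> {\<omega> \<in> space M. \<forall>i<n. Z i \<omega> = v i})" (is "_ = ?U")
  proof (intro equalityI subsetI)
    fix \<omega> assume \<omega>: "\<omega> \<in> A"
    then have "\<omega> \<in> space M" using assms sets.sets_into_space by blast
    then show "\<omega> \<in> ?U" using \<omega> Z_in_V
      by (intro UN_I[of "\<lambda>i\<in>{..<n}. Z i \<omega>"]) auto
  qed auto
  then have "emeasure M A = emeasure M ?U" by simp
  also have "\<dots> = (\<integral>\<^sup>+v. emeasure M (A \<inter> {\<omega> \<in> space M. \<forall>i<n. Z i \<omega> = v i}) \<partial>count_space (Pi\<^sub>E {..<n} (\<lambda>_. V)))"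
  proof (rule emeasure_UN_countable)
    show "A \<inter> {\<omega> \<in> space M. \<forall>i<n. Z i \<omega> = v i} \<in> sets M" if "v \<in> Pi\<^sub>E {..<n} (\<lambda>_. V)" for v
      using that by (intro sets.Int assms path_sets) auto
    show "countable (Pi\<^sub>E {..<n} (\<lambda>_. V))" using countable_V by (intro countable_PiE) auto
    show "disjoint_family_on (\<lambda>v. A \<inter> {\<omega> \<in> space M. \<forall>i<n. Z i \<omega> = v i}) (Pi\<^sub>E {..<n} (\<lambda>_. V))"
      unfolding disjoint_family_on_def
    proof (intro ballI impI)
      fix v w assume vw: "v \<in> Pi\<^sub>E {..<n} (\<lambda>_. V)" "w \<in> Pi\<^sub>E {..<n} (\<lambda>_. V)" "v \<noteq> w"
      then obtain i where "i < n" "v i \<noteq> w i" using PiE_ext[OF vw(1,2)] by auto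
      then show "(A \<inter> {\<omega> \<in> space M. \<forall>i<n. Z i \<omega> = v i}) \<inter> (A \<inter> {\<omega> \<in> space M. \<forall>i<n. Z i \<omega> = w i}) = {}"
        by force
    qed
  qed
  finally show ?thesis .
qed

lemma two_step:
  assumes x: "x \<in> V" and y: "y \<in> V"
  shows "emeasure M {\<omega> \<in> space M. Z n \<omega> = x \<and> Z (Suc n) \<omega> = y}
       = ennreal (q x y) * emeasure M {\<omega> \<in> space M. Z n \<omega> = x}"
proof -
  let ?A = "{\<omega> \<in> space M. Z n \<omega> = x}" and ?B = "{\<omega> \<in> space M. Z n \<omega> = x \<and> Z (Suc n) \<omega> = y}"
  let ?C = "\<lambda>v. {\<omega> \<in> space M. \<forall>i<n. Z i \<omega> = v i}"
  let ?I = "count_space (Pi\<^sub>E {..<n} (\<lambda>_. V))"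
  have A: "?A \<in> sets M" using Z_event x by simp
  have "?B = ?A \<inter> {\<omega> \<in> space M. Z (Suc n) \<omega> = y}" by auto
  then have B: "?B \<in> sets M" using A Z_event[OF y] by auto
  have "emeasure M ?B = (\<integral>\<^sup>+v. emeasure M (?B \<inter> ?C v) \<partial>?I)" by (rule split_paths[OF B])
  also have "\<dots> = (\<integral>\<^sup>+v. ennreal (q x y) * emeasure M (?A \<inter> ?C v) \<partial>?I)"
  proof (rule nn_integral_cong)
    fix v assume "v \<in> space ?I"
    then have v: "\<And>i. i < n \<Longrightarrow> v i \<in> V" by auto
    \<comment> \<open>The path \<open>w\<close> is the history \<open>v\<close> continued by
      \<open>x\<close> at time \<open>n\<close> and \<open>y\<close> at time \<open>n + 1\<close>;
      the two products then differ by the single factor \<open>q x y\<close>.\<close>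
    define w where "w = v(n := x, Suc n := y)"
    have wV: "w i \<in> V" if "i \<le> Suc n" for i using that v x y by (auto simp: w_def)
    have "?A \<inter> ?C v = {\<omega> \<in> space M. \<forall>i\<le>n. Z i \<omega> = w i}"
      by (auto simp: w_def le_less)
    then have a: "measure M (?A \<inter> ?C v) = (if w 0 = u then (\<Prod>i<n. q (w i) (w (Suc i))) else 0)"
      using cylinder_prob[of n w] wV by simp
    have "?B \<inter> ?C v = {\<omega> \<in> space M. \<forall>i\<le>Suc n. Z i \<omega> = w i}"
      by (auto simp: w_def le_less less_Suc_eq)
    then have b: "measure M (?B \<inter> ?C v) = (if w 0 = u then (\<Prod>i<Suc n. q (w i) (w (Suc i))) else 0)"
      using cylinder_prob[of "Suc n" w] wV by simp
    have "measure M (?B \<inter> ?C v) = q x y * measure M (?A \<inter> ?C v)"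
      unfolding a b by (simp add: w_def)
    then show "emeasure M (?B \<inter> ?C v) = ennreal (q x y) * emeasure M (?A \<inter> ?C v)"
      by (simp add: emeasure_eq_measure ennreal_mult q_nonneg)
  qed
  also have "\<dots> = ennreal (q x y) * (\<integral>\<^sup>+v. emeasure M (?A \<inter> ?C v) \<partial>?I)"
    by (rule nn_integral_cmult) simp
  also have "\<dots> = ennreal (q x y) * emeasure M ?A" by (simp only: split_paths[OF A, of n])
  finally show ?thesis .
qed

lemma nn_integral_Z:
  "(\<integral>\<^sup>+\<omega>. g (Z n \<omega>) \<partial>M) = (\<integral>\<^sup>+x. g x * emeasure M {\<omega> \<in> space M. Z n \<omega> = x} \<partial>count_space V)"
proof -
  have "(\<integral>\<^sup>+\<omega>. g (Z n \<omega>) \<partial>M) = (\<integral>\<^sup>+x. g x \<partial>distr M (count_space V) (Z n))"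
    by (subst nn_integral_distr[OF Z_meas]) auto
  also have "distr M (count_space V) (Z n) = density (count_space V) (\<lambda>x. emeasure M {\<omega> \<in> space M. Z n \<omega> = x})"
  proof (rule measure_eqI_countable)
    fix a assume a: "a \<in> V"
    have "emeasure (distr M (count_space V) (Z n)) {a} = emeasure M {\<omega> \<in> space M. Z n \<omega> = a}"
      using a by (subst emeasure_distr[OF Z_meas]) (auto intro: arg_cong[where f = "emeasure M"])
    moreover have "emeasure (density (count_space V) (\<lambda>x. emeasure M {\<omega> \<in> space M. Z n \<omega> = x})) {a}
        = (\<Sum>x\<in>{a}. emeasure M {\<omega> \<in> space M. Z n \<omega> = x} * indicator {a} x)"
      using a by (subst emeasure_density) (auto intro!: nn_integral_count_space')
    ultimately show "emeasure (distr M (count_space V) (Z n)) {a}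
        = emeasure (density (count_space V) (\<lambda>x. emeasure M {\<omega> \<in> space M. Z n \<omega> = x})) {a}" by simp
  qed (auto simp: countable_V)
  also have "(\<integral>\<^sup>+x. g x \<partial>density (count_space V) (\<lambda>x. emeasure M {\<omega> \<in> space M. Z n \<omega> = x}))
      = (\<integral>\<^sup>+x. g x * emeasure M {\<omega> \<in> space M. Z n \<omega> = x} \<partial>count_space V)"
    by (subst nn_integral_density) (auto simp: mult.commute)
  finally show ?thesis .
qed

text \<open>The Markov property as the action of the transition operator on functions. Summing
  \<open>two_step\<close> over the previous state gives the law at the next time, and Tonelli
  exchanges the two sums.\<close>

lemma nn_integral_Suc:
  "(\<integral>\<^sup>+\<omega>. g (Z (Suc n) \<omega>) \<partial>M) = (\<integral>\<^sup>+\<omega>. (\<integral>\<^sup>+y. ennreal (q (Z n \<omega>) y) * g y \<partial>count_space V) \<partial>M)"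
proof -
  let ?P = "\<lambda>n x. emeasure M {\<omega> \<in> space M. Z n \<omega> = x}"
  have P: "?P (Suc n) y = (\<integral>\<^sup>+x. ennreal (q x y) * ?P n x \<partial>count_space V)" if y: "y \<in> V" for y
  proof -
    have "{\<omega> \<in> space M. Z (Suc n) \<omega> = y} = (\<Union>x\<in>V. {\<omega> \<in> space M. Z n \<omega> = x \<and> Z (Suc n) \<omega> = y})"
      using Z_in_V by auto
    moreover have "emeasure M \<dots> = (\<integral>\<^sup>+x. emeasure M {\<omega> \<in> space M. Z n \<omega> = x \<and> Z (Suc n) \<omega> = y} \<partial>count_space V)"
    proof (rule emeasure_UN_countable)
      show "{\<omega> \<in> space M. Z n \<omega> = x \<and> Z (Suc n) \<omega> = y} \<in> sets M" if "x \<in> V" for x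
        using sets.Int[OF Z_event[OF that, of n] Z_event[OF y, of "Suc n"]] by (auto simp: Int_def conj_ac)
    qed (auto simp: countable_V disjoint_family_on_def)
    ultimately show ?thesis using two_step[OF _ y] by (auto intro: nn_integral_cong)
  qed
  have "(\<integral>\<^sup>+\<omega>. g (Z (Suc n) \<omega>) \<partial>M) = (\<integral>\<^sup>+y. g y * ?P (Suc n) y \<partial>count_space V)"
    by (rule nn_integral_Z)
  also have "\<dots> = (\<integral>\<^sup>+y. \<integral>\<^sup>+x. g y * (ennreal (q x y) * ?P n x) \<partial>count_space V \<partial>count_space V)"
    using P by (auto intro!: nn_integral_cong simp: nn_integral_cmult)
  also have "\<dots> = (\<integral>\<^sup>+x. \<integral>\<^sup>+y. g y * (ennreal (q x y) * ?P n x) \<partial>count_space V \<partial>count_space V)"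
    by (rule nn_integral_count_space_nn_integral[OF countable_V]) simp
  also have "\<dots> = (\<integral>\<^sup>+x. (\<integral>\<^sup>+y. ennreal (q x y) * g y \<partial>count_space V) * ?P n x \<partial>count_space V)"
    by (auto intro!: nn_integral_cong simp: nn_integral_multc[symmetric] ac_simps)
  also have "\<dots> = (\<integral>\<^sup>+\<omega>. (\<integral>\<^sup>+y. ennreal (q (Z n \<omega>) y) * g y \<partial>count_space V) \<partial>M)"
    by (rule nn_integral_Z[symmetric])
  finally show ?thesis .
qed

text \<open>By \<open>two_step\<close> a single forbidden transition is a null event, and there are
  countably many times and pairs of states. Later this says that the walk almost surely moves along
  edges of the tree.\<close>

lemma AE_transition: "AE \<omega> in M. \<forall>n. q (Z n \<omega>) (Z (Suc n) \<omega>) \<noteq> 0"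
proof -
  have "AE \<omega> in M. Z n \<omega> = x \<longrightarrow> Z (Suc n) \<omega> = y \<longrightarrow> q x y \<noteq> 0" if "x \<in> V" "y \<in> V" for n x y
  proof (cases "q x y = 0")
    case True
    have "{\<omega> \<in> space M. Z n \<omega> = x \<and> Z (Suc n) \<omega> = y} \<in> null_sets M"
      using two_step[OF that, of n] True sets.Int[OF Z_event[OF that(1), of n] Z_event[OF that(2), of "Suc n"]]
      by (auto simp: null_sets_def Int_def conj_ac)
    then show ?thesis by (rule AE_I') auto
  qed simp
  then have "AE \<omega> in M. \<forall>n. \<forall>x\<in>V. \<forall>y\<in>V. Z n \<omega> = x \<longrightarrow> Z (Suc n) \<omega> = y \<longrightarrow> q x y \<noteq> 0"
    unfolding AE_all_countable AE_ball_countable[OF countable_V] by blast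
  then show ?thesis using AE_space by eventually_elim (auto simp: Z_in_V)
qed

lemma AE_start: 
  assumes "u \<in> V"
  shows "AE \<omega> in M. Z 0 \<omega> = u"
proof -
  have "prob {\<omega> \<in> space M. Z 0 \<omega> = u} = 1"
    using cylinder_prob[of 0 "\<lambda>_. u"] assms by simp
  then have "AE \<omega> in M. \<omega> \<in> {\<omega> \<in> space M. Z 0 \<omega> = u}" by (rule AE_prob_1)
  then show ?thesis by simp
qed

end

section \<open>Markov processes and their laws\<close>

definition path_event :: "'w measure \<Rightarrow> (real \<Rightarrow> 'w \<Rightarrow> 's) \<Rightarrow> real set \<Rightarrow> (real \<Rightarrow> 's set) \<Rightarrow> 'w set" where
  "path_event M X J A = {\<omega> \<in> space M. \<forall>i\<in>J. X i \<omega> \<in> A i}"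

text \<open>The Markov property tested on events fixed by finitely many past times. This form has no
  filtration or conditional expectation in it, so it passes directly through a time change and can
  be used in an induction on the times.\<close>

definition markov_fdd ::
  "'s measure \<Rightarrow> (real \<Rightarrow> 's \<Rightarrow> 's measure) \<Rightarrow> 's \<Rightarrow> 'w measure \<Rightarrow> (real \<Rightarrow> 'w \<Rightarrow> 's) \<Rightarrow> bool" where
  "markov_fdd S K x M X \<longleftrightarrow> prob_space M \<and> (\<forall>t>0. X t \<in> M \<rightarrow>\<^sub>M S) \<and>
     (\<forall>t>0. distr M S (X t) = K t x) \<and>
     (\<forall>s>0. \<forall>t>0. \<forall>J A B. finite J \<and> J \<subseteq> {0<..s} \<and> (\<forall>i\<in>J. A i \<in> sets S) \<and> B \<in> sets S \<longrightarrow>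
        emeasure M (path_event M X J A \<inter> (X (s + t) -` B \<inter> space M)) =
          (\<integral>\<^sup>+\<omega>. indicator (path_event M X J A) \<omega> * emeasure (K t (X s \<omega>)) B \<partial>M))"

lemma markov_fdd_step:
  assumes "markov_fdd S K x M X" "s > 0" "t > 0" "finite J" "J \<subseteq> {0<..s}"
    and "\<And>i. i \<in> J \<Longrightarrow> A i \<in> sets S" "B \<in> sets S"
  shows "emeasure M (path_event M X J A \<inter> (X (s + t) -` B \<inter> space M)) =
          (\<integral>\<^sup>+\<omega>. indicator (path_event M X J A) \<omega> * emeasure (K t (X s \<omega>)) B \<partial>M)"
  using assms(1)[unfolded markov_fdd_def, THEN conjunct2, THEN conjunct2, THEN conjunct2, rule_format,
      OF assms(2,3), of J A B] assms(4-) by simp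

lemma path_event_insert:
  "path_event M X (insert b J) A = path_event M X J A \<inter> (X b -` A b \<inter> space M)"
  by (auto simp: path_event_def)

lemma path_event_sets:
  assumes "finite J" "\<And>i. i \<in> J \<Longrightarrow> X i \<in> M \<rightarrow>\<^sub>M S" "\<And>i. i \<in> J \<Longrightarrow> A i \<in> sets S"
  shows "path_event M X J A \<in> sets M"
  using assms
proof (induction J)
  case empty
  then show ?case by (simp add: path_event_def)
next
  case (insert b J)
  then have "X b -` A b \<inter> space M \<in> sets M" by (intro measurable_sets) auto
  then show ?case using insert by (auto simp: path_event_insert)
qed

text \<open>An event fixed by times up to \<open>s\<close> belongs to the natural filtration at
  \<open>s\<close>; integrating the conditional expectation over it gives the formula.\<close>

lemma markov_process_fdd:
  assumes mp: "markov_process S K Q X" and x: "x \<in> space S"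
  shows "markov_fdd S K x (Q x) X"
proof -
  let ?M = "Q x"
  have tf: "transition_function S K" using mp by (simp add: markov_process_def)
  have prob: "prob_space ?M" and X: "\<And>t. t > 0 \<Longrightarrow> X t \<in> ?M \<rightarrow>\<^sub>M S"
    and d: "\<And>t. t > 0 \<Longrightarrow> distr ?M S (X t) = K t x"
    and ce: "\<And>s t B. s > 0 \<Longrightarrow> t > 0 \<Longrightarrow> B \<in> sets S \<Longrightarrow> AE \<omega> in ?M.
        real_cond_exp ?M (natural_filtration ?M S X s) (\<lambda>\<omega>'. indicator B (X (s + t) \<omega>')) \<omega> = measure (K t (X s \<omega>)) B"
    using mp x by (auto simp: markov_process_def)
  interpret prob_space ?M by fact
  have step: "emeasure ?M (path_event ?M X J A \<inter> (X (s + t) -` B \<inter> space ?M)) =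
      (\<integral>\<^sup>+\<omega>. indicator (path_event ?M X J A) \<omega> * emeasure (K t (X s \<omega>)) B \<partial>?M)"
    if s: "s > 0" and t: "t > 0" and J: "finite J" "J \<subseteq> {0<..s}" and A: "\<And>i. i \<in> J \<Longrightarrow> A i \<in> sets S" and B: "B \<in> sets S"
    for s t J A B
  proof -
    let ?F = "natural_filtration ?M S X s"
    let ?G = "{X r -` B \<inter> space ?M | r B. 0 < r \<and> r \<le> s \<and> B \<in> sets S}"
    have Gsub: "?G \<subseteq> sets ?M" using X by (auto intro!: measurable_sets)
    then have setsF: "sets ?F = sigma_sets (space ?M) ?G" and spF: "space ?F = space ?M"
      unfolding natural_filtration_def using sets.sets_into_space
      by (intro sets_measure_of space_measure_of; blast)+
    have sub: "subalgebra ?M ?F"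
      unfolding subalgebra_def using setsF spF sets.sigma_sets_subset[OF Gsub] by simp
    interpret finite_measure_subalgebra ?M ?F by standard (rule sub)
    have XF: "X i \<in> ?F \<rightarrow>\<^sub>M S" if "i \<in> J" for i
    proof (rule measurableI)
      show "X i \<omega> \<in> space S" if "\<omega> \<in> space ?F" for \<omega>
        using measurable_space[OF X, of i \<omega>] J \<open>i \<in> J\<close> that spF by auto
      show "X i -` B \<inter> space ?F \<in> sets ?F" if "B \<in> sets S" for B
        unfolding setsF spF using J \<open>i \<in> J\<close> that by (intro sigma_sets.Basic) force
    qed
    let ?E = "path_event ?M X J A"
    have EF: "?E \<in> sets ?F"
      using path_event_sets[OF J(1) XF A] by (simp add: path_event_def spF)
    then have E: "?E \<in> sets ?M" using sub by (auto simp: subalgebra_def)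
    have Xst: "X (s + t) \<in> ?M \<rightarrow>\<^sub>M S" and Xs: "X s \<in> ?M \<rightarrow>\<^sub>M S" using X s t by auto
    have Kt: "K t \<in> S \<rightarrow>\<^sub>M prob_algebra S" using tf t by (simp add: transition_function_def)
    have KB: "(\<lambda>y. measure (K t y) B) \<in> borel_measurable S"
      using measurable_compose[OF measurable_prob_algebraD[OF Kt] measurable_measure_subprob_algebra[OF B]] .
    have mKB: "(\<lambda>\<omega>. measure (K t (X s \<omega>)) B) \<in> borel_measurable ?M"
      using measurable_compose[OF Xs KB] .
    have pK: "prob_space (K t (X s \<omega>))" if "\<omega> \<in> space ?M" for \<omega>
      using measurable_space[OF Kt measurable_space[OF Xs that]] by (simp add: space_prob_algebra)
    have H: "X (s + t) -` B \<inter> space ?M \<in> sets ?M" using Xst B by (rule measurable_sets)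
    have int: "integrable ?M (\<lambda>\<omega>. indicator B (X (s + t) \<omega>) :: real)"
      using Xst B by (intro integrable_const_bound[where B = 1]) auto
    have int2: "integrable ?M (\<lambda>\<omega>. indicator ?E \<omega> * measure (K t (X s \<omega>)) B)"
    proof (rule integrable_const_bound[where B = 1])
      show "AE \<omega> in ?M. norm (indicator ?E \<omega> * measure (K t (X s \<omega>)) B) \<le> 1"
        using pK by (intro AE_I2) (simp add: indicator_def prob_space.prob_le_1)
    qed (use mKB E in measurable)
    have "measure ?M (?E \<inter> (X (s + t) -` B \<inter> space ?M)) = (\<integral>\<omega>. indicator (?E \<inter> (X (s + t) -` B \<inter> space ?M)) \<omega> \<partial>?M)"
      using E H by simp
    also have "\<dots> = (\<integral>\<omega>\<in>?E. indicator B (X (s + t) \<omega>) \<partial>?M)"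
      unfolding set_lebesgue_integral_def
      by (intro Bochner_Integration.integral_cong) (auto simp: indicator_def)
    also have "\<dots> = (\<integral>\<omega>\<in>?E. real_cond_exp ?M ?F (\<lambda>\<omega>'. indicator B (X (s + t) \<omega>')) \<omega> \<partial>?M)"
      by (rule real_cond_exp_intA[OF int EF])
    also have "\<dots> = (\<integral>\<omega>. indicator ?E \<omega> * measure (K t (X s \<omega>)) B \<partial>?M)"
      unfolding set_lebesgue_integral_def
    proof (rule integral_cong_AE)
      show "AE \<omega> in ?M. indicator ?E \<omega> *\<^sub>R real_cond_exp ?M ?F (\<lambda>\<omega>'. indicator B (X (s + t) \<omega>')) \<omega>
          = indicator ?E \<omega> * measure (K t (X s \<omega>)) B"
        using ce[OF s t B] by eventually_elim simp
      show "(\<lambda>\<omega>. indicator ?E \<omega> * measure (K t (X s \<omega>)) B) \<in> borel_measurable ?M"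
        using int2 by simp
      show "(\<lambda>\<omega>. indicator ?E \<omega> *\<^sub>R real_cond_exp ?M ?F (\<lambda>\<omega>'. indicator B (X (s + t) \<omega>')) \<omega>) \<in> borel_measurable ?M"
        using E by measurable
    qed
    finally have "ennreal (measure ?M (?E \<inter> (X (s + t) -` B \<inter> space ?M)))
        = ennreal (\<integral>\<omega>. indicator ?E \<omega> * measure (K t (X s \<omega>)) B \<partial>?M)" by simp
    also have "\<dots> = (\<integral>\<^sup>+\<omega>. ennreal (indicator ?E \<omega> * measure (K t (X s \<omega>)) B) \<partial>?M)"
      by (rule nn_integral_eq_integral[OF int2, symmetric]) simp
    also have "\<dots> = (\<integral>\<^sup>+\<omega>. indicator ?E \<omega> * emeasure (K t (X s \<omega>)) B \<partial>?M)"
    proof (rule nn_integral_cong)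
      fix \<omega> assume "\<omega> \<in> space ?M"
      then interpret K: prob_space "K t (X s \<omega>)" by (rule pK)
      show "ennreal (indicator ?E \<omega> * measure (K t (X s \<omega>)) B) = indicator ?E \<omega> * emeasure (K t (X s \<omega>)) B"
        by (simp add: indicator_def K.emeasure_eq_measure)
    qed
    finally show ?thesis by (simp add: emeasure_eq_measure)
  qed
  show ?thesis unfolding markov_fdd_def using prob X d step by blast
qed

lemma markov_fdd_time_change:
  fixes C :: real
  assumes "markov_fdd S K x M X" "C > 0"
  shows "markov_fdd S (\<lambda>t. K (t / C)) x M (\<lambda>t. X (t / C))"
proof -
  have "emeasure M (path_event M (\<lambda>t. X (t / C)) J A \<inter> (X ((s + t) / C) -` B \<inter> space M)) =
      (\<integral>\<^sup>+\<omega>. indicator (path_event M (\<lambda>t. X (t / C)) J A) \<omega> * emeasure (K (t / C) (X (s / C) \<omega>)) B \<partial>M)"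
    if s: "s > 0" and t: "t > 0" and J: "finite J" "J \<subseteq> {0<..s}" and A: "\<forall>i\<in>J. A i \<in> sets S" and B: "B \<in> sets S"
    for s t J A B
  proof -
    \<comment> \<open>The times in \<open>J\<close> are divided by \<open>C\<close>, so the set
      belonging to a new time \<open>i\<close> is recovered as \<open>A (i * C)\<close>.\<close>
    have eq: "path_event M (\<lambda>t. X (t / C)) J A = path_event M X ((\<lambda>i. i / C) ` J) (\<lambda>i. A (i * C))"
      using assms(2) by (auto simp: path_event_def)
    have "finite ((\<lambda>i. i / C) ` J)" "(\<lambda>i. i / C) ` J \<subseteq> {0<..s / C}"
      and A': "\<And>i. i \<in> (\<lambda>i. i / C) ` J \<Longrightarrow> A (i * C) \<in> sets S" and "s / C > 0" "t / C > 0"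
      using s t J A assms(2) by (auto simp: divide_right_mono)
    then have "emeasure M (path_event M X ((\<lambda>i. i / C) ` J) (\<lambda>i. A (i * C)) \<inter> (X (s / C + t / C) -` B \<inter> space M)) =
      (\<integral>\<^sup>+\<omega>. indicator (path_event M X ((\<lambda>i. i / C) ` J) (\<lambda>i. A (i * C))) \<omega> * emeasure (K (t / C) (X (s / C) \<omega>)) B \<partial>M)"
      using B by (intro markov_fdd_step[OF assms(1)]) auto
    then show ?thesis unfolding eq by (simp add: add_divide_distrib)
  qed
  then show ?thesis using assms unfolding markov_fdd_def by simp
qed

text \<open>A subprobability measure: the law of \<open>X s\<close> restricted to a past event. The
  induction on time sets needs it rather than the probability of the event, since the next
  transition starts from the position.\<close>

definition last_law ::
  "'s measure \<Rightarrow> 'w measure \<Rightarrow> (real \<Rightarrow> 'w \<Rightarrow> 's) \<Rightarrow> real set \<Rightarrow> (real \<Rightarrow> 's set) \<Rightarrow> real \<Rightarrow> 's measure" where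
  "last_law S M X J A s = distr (density M (indicator (path_event M X J A))) S (X s)"

lemma sets_last_law [simp]: "sets (last_law S M X J A s) = sets S"
  by (simp add: last_law_def)

lemma emeasure_last_law:
  assumes "path_event M X J A \<in> sets M" "X s \<in> M \<rightarrow>\<^sub>M S" "B \<in> sets S"
  shows "emeasure (last_law S M X J A s) B = emeasure M (path_event M X J A \<inter> (X s -` B \<inter> space M))"
proof -
  have "X s -` B \<inter> space M \<in> sets M" using assms(2,3) by (rule measurable_sets)
  then show ?thesis using assms by (simp add: last_law_def emeasure_distr emeasure_restricted)
qed

lemma nn_integral_last_law:
  assumes "path_event M X J A \<in> sets M" "X s \<in> M \<rightarrow>\<^sub>M S" "g \<in> borel_measurable S"
  shows "(\<integral>\<^sup>+y. g y \<partial>last_law S M X J A s) = (\<integral>\<^sup>+\<omega>. indicator (path_event M X J A) \<omega> * g (X s \<omega>) \<partial>M)"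
proof -
  have "(\<lambda>\<omega>. g (X s \<omega>)) \<in> borel_measurable M" using assms(2,3) by (rule measurable_compose)
  then show ?thesis using assms
    by (simp add: last_law_def nn_integral_distr nn_integral_density)
qed

text \<open>Induction on the time set by adding its latest time \<open>b\<close>. The claim at
  \<open>s > b\<close> follows from the induction hypothesis at \<open>b\<close> by one transition
  of length \<open>s - b\<close>, integrated against the common law at time \<open>b\<close>; for
  \<open>s = b\<close> the new condition merely intersects the observed set.\<close>

lemma fdd_unique:
  assumes m1: "markov_fdd S K x M X" and m2: "markov_fdd S K' x M' X'"
    and tf: "transition_function S K"
    and eq: "\<And>t. t > 0 \<Longrightarrow> K t x = K' t x"
    and ae: "\<And>s t. s > 0 \<Longrightarrow> t > 0 \<Longrightarrow> AE y in K s x. K t y = K' t y"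
    and J: "finite J" and A: "\<And>i. i \<in> J \<Longrightarrow> A i \<in> sets S"
  shows "J \<subseteq> {0<..s} \<Longrightarrow> s > 0 \<Longrightarrow> last_law S M X J A s = last_law S M' X' J A s"
  using J A
proof (induction J arbitrary: s rule: finite_linorder_max_induct)
  case empty
  have "emeasure (last_law S M X {} A s) B = emeasure (last_law S M' X' {} A s) B" if "B \<in> sets S" for B
  proof -
    have X: "X s \<in> M \<rightarrow>\<^sub>M S" "X' s \<in> M' \<rightarrow>\<^sub>M S" using m1 m2 empty by (auto simp: markov_fdd_def)
    have "emeasure (distr M S (X s)) B = emeasure (distr M' S (X' s)) B"
      using m1 m2 eq empty by (simp add: markov_fdd_def)
    then have "emeasure M (X s -` B \<inter> space M) = emeasure M' (X' s -` B \<inter> space M')"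
      using X that by (simp add: emeasure_distr)
    then show ?thesis using X that
      by (subst (1 2) emeasure_last_law) (simp_all add: path_event_def Int_absorb1)
  qed
  then show ?case by (intro measure_eqI) auto
next
  case (insert b J)
  have b: "0 < b" "b \<le> s" using insert.prems(1) by auto
  have Jb: "J \<subseteq> {0<..b}"
  proof
    fix i assume i: "i \<in> J"
    then have "i < b" "0 < i" using insert.hyps(2) insert.prems(1) by auto
    then show "i \<in> {0<..b}" by simp
  qed
  have AJ: "\<And>i. i \<in> J \<Longrightarrow> A i \<in> sets S" and Ab: "A b \<in> sets S" using insert by auto
  have IH: "last_law S M X J A b = last_law S M' X' J A b"
    by (rule insert.IH[OF Jb b(1)]) (rule AJ)
  have X: "\<And>t. t > 0 \<Longrightarrow> X t \<in> M \<rightarrow>\<^sub>M S" "\<And>t. t > 0 \<Longrightarrow> X' t \<in> M' \<rightarrow>\<^sub>M S"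
    using m1 m2 by (auto simp: markov_fdd_def)
  have PJ: "path_event M X J A \<in> sets M" "path_event M' X' J A \<in> sets M'"
    using insert.hyps(1) Jb by (auto intro!: path_event_sets[where S = S] X AJ)
  have Pb: "path_event M X (insert b J) A \<in> sets M" "path_event M' X' (insert b J) A \<in> sets M'"
    using PJ measurable_sets[OF X(1)[OF b(1)] Ab] measurable_sets[OF X(2)[OF b(1)] Ab]
    by (auto simp: path_event_insert)
  have "emeasure (last_law S M X (insert b J) A s) B = emeasure (last_law S M' X' (insert b J) A s) B"
    if B: "B \<in> sets S" for B
  proof (cases "s = b")
    case True
    have "path_event M X (insert b J) A \<inter> (X b -` B \<inter> space M) = path_event M X J A \<inter> (X b -` (A b \<inter> B) \<inter> space M)"
      "path_event M' X' (insert b J) A \<inter> (X' b -` B \<inter> space M') = path_event M' X' J A \<inter> (X' b -` (A b \<inter> B) \<inter> space M')"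
      by (auto simp: path_event_insert)
    then have "emeasure (last_law S M X (insert b J) A s) B = emeasure (last_law S M X J A b) (A b \<inter> B)"
      "emeasure (last_law S M' X' (insert b J) A s) B = emeasure (last_law S M' X' J A b) (A b \<inter> B)"
      using True B Ab b X PJ Pb by (simp_all add: emeasure_last_law)
    then show ?thesis using IH by simp
  next
    case False
    define t where "t = s - b"
    have t: "t > 0" "s = b + t" using b False by (auto simp: t_def)
    have Kt: "K t \<in> S \<rightarrow>\<^sub>M subprob_algebra S" using tf t by (simp add: transition_function_def measurable_prob_algebraD)
    have KB: "(\<lambda>y. emeasure (K t y) B) \<in> borel_measurable S"
      using measurable_compose[OF Kt measurable_emeasure_subprob_algebra[OF B]] .
    let ?g = "\<lambda>y. indicator (A b) y * emeasure (K t y) B"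
    have g: "?g \<in> borel_measurable S" using KB Ab by measurable
    have sub: "insert b J \<subseteq> {0<..b}" "finite (insert b J)" using Jb b insert.hyps(1) by auto
    \<comment> \<open>The kernels may differ on an exceptional set, but the law of
      \<open>X' b\<close> is \<open>K b x\<close>, for which that set is null.\<close>
    have ae1: "AE \<omega> in M'. \<omega> \<in> path_event M' X' J A \<longrightarrow> K t (X' b \<omega>) = K' t (X' b \<omega>)"
    proof -
      have "distr M' S (X' b) = K b x"
        using m2 b(1) eq by (simp add: markov_fdd_def)
      then have "AE y in distr M' S (X' b). K t y = K' t y"
        using ae[OF b(1) t(1)] by (simp only:)
      then have "AE \<omega> in M'. K t (X' b \<omega>) = K' t (X' b \<omega>)"
        by (rule AE_distrD[OF X(2)[OF b(1)]])
      then show ?thesis by eventually_elim simp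
    qed
    have "emeasure (last_law S M X (insert b J) A s) B
        = emeasure M (path_event M X (insert b J) A \<inter> (X (b + t) -` B \<inter> space M))"
      using emeasure_last_law[OF Pb(1) X(1) B] t b by simp
    also have "\<dots> = (\<integral>\<^sup>+\<omega>. indicator (path_event M X (insert b J) A) \<omega> * emeasure (K t (X b \<omega>)) B \<partial>M)"
      using b(1) t(1) sub insert.prems B by (intro markov_fdd_step[OF m1]) auto
    also have "\<dots> = (\<integral>\<^sup>+\<omega>. indicator (path_event M X J A) \<omega> * ?g (X b \<omega>) \<partial>M)"
      by (intro nn_integral_cong) (auto simp: path_event_insert indicator_def)
    also have "\<dots> = (\<integral>\<^sup>+y. ?g y \<partial>last_law S M X J A b)"
      by (rule nn_integral_last_law[OF PJ(1) X(1)[OF b(1)] g, symmetric])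
    also have "\<dots> = (\<integral>\<^sup>+y. ?g y \<partial>last_law S M' X' J A b)"
      by (simp only: IH)
    also have "\<dots> = (\<integral>\<^sup>+\<omega>. indicator (path_event M' X' J A) \<omega> * ?g (X' b \<omega>) \<partial>M')"
      by (rule nn_integral_last_law[OF PJ(2) X(2)[OF b(1)] g])
    also have "\<dots> = (\<integral>\<^sup>+\<omega>. indicator (path_event M' X' (insert b J) A) \<omega> * emeasure (K' t (X' b \<omega>)) B \<partial>M')"
      using ae1 AE_space by (intro nn_integral_cong_AE, eventually_elim) (auto simp: path_event_insert indicator_def)
    also have "\<dots> = emeasure M' (path_event M' X' (insert b J) A \<inter> (X' (b + t) -` B \<inter> space M'))"
      using b(1) t(1) sub insert.prems B by (intro markov_fdd_step[OF m2, symmetric]) auto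
    also have "\<dots> = emeasure (last_law S M' X' (insert b J) A s) B"
      using emeasure_last_law[OF Pb(2) X(2) B] t b by simp
    finally show ?thesis .
  qed
  then show ?case by (intro measure_eqI) auto
qed

lemma process_law_unique:
  assumes m1: "markov_fdd S K x M X" and m2: "markov_fdd S K' x M' X'"
    and tf: "transition_function S K"
    and eq: "\<And>t. t > 0 \<Longrightarrow> K t x = K' t x"
    and ae: "\<And>s t. s > 0 \<Longrightarrow> t > 0 \<Longrightarrow> AE y in K s x. K t y = K' t y"
  shows "process_law S M X = process_law S M' X'"
  unfolding process_law_def
proof (rule measure_eqI_PiM_infinite)
  let ?I = "{0<..} :: real set"
  interpret M: prob_space M using m1 by (simp add: markov_fdd_def)
  interpret M': prob_space M' using m2 by (simp add: markov_fdd_def)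
  have X: "\<And>t. t > 0 \<Longrightarrow> X t \<in> M \<rightarrow>\<^sub>M S" "\<And>t. t > 0 \<Longrightarrow> X' t \<in> M' \<rightarrow>\<^sub>M S"
    using m1 m2 by (auto simp: markov_fdd_def)
  have Y: "(\<lambda>\<omega>. \<lambda>t\<in>?I. X t \<omega>) \<in> M \<rightarrow>\<^sub>M (\<Pi>\<^sub>M t\<in>?I. S)" "(\<lambda>\<omega>. \<lambda>t\<in>?I. X' t \<omega>) \<in> M' \<rightarrow>\<^sub>M (\<Pi>\<^sub>M t\<in>?I. S)"
    using X by (auto intro!: measurable_restrict)
  show "finite_measure (distr M (\<Pi>\<^sub>M t\<in>?I. S) (\<lambda>\<omega>. \<lambda>t\<in>?I. X t \<omega>))"
    by (rule M.finite_measure_distr[OF Y(1)])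
  fix A :: "real \<Rightarrow> 'a set" and J :: "real set" assume J: "finite J" "J \<subseteq> ?I" and A: "\<And>i. i \<in> J \<Longrightarrow> A i \<in> sets S"
  \<comment> \<open>Any positive time not before the last element of \<open>J\<close> will do;
    inserting \<open>1\<close> keeps \<open>s\<close> positive when \<open>J\<close> is
    empty.\<close>
  define s where "s = Max (insert 1 J)"
  have "s \<ge> 1" "J \<subseteq> {..s}" using J by (auto simp: s_def)
  then have s: "s > 0" "J \<subseteq> {0<..s}" using J by auto
  have P: "path_event M X J A \<in> sets M" "path_event M' X' J A \<in> sets M'"
    using J by (auto intro!: path_event_sets[where S = S] X A)
  have pre: "(\<lambda>\<omega>. \<lambda>t\<in>?I. X t \<omega>) -` prod_emb ?I (\<lambda>_. S) J (Pi\<^sub>E J A) \<inter> space M = path_event M X J A"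
    "(\<lambda>\<omega>. \<lambda>t\<in>?I. X' t \<omega>) -` prod_emb ?I (\<lambda>_. S) J (Pi\<^sub>E J A) \<inter> space M' = path_event M' X' J A"
    using J X[THEN measurable_space] by (auto simp: prod_emb_iff path_event_def PiE_iff extensional_def subset_eq restrict_def split: if_splits)
  have full: "path_event M X J A \<inter> (X s -` space S \<inter> space M) = path_event M X J A"
    "path_event M' X' J A \<inter> (X' s -` space S \<inter> space M') = path_event M' X' J A"
    using X[THEN measurable_space] s by (auto simp: path_event_def)
  have "emeasure M (path_event M X J A) = emeasure (last_law S M X J A s) (space S)"
    using emeasure_last_law[OF P(1) X(1)[OF s(1)] sets.top] full by simp
  also have "\<dots> = emeasure (last_law S M' X' J A s) (space S)"
    using fdd_unique[OF m1 m2 tf eq ae J(1) A s(2,1)] by simp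
  also have "\<dots> = emeasure M' (path_event M' X' J A)"
    using emeasure_last_law[OF P(2) X(2)[OF s(1)] sets.top] full by simp
  finally have *: "emeasure M (path_event M X J A) = emeasure M' (path_event M' X' J A)" .
  have "prod_emb ?I (\<lambda>_. S) J (Pi\<^sub>E J A) \<in> sets (\<Pi>\<^sub>M t\<in>?I. S)"
    using J A by (intro sets_PiM_I) auto
  then show "emeasure (distr M (\<Pi>\<^sub>M t\<in>?I. S) (\<lambda>\<omega>. \<lambda>t\<in>?I. X t \<omega>)) (prod_emb ?I (\<lambda>_. S) J (Pi\<^sub>E J A)) =
      emeasure (distr M' (\<Pi>\<^sub>M t\<in>?I. S) (\<lambda>\<omega>. \<lambda>t\<in>?I. X' t \<omega>)) (prod_emb ?I (\<lambda>_. S) J (Pi\<^sub>E J A))"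
    using * pre by (simp add: emeasure_distr[OF Y(1)] emeasure_distr[OF Y(2)])
qed simp_all

section \<open>Exit laws of the walk\<close>

context padic
begin

definition level :: "vertex \<Rightarrow> nat" where
  "level v = (THE n. \<exists>r\<in>residues_upto p n. v = cyl p n r)"

definition residue :: "vertex \<Rightarrow> int" where
  "residue v = (THE r. r \<in> residues_upto p (level v) \<and> v = cyl p (level v) r)"

lemma cyl_Int_Zp [simp]: "cyl p n r \<inter> Zp p = cyl p n r"
  using cyl_sub_Zp by blast

lemma level_cyl [simp]: "r \<in> residues_upto p n \<Longrightarrow> level (cyl p n r) = n"
  unfolding level_def using cyl_eq_iff by (intro the_equality) blast+

lemma residue_cyl [simp]: "r \<in> residues_upto p n \<Longrightarrow> residue (cyl p n r) = r"
  unfolding residue_def by (rule the_equality) (auto simp: cyl_eq_iff)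

definition children :: "nat \<Rightarrow> int \<Rightarrow> int set" where
  "children n r = {s \<in> residues_upto p (Suc n). s mod int p ^ n = r}"

lemma finite_children [simp]: "finite (children n r)"
  by (rule finite_subset[of _ "residues_upto p (Suc n)"]) (auto simp: children_def)

lemma childrenD:
  assumes "s \<in> children n r"
  shows "s \<in> residues_upto p (Suc n)" "s mod int p ^ n = r"
  using assms by (simp_all add: children_def)

lemma indicator_cyl: "indicator (cyl p n r) x = (if x \<in> Zp p \<and> x n = r then 1 else 0 :: real)"
  by (simp add: cyl_def indicator_def)

lemma sum_children_indicator:
  "(\<Sum>s\<in>children n r. indicator (cyl p (Suc n) s) x) = (indicator (cyl p n r) x :: real)"
proof (cases "x \<in> cyl p n r")
  case True
  then have x: "x \<in> Zp p" "x n = r" by (auto simp: cyl_def)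
  have c: "x (Suc n) \<in> children n r"
    unfolding children_def using Zp_bounds[OF x(1), of "Suc n"] Zp_mod[OF x(1), of n "Suc n"] x(2) by simp
  have "(\<Sum>s\<in>children n r. indicator (cyl p (Suc n) s) x) = (\<Sum>s\<in>children n r. if s = x (Suc n) then 1 else 0 :: real)"
    by (rule sum.cong) (auto simp: indicator_cyl x)
  also have "\<dots> = 1" using c by simp
  finally show ?thesis using True by simp
next
  case False
  have "x \<notin> cyl p (Suc n) s" if "s \<in> children n r" for s
  proof
    assume "x \<in> cyl p (Suc n) s"
    then have "x \<in> Zp p" "x (Suc n) = s" by (auto simp: cyl_def)
    then have "x n = r" using Zp_mod[of x p n "Suc n"] childrenD(2)[OF that] by simp
    then show False using False \<open>x \<in> Zp p\<close> by (simp add: cyl_def)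
  qed
  then show ?thesis using False by (simp add: indicator_def)
qed

end

context padic_haar
begin

lemma measure_cyl_integral: "r \<in> residues_upto p n \<Longrightarrow> (\<integral>x. indicator (cyl p n r) x \<partial>\<mu>) = inverse (real p ^ n)"
  using measure_cyl by simp

text \<open>Counting by measure: the children partition a ball of measure \<open>p^(-n)\<close>, and
  each has measure \<open>p^(-(n + 1))\<close>.\<close>

lemma card_children:
  assumes "r \<in> residues_upto p n"
  shows "card (children n r) = p"
proof -
  have "inverse (real p ^ n) = (\<integral>x. (\<Sum>s\<in>children n r. indicator (cyl p (Suc n) s) x) \<partial>\<mu>)"
    using measure_cyl[OF assms] by (simp add: sum_children_indicator)
  also have "\<dots> = (\<Sum>s\<in>children n r. \<integral>x. indicator (cyl p (Suc n) s) x \<partial>\<mu>)"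
    by (rule Bochner_Integration.integral_sum) (auto simp: emeasure_eq_measure)
  also have "\<dots> = (\<Sum>s\<in>children n r. inverse (real p ^ Suc n))"
    by (rule sum.cong[OF refl measure_cyl_integral]) (rule childrenD(1))
  finally have "inverse (real p ^ n) = real (card (children n r)) * inverse (real p ^ Suc n)" by simp
  then have "real (card (children n r)) = real p" using p_gt_1 by (simp add: field_simps)
  then show ?thesis by simp
qed

end

text \<open>The parameter is \<open>F\<close> rather than \<open>c\<close>. The relation gives
  \<open>1 - c = F * c\<close>, hence \<open>F = (1 - c) + c * F^2\<close>, the equation for the
  probability of ever reaching the predecessor. The value \<open>p^(-\<alpha>)\<close> is inserted
  only in the final theorem.\<close>

locale tree_walk = padic_haar +
  fixes F c :: real
  assumes F: "0 < F" "F < 1" and c: "c = 1 / (1 + F)"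
begin

lemma c_pos: "c > 0" and c_F: "1 - c = F * c" and c_lt_1: "c < 1"
  using F by (simp_all add: c field_simps)

abbreviation q where "q \<equiv> walk_prob p c"

lemma walk_prob_cyl:
  assumes r: "r \<in> residues_upto p n" and s: "s \<in> residues_upto p m"
  shows "q (cyl p n r) (cyl p m s) =
    (if n = Suc m \<and> r mod int p ^ m = s then F * c
     else if m = Suc n \<and> s mod int p ^ n = r then (if n = 0 then 1 / real p else c / real p) else 0)"
proof -
  have up: "(cyl p n r \<in> balls p \<and> cyl p n r \<noteq> Zp p \<and> cyl p m s = pred p (cyl p n r)) \<longleftrightarrow> (n = Suc m \<and> r mod int p ^ m = s)"
    if r: "r \<in> residues_upto p n" and s: "s \<in> residues_upto p m" for n r m s
  proof (cases n)
    case 0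
    then show ?thesis using cyl_eq_root_iff[OF r] by simp
  next
    case (Suc k)
    have "cyl p m s = cyl p k (r mod int p ^ k) \<longleftrightarrow> m = k \<and> s = r mod int p ^ k"
      by (rule cyl_eq_iff[OF s]) simp
    then show ?thesis using cyl_in_balls[OF r] cyl_eq_root_iff[OF r] pred_cyl[of r k] r Suc by auto
  qed
  show ?thesis
    unfolding walk_prob_def up[OF r s] up[OF s r]
    by (simp only: cyl_eq_root_iff[OF r] c_F)
qed

lemma q_nonneg: "q u v \<ge> 0"
  using c_pos c_lt_1 by (simp add: walk_prob_def)

text \<open>The transition operator of the walk in the coordinates of the vertex
  \<open>cyl p n r\<close>; the root is special because the walk cannot move backwards
  there.\<close>

definition step :: "(vertex \<Rightarrow> real) \<Rightarrow> nat \<Rightarrow> int \<Rightarrow> real" where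
  "step f n r = (if n = 0 then (\<Sum>s\<in>children 0 r. f (cyl p 1 s)) / p
     else F * c * f (cyl p (n - 1) (r mod int p ^ (n - 1))) + c / p * (\<Sum>s\<in>children n r. f (cyl p (Suc n) s)))"

lemma nn_integral_step:
  assumes r: "r \<in> residues_upto p n" and f: "\<And>v. v \<in> balls p \<Longrightarrow> f v \<ge> 0"
  shows "(\<integral>\<^sup>+v. ennreal (q (cyl p n r) v) * ennreal (f v) \<partial>count_space (balls p)) = ennreal (step f n r)"
proof -
  let ?u = "cyl p n r"
  let ?D = "cyl p (Suc n) ` children n r"
  let ?U = "if n = 0 then {} else {cyl p (n - 1) (r mod int p ^ (n - 1))}"
  have D: "?D \<subseteq> balls p" by (auto intro!: cyl_in_balls dest: childrenD(1) simp del: atLeastLessThan_iff)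
  have U: "?U \<subseteq> balls p" by (auto intro!: cyl_in_balls)
  have out: "q ?u v = 0" if v: "v \<in> balls p" "v \<notin> ?D \<union> ?U" for v
  proof -
    obtain m s where v': "v = cyl p m s" "s \<in> residues_upto p m" by (rule ballsE[OF v(1)])
    have "\<not> (n = Suc m \<and> r mod int p ^ m = s)" using v(2) v'(1) by auto
    moreover have "\<not> (m = Suc n \<and> s mod int p ^ n = r)" using v(2) v' by (auto simp: children_def)
    ultimately show ?thesis unfolding v'(1) walk_prob_cyl[OF r v'(2)] by auto
  qed
  have "(\<integral>\<^sup>+v. ennreal (q ?u v) * ennreal (f v) \<partial>count_space (balls p)) = (\<Sum>v\<in>?D \<union> ?U. ennreal (q ?u v) * ennreal (f v))"
    using D U out by (intro nn_integral_count_space') auto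
  also have "\<dots> = (\<Sum>v\<in>?D \<union> ?U. ennreal (q ?u v * f v))"
    using D U f by (intro sum.cong refl) (auto simp: ennreal_mult q_nonneg)
  also have "\<dots> = ennreal (\<Sum>v\<in>?D \<union> ?U. q ?u v * f v)"
    using D U f by (intro sum_ennreal) (auto simp: q_nonneg)
  also have "(\<Sum>v\<in>?D \<union> ?U. q ?u v * f v) = (\<Sum>v\<in>?D. q ?u v * f v) + (\<Sum>v\<in>?U. q ?u v * f v)"
  proof (rule sum.union_disjoint)
    show "?D \<inter> ?U = {}"
    proof -
      have "cyl p (Suc n) s \<noteq> cyl p (n - 1) (r mod int p ^ (n - 1))" if "s \<in> children n r" for s
        using cyl_eq_iff[OF childrenD(1)[OF that] residue_mod[of r "n - 1"]] by auto
      then show ?thesis by auto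
    qed
  qed auto
  also have "(\<Sum>v\<in>?D. q ?u v * f v) = (\<Sum>s\<in>children n r. q ?u (cyl p (Suc n) s) * f (cyl p (Suc n) s))"
  proof (rule sum.reindex_cong[OF _ refl refl])
    show "inj_on (cyl p (Suc n)) (children n r)"
      by (rule inj_onI) (use cyl_eq_iff[OF childrenD(1) childrenD(1)] in blast)
  qed
  also have "\<dots> = (\<Sum>s\<in>children n r. (if n = 0 then 1 / real p else c / real p) * f (cyl p (Suc n) s))"
  proof (rule sum.cong[OF refl])
    fix s assume s: "s \<in> children n r"
    show "q ?u (cyl p (Suc n) s) * f (cyl p (Suc n) s) = (if n = 0 then 1 / real p else c / real p) * f (cyl p (Suc n) s)"
      unfolding walk_prob_cyl[OF r childrenD(1)[OF s]] using childrenD(2)[OF s] by auto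
  qed
  also have "\<dots> = (if n = 0 then 1 / real p else c / real p) * (\<Sum>s\<in>children n r. f (cyl p (Suc n) s))"
    by (simp add: sum_distrib_left)
  also have "(\<Sum>v\<in>?U. q ?u v * f v) = (if n = 0 then 0 else F * c * f (cyl p (n - 1) (r mod int p ^ (n - 1))))"
    using walk_prob_cyl[OF r residue_mod[of r "n - 1"]] by auto
  finally show ?thesis by (simp add: step_def add.commute)
qed

text \<open>The exit law from the vertex \<open>cyl p n r\<close> will turn out to have the density \<open>dens n r\<close>: the walk
  either reaches the predecessor, with probability \<open>F\<close>, or it ends in the subtree of the vertex, where
  by symmetry its end is uniformly distributed.\<close>

fun dens :: "nat \<Rightarrow> int \<Rightarrow> padic \<Rightarrow> real" where
  "dens 0 r x = 1"
| "dens (Suc n) r x = F * dens n (r mod int p ^ n) x + (1 - F) * real p ^ Suc n * indicator (cyl p (Suc n) r) x"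

lemma dens_nonneg: "dens n r x \<ge> 0"
  using F by (induction n r x rule: dens.induct) auto

lemma dens_measurable [measurable]: "dens n r \<in> borel_measurable (Zp_borel p)"
proof (induction n arbitrary: r)
  case (Suc n)
  have [measurable]: "dens n (r mod int p ^ n) \<in> borel_measurable (Zp_borel p)" by (rule Suc)
  have "dens (Suc n) r = (\<lambda>x. F * dens n (r mod int p ^ n) x + (1 - F) * real p ^ Suc n * indicator (cyl p (Suc n) r) x)"
    by (simp add: fun_eq_iff)
  then show ?case by (simp only:) measurable
next
  case 0
  have "dens 0 r = (\<lambda>x. 1)" by (simp add: fun_eq_iff)
  then show ?case by simp
qed

lemma dens_bounded: "dens n r x \<le> real p ^ n"
proof (induction n r x rule: dens.induct)
  case (2 n r x)
  have "dens (Suc n) r x \<le> F * real p ^ n + (1 - F) * real p ^ Suc n"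
    unfolding dens.simps
  proof (rule add_mono)
    show "F * dens n (r mod int p ^ n) x \<le> F * real p ^ n" using 2 F by simp
    have "(1 - F) * real p ^ Suc n * indicator (cyl p (Suc n) r) x \<le> (1 - F) * real p ^ Suc n * 1"
      using F by (intro mult_left_mono) (auto simp: indicator_def)
    then show "(1 - F) * real p ^ Suc n * indicator (cyl p (Suc n) r) x \<le> (1 - F) * real p ^ Suc n" by simp
  qed
  also have "\<dots> \<le> F * real p ^ Suc n + (1 - F) * real p ^ Suc n"
    using F p_gt_1 by (intro add_right_mono mult_left_mono power_increasing) auto
  finally show ?case by (simp add: algebra_simps)
qed simp

lemma integrable_dens_mult:
  assumes "integrable \<mu> g"
  shows "integrable \<mu> (\<lambda>x. dens n r x * g x)"
proof (rule Bochner_Integration.integrable_bound)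
  show "integrable \<mu> (\<lambda>x. real p ^ n * g x)" using assms by simp
  show "AE x in \<mu>. norm (dens n r x * g x) \<le> norm (real p ^ n * g x)"
    using dens_bounded dens_nonneg by (auto simp: abs_mult intro!: mult_right_mono)
qed (use assms in measurable)

lemma integral_dens_Suc:
  assumes "integrable \<mu> g"
  shows "(\<integral>x. dens (Suc n) r x * g x \<partial>\<mu>) = F * (\<integral>x. dens n (r mod int p ^ n) x * g x \<partial>\<mu>)
     + (1 - F) * real p ^ Suc n * (\<integral>x. indicator (cyl p (Suc n) r) x * g x \<partial>\<mu>)"
proof -
  have i: "integrable \<mu> (\<lambda>x. indicator (cyl p (Suc n) r) x * g x)"
    using integrable_mult_indicator[OF _ assms, of "cyl p (Suc n) r"] by simp
  have "(\<integral>x. dens (Suc n) r x * g x \<partial>\<mu>) = (\<integral>x. F * (dens n (r mod int p ^ n) x * g x)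
     + (1 - F) * real p ^ Suc n * (indicator (cyl p (Suc n) r) x * g x) \<partial>\<mu>)"
    by (simp add: algebra_simps)
  also have "\<dots> = F * (\<integral>x. dens n (r mod int p ^ n) x * g x \<partial>\<mu>)
     + (1 - F) * real p ^ Suc n * (\<integral>x. indicator (cyl p (Suc n) r) x * g x \<partial>\<mu>)"
    using i integrable_dens_mult[OF assms] by simp
  finally show ?thesis .
qed

definition vdens :: "vertex \<Rightarrow> padic \<Rightarrow> real" where
  "vdens v = dens (level v) (residue v)"

lemma vdens_cyl: "r \<in> residues_upto p n \<Longrightarrow> vdens (cyl p n r) = dens n r"
  by (simp add: vdens_def del: atLeastLessThan_iff)

text \<open>For a fixed end \<open>x\<close> the density is harmonic in the vertex; it is the Martin
  kernel. Summed over the children, the indicators combine to that of the vertex itself. Away from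
  the root the recursion for \<open>dens\<close> absorbs this term together with the predecessor,
  and the factor \<open>c * (1 + F) = 1\<close> remains; at the root the terms are \<open>F\<close>
  and \<open>1 - F\<close>.\<close>

lemma step_dens:
  assumes r: "r \<in> residues_upto p n" and x: "x \<in> Zp p"
  shows "step (\<lambda>v. vdens v x) n r = vdens (cyl p n r) x"
proof -
  have ch: "(\<Sum>s\<in>children n r. vdens (cyl p (Suc n) s) x)
      = real p * F * dens n r x + (1 - F) * real p ^ Suc n * indicator (cyl p n r) x"
  proof -
    have "(\<Sum>s\<in>children n r. vdens (cyl p (Suc n) s) x)
        = (\<Sum>s\<in>children n r. F * dens n r x + (1 - F) * real p ^ Suc n * indicator (cyl p (Suc n) s) x)"
      by (rule sum.cong[OF refl]) (use childrenD in \<open>auto simp: vdens_cyl simp del: atLeastLessThan_iff\<close>)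
    also have "\<dots> = real p * (F * dens n r x) + (1 - F) * real p ^ Suc n * (\<Sum>s\<in>children n r. indicator (cyl p (Suc n) s) x)"
      using card_children[OF r] by (simp add: sum.distrib sum_distrib_left)
    finally show ?thesis by (simp add: sum_children_indicator)
  qed
  show ?thesis
  proof (cases n)
    case 0
    then have "r = 0" using r by simp
    then show ?thesis using ch 0 p_gt_1 vdens_cyl[OF r] x
      by (simp add: step_def cyl_0 field_simps)
  next
    case (Suc m)
    let ?r = "r mod int p ^ m"
    have "step (\<lambda>v. vdens v x) n r = F * c * dens m ?r x + c * (F * dens n r x + (1 - F) * real p ^ n * indicator (cyl p n r) x)"
    proof -
      have "step (\<lambda>v. vdens v x) n r = F * c * dens m ?r x + c / p * (\<Sum>s\<in>children n r. vdens (cyl p (Suc n) s) x)"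
        using Suc vdens_cyl[OF residue_mod[of r m]] by (simp add: step_def)
      also have "c / p * (\<Sum>s\<in>children n r. vdens (cyl p (Suc n) s) x)
          = c * (F * dens n r x + (1 - F) * real p ^ n * indicator (cyl p n r) x)"
        unfolding ch using p_gt_1 by (simp add: field_simps del: dens.simps)
      finally show ?thesis .
    qed
    also have "\<dots> = c * (F * dens n r x + dens n r x)"
      using Suc by (simp add: algebra_simps)
    also have "\<dots> = c * (1 + F) * dens n r x" by (simp add: algebra_simps)
    also have "\<dots> = dens n r x" using F by (simp add: c)
    finally show ?thesis using vdens_cyl[OF r] by simp
  qed
qed

end

section \<open>Ends as limits of sequences of balls\<close>

context padic
begin

lemma ball_cyl:
  assumes "v \<in> balls p"
  shows "residue v \<in> residues_upto p (level v)" "cyl p (level v) (residue v) = v"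
proof -
  obtain n r where v: "v = cyl p n r" and r: "r \<in> residues_upto p n" by (rule ballsE[OF assms])
  show "residue v \<in> residues_upto p (level v)" "cyl p (level v) (residue v) = v"
    unfolding v level_cyl[OF r] residue_cyl[OF r] using r by simp_all
qed

lemma ball_nonempty: "v \<in> balls p \<Longrightarrow> \<exists>x\<in>v. x \<in> Zp p"
  using ball_cyl[of v] cyl_nonempty cyl_sub_Zp by blast

text \<open>Convergence to some end without mention of the end: only countably many levels and
  residues are quantified over, which makes the event measurable.\<close>

definition settles :: "(nat \<Rightarrow> vertex) \<Rightarrow> bool" where
  "settles z \<longleftrightarrow> (\<forall>k. \<exists>s\<in>residues_upto p k. \<forall>\<^sub>F n in sequentially. z n \<subseteq> cyl p k s)"

lemma eventually_cyl_unique: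
  assumes z: "\<And>n. z n \<in> balls p"
    and "\<forall>\<^sub>F n in sequentially. z n \<subseteq> cyl p k s" "\<forall>\<^sub>F n in sequentially. z n \<subseteq> cyl p m t" "k \<le> m"
  shows "t mod int p ^ k = s"
proof -
  have "\<forall>\<^sub>F n in sequentially. z n \<subseteq> cyl p k s \<and> z n \<subseteq> cyl p m t"
    using assms(2,3) by (rule eventually_conj)
  then obtain n where n: "z n \<subseteq> cyl p k s" "z n \<subseteq> cyl p m t"
    by (auto simp: eventually_sequentially)
  obtain x where "x \<in> z n" "x \<in> Zp p" using ball_nonempty[OF z] by blast
  then have "x k = s" "x m = t" using n by (auto simp: cyl_def)
  then show ?thesis using Zp_mod[OF \<open>x \<in> Zp p\<close> assms(4)] by simp
qed

lemma tends_to_end_iff: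
  "tends_to_end p z \<xi> \<longleftrightarrow> \<xi> \<in> Zp p \<and> (\<forall>k. \<forall>\<^sub>F n in sequentially. z n \<subseteq> cyl p k (\<xi> k))"
proof
  assume t: "tends_to_end p z \<xi>"
  then have x: "\<xi> \<in> Zp p" by (simp add: tends_to_end_def)
  have "\<forall>\<^sub>F n in sequentially. z n \<subseteq> cyl p k (\<xi> k)" for k
  proof -
    have "cyl p k (\<xi> k) \<in> balls p" "\<xi> \<in> cyl p k (\<xi> k)"
      using cyl_in_balls[OF Zp_bounds[OF x]] x by (simp_all add: cyl_def)
    then show ?thesis using t by (simp add: tends_to_end_def)
  qed
  then show "\<xi> \<in> Zp p \<and> (\<forall>k. \<forall>\<^sub>F n in sequentially. z n \<subseteq> cyl p k (\<xi> k))" using x by simp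
next
  assume a: "\<xi> \<in> Zp p \<and> (\<forall>k. \<forall>\<^sub>F n in sequentially. z n \<subseteq> cyl p k (\<xi> k))"
  have "\<forall>\<^sub>F n in sequentially. z n \<subseteq> B" if B: "B \<in> balls p" "\<xi> \<in> B" for B
  proof -
    obtain k s where "B = cyl p k s" by (rule ballsE[OF B(1)])
    then have "B = cyl p k (\<xi> k)" using B(2) by (simp add: cyl_def)
    then show ?thesis using a by simp
  qed
  then show "tends_to_end p z \<xi>" using a by (simp add: tends_to_end_def)
qed

text \<open>The residues chosen at different levels are compatible because the balls
  \<open>z n\<close> are nonempty, so they assemble to a \<open>p\<close>-adic integer.\<close>

lemma settles_iff:
  assumes z: "\<And>n. z n \<in> balls p"
  shows "settles z \<longleftrightarrow> (\<exists>\<xi>. tends_to_end p z \<xi>)"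
proof
  assume "settles z"
  then have "\<forall>k. \<exists>s. s \<in> residues_upto p k \<and> (\<forall>\<^sub>F n in sequentially. z n \<subseteq> cyl p k s)"
    unfolding settles_def by blast
  then obtain \<xi> where \<xi>: "\<And>k. \<xi> k \<in> residues_upto p k" "\<And>k. \<forall>\<^sub>F n in sequentially. z n \<subseteq> cyl p k (\<xi> k)"
    by metis
  have "\<xi> (Suc k) mod int p ^ k = \<xi> k" for k
    by (rule eventually_cyl_unique[OF z \<xi>(2) \<xi>(2)]) simp
  then have "\<xi> \<in> Zp p" using \<xi>(1) by (simp add: Zp_def)
  then show "\<exists>\<xi>. tends_to_end p z \<xi>" using \<xi>(2) by (auto simp: tends_to_end_iff)
next
  assume "\<exists>\<xi>. tends_to_end p z \<xi>"
  then show "settles z" unfolding settles_def tends_to_end_iff using Zp_bounds by blast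
qed

lemma limit_end_settles:
  assumes z: "\<And>n. Z n \<omega> \<in> balls p" and s: "settles (\<lambda>n. Z n \<omega>)"
  shows "tends_to_end p (\<lambda>n. Z n \<omega>) (limit_end p Z \<omega>)"
proof -
  obtain \<xi> where \<xi>: "tends_to_end p (\<lambda>n. Z n \<omega>) \<xi>" using s settles_iff[of "\<lambda>n. Z n \<omega>"] z by blast
  have uniq: "\<eta> = \<xi>" if "tends_to_end p (\<lambda>n. Z n \<omega>) \<eta>" for \<eta>
  proof
    fix k
    have "\<xi> k mod int p ^ k = \<eta> k"
    proof (rule eventually_cyl_unique[where z = "\<lambda>n. Z n \<omega>"])
      show "\<forall>\<^sub>F n in sequentially. Z n \<omega> \<subseteq> cyl p k (\<eta> k)" "\<forall>\<^sub>F n in sequentially. Z n \<omega> \<subseteq> cyl p k (\<xi> k)"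
        using \<xi> that by (simp_all add: tends_to_end_iff)
    qed (simp_all add: z)
    moreover have "\<xi> \<in> Zp p" using \<xi> by (simp add: tends_to_end_def)
    ultimately show "\<eta> k = \<xi> k" using Zp_residue[of \<xi> k] by metis
  qed
  have "(THE \<xi>. tends_to_end p (\<lambda>n. Z n \<omega>) \<xi>) = \<xi>"
    by (rule the_equality[where P = "tends_to_end p (\<lambda>n. Z n \<omega>)", OF \<xi> uniq])
  then have "limit_end p Z \<omega> = \<xi>" unfolding limit_end_def using \<xi> by (metis (full_types))
  then show ?thesis using \<xi> by simp
qed

text \<open>This expresses the preimage of a ball under \<open>limit_end\<close> through the walk
  itself, as needed for measurability.\<close>

lemma limit_end_mem_cyl:
  assumes z: "\<And>n. Z n \<omega> \<in> balls p" and s: "settles (\<lambda>n. Z n \<omega>)"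
  shows "limit_end p Z \<omega> \<in> cyl p k r \<longleftrightarrow> (\<forall>\<^sub>F n in sequentially. Z n \<omega> \<subseteq> cyl p k r)"
proof -
  let ?\<xi> = "limit_end p Z \<omega>"
  have \<xi>: "?\<xi> \<in> Zp p" "\<And>k. \<forall>\<^sub>F n in sequentially. Z n \<omega> \<subseteq> cyl p k (?\<xi> k)"
    using limit_end_settles[of Z \<omega>, OF z s] by (auto simp: tends_to_end_iff)
  show ?thesis
  proof
    assume "?\<xi> \<in> cyl p k r"
    then have "?\<xi> k = r" by (simp add: cyl_def)
    then show "\<forall>\<^sub>F n in sequentially. Z n \<omega> \<subseteq> cyl p k r" using \<xi>(2)[of k] by simp
  next
    assume "\<forall>\<^sub>F n in sequentially. Z n \<omega> \<subseteq> cyl p k r"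
    then have "?\<xi> k mod int p ^ k = r"
      using \<xi>(2)[of k] z by (intro eventually_cyl_unique[of "\<lambda>n. Z n \<omega>" k r k "?\<xi> k"]) auto
    then have "?\<xi> k = r" using Zp_residue[OF \<xi>(1)] by simp
    then show "?\<xi> \<in> cyl p k r" using \<xi>(1) by (simp add: cyl_def)
  qed
qed

lemma limit_end_not_settles:
  assumes z: "\<And>n. Z n \<omega> \<in> balls p" and s: "\<not> settles (\<lambda>n. Z n \<omega>)"
  shows "limit_end p Z \<omega> = (\<lambda>_. 0)"
  unfolding limit_end_def using settles_iff[of "\<lambda>n. Z n \<omega>"] z s by auto

end

context padic_haar
begin

lemma integrable_indicator_cyl: "integrable \<mu> (indicator (cyl p k s) :: padic \<Rightarrow> real)"
  by (simp add: emeasure_eq_measure)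

lemma integral_cyl_cyl:
  assumes r: "r \<in> residues_upto p n" and s: "s \<in> residues_upto p k"
  shows "(\<integral>x. indicator (cyl p n r) x * indicator (cyl p k s) x \<partial>\<mu>) =
     (if k \<le> n then (if r mod int p ^ k = s then inverse (real p ^ n) else 0)
      else (if s mod int p ^ n = r then inverse (real p ^ k) else 0))"
proof -
  have *: "(\<integral>x. indicator (cyl p n r) x * indicator (cyl p k s) x \<partial>\<mu>) = (if r mod int p ^ k = s then inverse (real p ^ n) else 0)"
    if r: "r \<in> residues_upto p n" and s: "s \<in> residues_upto p k" and le: "k \<le> n" for n r k s
  proof (cases "r mod int p ^ k = s")
    case True
    then have "cyl p n r \<subseteq> cyl p k s" using cyl_subset_iff[OF r] le by blast
    then have "indicator (cyl p n r) x * indicator (cyl p k s) x = (indicator (cyl p n r) x :: real)" for x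
      by (auto simp: indicator_def)
    then have "(\<integral>x. indicator (cyl p n r) x * indicator (cyl p k s) x \<partial>\<mu>) = (\<integral>x. (indicator (cyl p n r) x :: real) \<partial>\<mu>)"
      by (simp only:)
    then show ?thesis using True measure_cyl_integral[OF r] by presburger
  next
    case False
    then have "cyl p n r \<inter> cyl p k s = {}"
      using cyl_disjoint_or_subset[OF le, of r s] cyl_subset_iff[OF r, of k s] by blast
    then have "indicator (cyl p n r) x * indicator (cyl p k s) x = (0 :: real)" for x
      by (auto simp: indicator_def)
    then show ?thesis using False by (simp only: Bochner_Integration.integral_zero if_False)
  qed
  show ?thesis
  proof (cases "k \<le> n")
    case True
    then show ?thesis using *[OF r s] by simp
  next
    case False
    then have "(\<integral>x. indicator (cyl p k s) x * indicator (cyl p n r) x \<partial>\<mu>) = (if s mod int p ^ n = r then inverse (real p ^ k) else 0)"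
      by (intro *[OF s r]) simp
    then show ?thesis using False by (simp add: mult.commute)
  qed
qed

end

section \<open>Transience and exit probabilities\<close>

context tree_walk
begin

text \<open>While the level stays at least \<open>k\<close>, a step to a neighbour cannot change the
  ancestor of level \<open>k\<close>; hence this ancestor is eventually constant.\<close>

lemma nearest_neighbour_settles:
  assumes z: "\<And>n. z n \<in> balls p" and nn: "\<And>n. q (z n) (z (Suc n)) \<noteq> 0"
    and lim: "filterlim (\<lambda>n. level (z n)) at_top sequentially"
  shows "settles z"
  unfolding settles_def
proof
  fix k
  have "\<forall>\<^sub>F n in sequentially. k \<le> level (z n)" using lim by (simp add: filterlim_at_top)
  then obtain N where N: "\<And>n. n \<ge> N \<Longrightarrow> k \<le> level (z n)" by (auto simp: eventually_sequentially)
  define a where "a n = residue (z n) mod int p ^ k" for n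
  have step: "a (Suc n) = a n" if n: "n \<ge> N" for n
  proof -
    let ?l = "level (z n)" and ?m = "level (z (Suc n))" and ?r = "residue (z n)" and ?s = "residue (z (Suc n))"
    have "q (cyl p ?l ?r) (cyl p ?m ?s) \<noteq> 0" using nn[of n] by (simp only: ball_cyl[OF z] not_False_eq_True)
    then have "?r mod int p ^ ?m = ?s \<or> ?s mod int p ^ ?l = ?r"
      unfolding walk_prob_cyl[OF ball_cyl(1)[OF z] ball_cyl(1)[OF z]] by (auto split: if_splits)
    moreover have "?r mod int p ^ ?m mod int p ^ k = ?r mod int p ^ k" "?s mod int p ^ ?l mod int p ^ k = ?s mod int p ^ k"
      using N[of n] N[of "Suc n"] n by (simp_all add: mod_mod_cancel le_imp_power_dvd)
    ultimately show ?thesis unfolding a_def by metis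
  qed
  have aN: "a n = a N" if "n \<ge> N" for n
    using that by (induction n rule: dec_induct) (use step in auto)
  have "z n \<subseteq> cyl p k (a N)" if "n \<ge> N" for n
    using cyl_subset_iff[OF ball_cyl(1)[OF z[of n]], of k "a N"] N[OF that] aN[OF that]
    by (simp add: ball_cyl[OF z] a_def)
  moreover have "a N \<in> residues_upto p k" by (simp add: a_def)
  ultimately show "\<exists>s\<in>residues_upto p k. \<forall>\<^sub>F n in sequentially. z n \<subseteq> cyl p k s"
    unfolding eventually_sequentially by blast
qed

text \<open>The walk is transient because \<open>G ^ level v\<close> is strictly superharmonic for every \<open>G\<close> strictly
  between \<open>F\<close> and \<open>1\<close>.\<close>

definition G :: real where "G = (1 + F) / 2"

text \<open>A bound for the factor by which one step shrinks \<open>G ^ level v\<close> on average: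
  \<open>G\<close> is the factor at the root, where the walk surely moves to a child, and the second
  entry is the factor elsewhere.\<close>

definition decay :: real where "decay = max G (c * (F + G\<^sup>2) / G)"

lemma G: "0 < G" "G < 1" "F < G"
  using F by (simp_all add: G_def)

text \<open>The equation \<open>c * (F + G^2) = G\<close> is quadratic in \<open>G\<close> with
  roots \<open>F\<close> and \<open>1\<close>; strictly between them the left side is
  smaller.\<close>

lemma decay: "0 < decay" "decay < 1"
proof -
  have "0 < (G - F) * (1 - G)" using G by simp
  then have "F + G\<^sup>2 < (1 + F) * G" by (simp add: algebra_simps power2_eq_square)
  then have "c * (F + G\<^sup>2) < c * ((1 + F) * G)" using c_pos by (intro mult_strict_left_mono)
  also have "\<dots> = G" using F by (simp add: c)
  finally have "c * (F + G\<^sup>2) / G < 1" using G by simp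
  then show "0 < decay" "decay < 1" using G by (auto simp: decay_def)
qed

lemma step_power_level:
  assumes r: "r \<in> residues_upto p n"
  shows "step (\<lambda>v. G ^ level v) n r \<le> decay * G ^ n"
proof -
  have ch: "(\<Sum>s\<in>children n r. G ^ level (cyl p (Suc n) s)) = real p * G ^ Suc n"
  proof -
    have "(\<Sum>s\<in>children n r. G ^ level (cyl p (Suc n) s)) = (\<Sum>s\<in>children n r. G ^ Suc n)"
      by (rule sum.cong[OF refl]) (simp add: level_cyl[OF childrenD(1)] del: power_Suc)
    then show ?thesis using card_children[OF r] by simp
  qed
  show ?thesis
  proof (cases n)
    case 0
    then have "step (\<lambda>v. G ^ level v) n r = G" using ch p_gt_1 by (simp add: step_def)
    then show ?thesis using 0 by (simp add: decay_def)
  next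
    case (Suc m)
    have "step (\<lambda>v. G ^ level v) n r = F * c * G ^ m + c / real p * (\<Sum>s\<in>children n r. G ^ level (cyl p (Suc n) s))"
      using Suc level_cyl[OF residue_mod[of r m]] by (simp add: step_def)
    also have "\<dots> = c * (F + G\<^sup>2) / G * G ^ n"
      unfolding ch using G p_gt_1 Suc by (simp add: field_simps power2_eq_square)
    also have "\<dots> \<le> decay * G ^ n"
      using G by (intro mult_right_mono) (auto simp: decay_def)
    finally show ?thesis .
  qed
qed

text \<open>Anticipates the probability that the walk from \<open>v\<close> ends in
  \<open>cyl p k s\<close>, which \<open>prob_limit_end_cyl\<close> confirms.\<close>

definition hit :: "nat \<Rightarrow> int \<Rightarrow> vertex \<Rightarrow> real" where
  "hit k s v = (\<integral>x. vdens v x * indicator (cyl p k s) x \<partial>\<mu>)"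

lemma integrable_vdens: "integrable \<mu> (\<lambda>x. vdens v x * indicator (cyl p k s) x)"
  unfolding vdens_def by (rule integrable_dens_mult[OF integrable_indicator_cyl])

lemma step_hit:
  assumes r: "r \<in> residues_upto p n"
  shows "step (hit k s) n r = hit k s (cyl p n r)"
proof -
  let ?i = "indicator (cyl p k s) :: padic \<Rightarrow> real"
  have "hit k s (cyl p n r) = (\<integral>x. step (\<lambda>v. vdens v x) n r * ?i x \<partial>\<mu>)"
    unfolding hit_def
    by (rule Bochner_Integration.integral_cong[OF refl]) (simp add: step_dens[OF r])
  also have "\<dots> = step (hit k s) n r"
  proof (cases "n = 0")
    case True
    then have "step (\<lambda>v. vdens v x) n r * y = (\<Sum>t\<in>children 0 r. vdens (cyl p 1 t) x * y) / p" for x y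
      by (simp add: step_def sum_distrib_right)
    then have "(\<integral>x. step (\<lambda>v. vdens v x) n r * ?i x \<partial>\<mu>)
      = (\<integral>x. (\<Sum>t\<in>children 0 r. vdens (cyl p 1 t) x * ?i x) / p \<partial>\<mu>)"
      by (simp only:)
    also have "\<dots> = (\<Sum>t\<in>children 0 r. \<integral>x. vdens (cyl p 1 t) x * ?i x \<partial>\<mu>) / p"
      by (simp only: Bochner_Integration.integral_divide_zero Bochner_Integration.integral_sum integrable_vdens)
    finally show ?thesis using True by (simp add: step_def hit_def)
  next
    case False
    let ?u = "cyl p (n - 1) (r mod int p ^ (n - 1))"
    have "step (\<lambda>v. vdens v x) n r * y
      = F * c * (vdens ?u x * y) + c / p * (\<Sum>t\<in>children n r. vdens (cyl p (Suc n) t) x * y)" for x y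
      using False by (simp add: step_def sum_distrib_right distrib_right sum_distrib_left mult.assoc)
    then have "(\<integral>x. step (\<lambda>v. vdens v x) n r * ?i x \<partial>\<mu>)
      = (\<integral>x. F * c * (vdens ?u x * ?i x) + c / p * (\<Sum>t\<in>children n r. vdens (cyl p (Suc n) t) x * ?i x) \<partial>\<mu>)"
      by (simp only:)
    also have "\<dots> = F * c * (\<integral>x. vdens ?u x * ?i x \<partial>\<mu>)
        + c / p * (\<Sum>t\<in>children n r. \<integral>x. vdens (cyl p (Suc n) t) x * ?i x \<partial>\<mu>)"
      by (simp only: Bochner_Integration.integral_add Bochner_Integration.integral_mult_right_zero Bochner_Integration.integral_sum
          integrable_vdens Bochner_Integration.integrable_sum Bochner_Integration.integrable_mult_right)
    finally show ?thesis using False by (simp add: step_def hit_def)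
  qed
  finally show ?thesis ..
qed

lemma hit_nonneg: "hit k s v \<ge> 0"
  unfolding hit_def vdens_def using dens_nonneg by (intro integral_nonneg_AE) auto

lemma integral_dens: "(\<integral>x. dens n r x \<partial>\<mu>) = 1" if "r \<in> residues_upto p n"
  using that
proof (induction n arbitrary: r)
  case (Suc n)
  have one: "integrable \<mu> (\<lambda>x. 1 :: real)" by simp
  have "(\<integral>x. dens (Suc n) r x \<partial>\<mu>) = F * (\<integral>x. dens n (r mod int p ^ n) x \<partial>\<mu>)
     + (1 - F) * real p ^ Suc n * (\<integral>x. indicator (cyl p (Suc n) r) x \<partial>\<mu>)"
    using integral_dens_Suc[OF one, of n r] by (simp only: mult_1_right)
  also have "\<dots> = F * 1 + (1 - F) * real p ^ Suc n * inverse (real p ^ Suc n)"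
    by (simp only: Suc.IH[OF residue_mod] measure_cyl_integral[OF Suc.prems])
  also have "\<dots> = F + (1 - F) * (real p ^ Suc n * inverse (real p ^ Suc n))"
    by (simp only: mult_1_right mult.assoc)
  also have "real p ^ Suc n * inverse (real p ^ Suc n) = 1"
    by (rule right_inverse) simp
  finally show ?case by simp
next
  case 0
  have "dens 0 r = (\<lambda>x. 1)" by (simp add: fun_eq_iff)
  then show ?case using prob_space by simp
qed

lemma hit_le_1: "v \<in> balls p \<Longrightarrow> hit k s v \<le> 1"
proof -
  assume v: "v \<in> balls p"
  have one: "integrable \<mu> (\<lambda>x. vdens v x * 1)"
    unfolding vdens_def by (rule integrable_dens_mult) simp
  have "hit k s v \<le> (\<integral>x. vdens v x * 1 \<partial>\<mu>)"
    unfolding hit_def using one integrable_vdens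
    by (intro integral_mono mult_left_mono) (auto simp: vdens_def dens_nonneg indicator_def)
  also have "\<dots> = 1" using integral_dens[OF ball_cyl(1)[OF v]] by (simp add: vdens_def)
  finally show ?thesis .
qed

lemma hit_Suc:
  assumes r: "r \<in> residues_upto p (Suc n)" and s: "s \<in> residues_upto p k" and k: "k \<le> Suc n"
  shows "hit k s (cyl p (Suc n) r) = F * hit k s (cyl p n (r mod int p ^ n))
     + (if r mod int p ^ k = s then 1 - F else 0)"
proof -
  have "(\<integral>x. indicator (cyl p (Suc n) r) x * indicator (cyl p k s) x \<partial>\<mu>)
      = (if r mod int p ^ k = s then inverse (real p ^ Suc n) else 0)"
    using integral_cyl_cyl[OF r s] k by simp
  then have "hit k s (cyl p (Suc n) r) = F * hit k s (cyl p n (r mod int p ^ n))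
     + (1 - F) * real p ^ Suc n * (if r mod int p ^ k = s then inverse (real p ^ Suc n) else 0)"
    unfolding hit_def vdens_cyl[OF r] vdens_cyl[OF residue_mod]
    using integral_dens_Suc[OF integrable_indicator_cyl, of n r k s] by simp
  moreover have "real p ^ Suc n * inverse (real p ^ Suc n) = 1"
    by (rule right_inverse) simp
  ultimately show ?thesis by (simp only: mult.assoc) simp
qed

text \<open>From level \<open>k\<close> on, the last term in \<open>hit_Suc\<close> is constant
  along descendants, so the deviation from zero or one is multiplied by \<open>F\<close> at each
  further level. Thus \<open>hit k s\<close> has the indicator of the cylinder as its boundary
  values.\<close>

lemma hit_bounds:
  assumes "k \<le> n" "r \<in> residues_upto p n" and s: "s \<in> residues_upto p k"
  shows "\<bar>hit k s (cyl p n r) - (if r mod int p ^ k = s then 1 else 0)\<bar> \<le> F ^ (n - k)"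
  using assms(1,2)
proof (induction n arbitrary: r rule: dec_induct)
  case base
  then show ?case using hit_nonneg[of k s "cyl p k r"] hit_le_1[OF cyl_in_balls[OF base], of k s] by auto
next
  case (step n)
  let ?r = "r mod int p ^ n"
  let ?e = "if r mod int p ^ k = s then 1 else 0 :: real"
  have m: "?r mod int p ^ k = r mod int p ^ k"
    using step.hyps by (simp add: mod_mod_cancel le_imp_power_dvd)
  have "hit k s (cyl p (Suc n) r) - ?e = F * (hit k s (cyl p n ?r) - ?e)"
    using hit_Suc[OF step.prems s] step.hyps by (simp add: algebra_simps)
  then have "\<bar>hit k s (cyl p (Suc n) r) - ?e\<bar> = F * \<bar>hit k s (cyl p n ?r) - ?e\<bar>"
    using F by (simp add: abs_mult)
  also have "\<dots> \<le> F * F ^ (n - k)"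
    using step.IH[OF residue_mod, of r] F unfolding m by (intro mult_left_mono) auto
  also have "\<dots> = F ^ (Suc n - k)" using step.hyps by (simp add: Suc_diff_le)
  finally show ?case .
qed

end

section \<open>Exit laws through the limit of a bounded martingale\<close>

locale boundary_walk = tree_walk +
  fixes P :: "vertex \<Rightarrow> 'w measure" and Z :: "nat \<Rightarrow> 'w \<Rightarrow> vertex"
  assumes walk: "random_walk p (walk_prob p c) P Z"
begin

context
  fixes u assumes u: "u \<in> balls p"
begin

interpretation W: countable_chain "P u" "balls p" q u Z
proof -
  have pP: "prob_space (P u)" and Z: "\<And>n. Z n \<in> P u \<rightarrow>\<^sub>M count_space (balls p)"
    and pr: "\<And>n v. (\<And>i. i \<le> n \<Longrightarrow> v i \<in> balls p) \<Longrightarrow>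
        measure (P u) {\<omega> \<in> space (P u). \<forall>i\<le>n. Z i \<omega> = v i} =
          (if v 0 = u then (\<Prod>i<n. q (v i) (v (Suc i))) else 0)"
    using walk u unfolding random_walk_def by auto
  show "countable_chain (P u) (balls p) q u Z"
    by (intro countable_chain.intro countable_chain_axioms.intro countable_balls q_nonneg pP Z) (rule pr)
qed

lemma nn_integral_walk_Suc:
  assumes f: "\<And>v. v \<in> balls p \<Longrightarrow> f v \<ge> 0"
  shows "(\<integral>\<^sup>+\<omega>. ennreal (f (Z (Suc n) \<omega>)) \<partial>P u)
       = (\<integral>\<^sup>+\<omega>. ennreal (step f (level (Z n \<omega>)) (residue (Z n \<omega>))) \<partial>P u)"
proof (rule trans[OF W.nn_integral_Suc nn_integral_cong])
  fix \<omega> assume "\<omega> \<in> space (P u)"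
  then have b: "Z n \<omega> \<in> balls p" by (rule W.Z_in_V)
  show "(\<integral>\<^sup>+y. ennreal (q (Z n \<omega>) y) * ennreal (f y) \<partial>count_space (balls p))
      = ennreal (step f (level (Z n \<omega>)) (residue (Z n \<omega>)))"
    using nn_integral_step[OF ball_cyl(1)[OF b], of f] f by (simp add: ball_cyl(2)[OF b])
qed

lemma measurable_walk: "(\<lambda>\<omega>. f (Z n \<omega>)) \<in> P u \<rightarrow>\<^sub>M count_space UNIV"
  using measurable_compose[OF W.Z_meas, of f "count_space UNIV" n] by simp

lemma borel_measurable_walk: "(\<lambda>\<omega>. f (Z n \<omega>) :: real) \<in> borel_measurable (P u)"
  using measurable_compose[OF W.Z_meas, of f borel n] by simp

text \<open>The expectation of \<open>G ^ level (Z n \<omega>)\<close> is at most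
  \<open>decay ^ n\<close>, so the sum over \<open>n\<close> is almost surely finite and its terms
  tend to zero.\<close>

lemma AE_level_at_top: "AE \<omega> in P u. filterlim (\<lambda>n. level (Z n \<omega>)) at_top sequentially"
proof -
  have [measurable]: "(\<lambda>\<omega>. ennreal (G ^ level (Z n \<omega>))) \<in> borel_measurable (P u)" for n
    using borel_measurable_walk[of "\<lambda>v. G ^ level v"] by simp
  have bound: "(\<integral>\<^sup>+\<omega>. ennreal (G ^ level (Z n \<omega>)) \<partial>P u) \<le> ennreal (decay ^ n)" for n
  proof (induction n)
    case 0
    have "(\<integral>\<^sup>+\<omega>. ennreal (G ^ level (Z 0 \<omega>)) \<partial>P u) \<le> (\<integral>\<^sup>+\<omega>. 1 \<partial>P u)"
      using G by (intro nn_integral_mono) (simp add: power_le_one)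
    then show ?case by (simp add: W.emeasure_space_1)
  next
    case (Suc n)
    have "(\<integral>\<^sup>+\<omega>. ennreal (G ^ level (Z (Suc n) \<omega>)) \<partial>P u)
        = (\<integral>\<^sup>+\<omega>. ennreal (step (\<lambda>v. G ^ level v) (level (Z n \<omega>)) (residue (Z n \<omega>))) \<partial>P u)"
      by (rule nn_integral_walk_Suc) (use G in simp)
    also have "\<dots> \<le> (\<integral>\<^sup>+\<omega>. ennreal decay * ennreal (G ^ level (Z n \<omega>)) \<partial>P u)"
    proof (rule nn_integral_mono)
      fix \<omega> assume "\<omega> \<in> space (P u)"
      then have "Z n \<omega> \<in> balls p" by (rule W.Z_in_V)
      then have "step (\<lambda>v. G ^ level v) (level (Z n \<omega>)) (residue (Z n \<omega>)) \<le> decay * G ^ level (Z n \<omega>)"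
        by (intro step_power_level ball_cyl)
      then show "ennreal (step (\<lambda>v. G ^ level v) (level (Z n \<omega>)) (residue (Z n \<omega>)))
          \<le> ennreal decay * ennreal (G ^ level (Z n \<omega>))"
        using decay G by (simp add: ennreal_mult[symmetric] ennreal_leI)
    qed
    also have "\<dots> = ennreal decay * (\<integral>\<^sup>+\<omega>. ennreal (G ^ level (Z n \<omega>)) \<partial>P u)"
      by (rule nn_integral_cmult) measurable
    also have "\<dots> \<le> ennreal decay * ennreal (decay ^ n)" by (intro mult_left_mono Suc) simp
    also have "\<dots> = ennreal (decay ^ Suc n)" using decay by (simp add: ennreal_mult)
    finally show ?case .
  qed
  have "(\<integral>\<^sup>+\<omega>. (\<Sum>n. ennreal (G ^ level (Z n \<omega>))) \<partial>P u) = (\<Sum>n. \<integral>\<^sup>+\<omega>. ennreal (G ^ level (Z n \<omega>)) \<partial>P u)"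
    by (rule nn_integral_suminf) measurable
  also have "\<dots> \<le> (\<Sum>n. ennreal (decay ^ n))" by (intro suminf_le bound) auto
  also have "\<dots> = ennreal (\<Sum>n. decay ^ n)"
    using decay by (intro suminf_ennreal2 summable_geometric) auto
  also have "\<dots> < \<infinity>" by simp
  finally have "(\<integral>\<^sup>+\<omega>. (\<Sum>n. ennreal (G ^ level (Z n \<omega>))) \<partial>P u) \<noteq> \<infinity>" by simp
  then have "AE \<omega> in P u. (\<Sum>n. ennreal (G ^ level (Z n \<omega>))) \<noteq> \<infinity>"
    by (rule nn_integral_PInf_AE[rotated]) measurable
  then show ?thesis
  proof eventually_elim
    case (elim \<omega>)
    have "summable (\<lambda>n. G ^ level (Z n \<omega>))"
      using elim G by (intro summable_suminf_not_top) auto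
    then have lim: "(\<lambda>n. G ^ level (Z n \<omega>)) \<longlonglongrightarrow> 0" by (rule summable_LIMSEQ_zero)
    show ?case
      unfolding filterlim_at_top
    proof
      fix k
      have "\<forall>\<^sub>F n in sequentially. G ^ level (Z n \<omega>) < G ^ k"
        using lim G by (intro order_tendstoD(2)[OF lim]) simp
      then show "\<forall>\<^sub>F n in sequentially. k \<le> level (Z n \<omega>)"
      proof eventually_elim
        case (elim n)
        then show ?case using G power_decreasing[of "level (Z n \<omega>)" k G] by (intro leI) force
      qed
    qed
  qed
qed

lemma AE_settles: "AE \<omega> in P u. settles (\<lambda>n. Z n \<omega>)"
  using AE_level_at_top W.AE_transition AE_space
  by eventually_elim (rule nearest_neighbour_settles; use W.Z_in_V in auto)

lemma measurable_eventually_subset: "Measurable.pred (P u) (\<lambda>\<omega>. \<forall>\<^sub>F n in sequentially. Z n \<omega> \<subseteq> B)"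
proof -
  have [measurable]: "Measurable.pred (P u) (\<lambda>\<omega>. Z n \<omega> \<subseteq> B)" for n
    by (rule measurable_walk[of "\<lambda>v. v \<subseteq> B"])
  show ?thesis unfolding eventually_sequentially by measurable
qed

lemma measurable_settles: "Measurable.pred (P u) (\<lambda>\<omega>. settles (\<lambda>n. Z n \<omega>))"
proof -
  note [measurable] = measurable_eventually_subset
  have "Measurable.pred (P u) (\<lambda>\<omega>. \<forall>k. \<exists>s. s \<in> residues_upto p k \<and> (\<forall>\<^sub>F n in sequentially. Z n \<omega> \<subseteq> cyl p k s))"
    by measurable
  then show ?thesis unfolding settles_def Bex_def .
qed

lemma measurable_limit_end: "limit_end p Z \<in> P u \<rightarrow>\<^sub>M Zp_borel p"
proof (rule measurable_sigma_sets[OF sets_Zp_borel balls_sub])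
  have Zb: "Z n \<omega> \<in> balls p" if "\<omega> \<in> space (P u)" for n \<omega> using that by (rule W.Z_in_V)
  show "limit_end p Z \<in> space (P u) \<rightarrow> Zp p"
  proof
    fix \<omega> assume "\<omega> \<in> space (P u)"
    then show "limit_end p Z \<omega> \<in> Zp p"
      using limit_end_settles[of Z \<omega>] limit_end_not_settles[of Z \<omega>] Zb residue_in_Zp[of 0]
      by (cases "settles (\<lambda>n. Z n \<omega>)") (auto simp: tends_to_end_def)
  qed
  fix B assume "B \<in> balls p"
  then obtain k s where B: "B = cyl p k s" by (rule ballsE)
  \<comment> \<open>Trajectories that do not settle are sent to the dummy value zero, so they belong
    to the preimage exactly if zero lies in \<open>B\<close>.\<close>
  have "limit_end p Z -` B \<inter> space (P u) = {\<omega> \<in> space (P u). if settles (\<lambda>n. Z n \<omega>)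
      then \<forall>\<^sub>F n in sequentially. Z n \<omega> \<subseteq> B else (\<lambda>_. 0) \<in> B}"
  proof (intro set_eqI)
    fix \<omega>
    show "\<omega> \<in> limit_end p Z -` B \<inter> space (P u) \<longleftrightarrow> \<omega> \<in> {\<omega> \<in> space (P u). if settles (\<lambda>n. Z n \<omega>)
        then \<forall>\<^sub>F n in sequentially. Z n \<omega> \<subseteq> B else (\<lambda>_. 0) \<in> B}"
    proof (cases "\<omega> \<in> space (P u)")
      case True
      have b: "\<And>n. Z n \<omega> \<in> balls p" using Zb True .
      show ?thesis using limit_end_mem_cyl[of Z \<omega> k s, OF b] limit_end_not_settles[of Z \<omega>, OF b] True
        by (simp add: B)
    qed simp
  qed
  also have "\<dots> \<in> sets (P u)"
    using measurable_settles measurable_eventually_subset[of B] by measurable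
  finally show "limit_end p Z -` B \<inter> space (P u) \<in> sets (P u)" .
qed

text \<open>The martingale property of \<open>hit k s\<close> along the walk, obtained from its
  harmonicity one step at a time.\<close>

lemma expectation_hit: "(\<integral>\<omega>. hit k s (Z n \<omega>) \<partial>P u) = hit k s u"
proof -
  have "(\<integral>\<^sup>+\<omega>. ennreal (hit k s (Z n \<omega>)) \<partial>P u) = ennreal (hit k s u)"
  proof (induction n)
    case 0
    have "(\<integral>\<^sup>+\<omega>. ennreal (hit k s (Z 0 \<omega>)) \<partial>P u) = (\<integral>\<^sup>+\<omega>. ennreal (hit k s u) \<partial>P u)"
      using W.AE_start[OF u] by (intro nn_integral_cong_AE) auto
    then show ?case by (simp add: W.emeasure_space_1)
  next
    case (Suc n)
    have "(\<integral>\<^sup>+\<omega>. ennreal (hit k s (Z (Suc n) \<omega>)) \<partial>P u)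
       = (\<integral>\<^sup>+\<omega>. ennreal (step (hit k s) (level (Z n \<omega>)) (residue (Z n \<omega>))) \<partial>P u)"
      by (rule nn_integral_walk_Suc) (rule hit_nonneg)
    also have "\<dots> = (\<integral>\<^sup>+\<omega>. ennreal (hit k s (Z n \<omega>)) \<partial>P u)"
    proof (rule nn_integral_cong)
      fix \<omega> assume "\<omega> \<in> space (P u)"
      then have b: "Z n \<omega> \<in> balls p" by (rule W.Z_in_V)
      show "ennreal (step (hit k s) (level (Z n \<omega>)) (residue (Z n \<omega>))) = ennreal (hit k s (Z n \<omega>))"
        by (simp only: step_hit[OF ball_cyl(1)[OF b]] ball_cyl(2)[OF b])
    qed
    finally show ?case using Suc by simp
  qed
  then show ?thesis
    using hit_nonneg by (subst integral_eq_nn_integral) (auto intro: borel_measurable_walk)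
qed

text \<open>Along almost every trajectory \<open>hit k s\<close> tends to the indicator of the event
  that the end lies in the cylinder, by \<open>hit_bounds\<close>. Its expectation stays constant,
  so dominated convergence identifies the probability.\<close>

lemma prob_limit_end_cyl:
  assumes s: "s \<in> residues_upto p k"
  shows "measure (P u) (limit_end p Z -` cyl p k s \<inter> space (P u)) = hit k s u"
proof -
  let ?E = "limit_end p Z -` cyl p k s \<inter> space (P u)"
  have E: "?E \<in> sets (P u)" by (rule measurable_sets[OF measurable_limit_end]) simp
  have "(\<lambda>n. \<integral>\<omega>. hit k s (Z n \<omega>) \<partial>P u) \<longlonglongrightarrow> (\<integral>\<omega>. indicator ?E \<omega> \<partial>P u)"
  proof (rule integral_dominated_convergence[where w = "\<lambda>_. 1"])
    show "(indicator ?E :: _ \<Rightarrow> real) \<in> borel_measurable (P u)" using E by simp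
    show "(\<lambda>\<omega>. hit k s (Z n \<omega>)) \<in> borel_measurable (P u)" for n by (rule borel_measurable_walk)
    show "AE \<omega> in P u. norm (hit k s (Z n \<omega>)) \<le> 1" for n
      using W.Z_in_V hit_nonneg hit_le_1 by (intro AE_I2) simp
    show "AE \<omega> in P u. (\<lambda>n. hit k s (Z n \<omega>)) \<longlonglongrightarrow> indicator ?E \<omega>"
      using AE_level_at_top AE_settles AE_space
    proof eventually_elim
      case (elim \<omega>)
      have b: "Z n \<omega> \<in> balls p" for n using elim(3) by (rule W.Z_in_V)
      define \<xi> where "\<xi> = limit_end p Z \<omega>"
      have t: "\<xi> \<in> Zp p" "\<forall>\<^sub>F n in sequentially. Z n \<omega> \<subseteq> cyl p k (\<xi> k)"
        using limit_end_settles[of Z \<omega>, OF b elim(2)] by (auto simp: tends_to_end_iff \<xi>_def)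
      have ind: "indicator ?E \<omega> = (if \<xi> k = s then 1 else 0 :: real)"
        using elim(3) t(1) by (auto simp: indicator_def cyl_def \<xi>_def)
      have "((\<lambda>n. hit k s (Z n \<omega>) - indicator ?E \<omega>) \<longlongrightarrow> 0) sequentially"
      proof (rule Lim_null_comparison)
        have "\<forall>\<^sub>F n in sequentially. k \<le> level (Z n \<omega>)" using elim(1) by (simp add: filterlim_at_top)
        then show "\<forall>\<^sub>F n in sequentially. norm (hit k s (Z n \<omega>) - indicator ?E \<omega>) \<le> F ^ (level (Z n \<omega>) - k)"
          using t(2)
        proof eventually_elim
          case (elim n)
          have "residue (Z n \<omega>) mod int p ^ k = \<xi> k"
            using elim(2) cyl_subset_iff[OF ball_cyl(1)[OF b], of n k "\<xi> k"] by (simp add: ball_cyl(2)[OF b])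
          then show ?case
            using hit_bounds[OF elim(1) ball_cyl(1)[OF b] s] by (simp add: ball_cyl(2)[OF b] ind)
        qed
        have "filterlim (\<lambda>n. level (Z n \<omega>) - k) at_top sequentially"
          using elim(1) by (rule filterlim_compose[OF filterlim_minus_const_nat_at_top])
        then show "((\<lambda>n. F ^ (level (Z n \<omega>) - k)) \<longlongrightarrow> 0) sequentially"
          using F by (intro filterlim_compose[OF LIMSEQ_power_zero]) auto
      qed
      then show ?case by (simp add: LIM_zero_iff)
    qed
  qed simp
  then have "hit k s u = (\<integral>\<omega>. indicator ?E \<omega> \<partial>P u)"
    unfolding expectation_hit by (rule LIMSEQ_unique[OF tendsto_const])
  then show ?thesis using E by simp
qed

lemma exit_law_density: "exit_law p P Z u = density \<mu> (\<lambda>x. ennreal (vdens u x))"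
proof (rule Zp_measure_eqI)
  show "finite_measure (exit_law p P Z u)"
    unfolding exit_law_def by (rule W.finite_measure_distr[OF measurable_limit_end])
  fix n r assume r: "r \<in> residues_upto p n"
  have "emeasure (exit_law p P Z u) (cyl p n r) = ennreal (hit n r u)"
    unfolding exit_law_def emeasure_distr[OF measurable_limit_end cyl_in_sets]
    using prob_limit_end_cyl[OF r] by (simp add: W.emeasure_eq_measure)
  also have "\<dots> = (\<integral>\<^sup>+x. ennreal (vdens u x * indicator (cyl p n r) x) \<partial>\<mu>)"
    unfolding hit_def
    using integrable_vdens by (intro nn_integral_eq_integral[symmetric]) (auto simp: vdens_def dens_nonneg)
  also have "\<dots> = (\<integral>\<^sup>+x. ennreal (vdens u x) * indicator (cyl p n r) x \<partial>\<mu>)"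
    by (intro nn_integral_cong) (simp add: indicator_def)
  also have "\<dots> = emeasure (density \<mu> (\<lambda>x. ennreal (vdens u x))) (cyl p n r)"
    by (subst emeasure_density) (auto simp: vdens_def)
  finally show "emeasure (exit_law p P Z u) (cyl p n r) = emeasure (density \<mu> (\<lambda>x. ennreal (vdens u x))) (cyl p n r)" .
qed (simp_all add: exit_law_def)

end

lemma exit_law_root: "exit_law p P Z (Zp p) = \<mu>"
proof -
  have "vdens (Zp p) = (\<lambda>x. 1)" using vdens_cyl[of 0 0] by (simp add: cyl_0 fun_eq_iff)
  then show ?thesis using exit_law_density[OF root_in_balls] by (simp add: density_1)
qed

lemma harmonic_ext_cyl:
  assumes r: "r \<in> residues_upto p n" and \<psi>: "\<psi> \<in> borel_measurable \<mu>"
  shows "harmonic_ext (exit_law p P Z) \<psi> (cyl p n r) = (\<integral>x. dens n r x * \<psi> x \<partial>\<mu>)"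
  unfolding harmonic_ext_def exit_law_density[OF cyl_in_balls[OF r]] vdens_cyl[OF r]
  using \<psi> by (subst integral_density) (auto simp: dens_nonneg)

end

section \<open>The energy form on wavelets\<close>

context padic
begin

text \<open>The index \<open>m\<close> is the level of the parent. The \<open>p\<close> wavelets
  with a common parent add up to zero; this redundant family treats all balls alike, where a basis
  would have to single out one child.\<close>

definition wavelet :: "nat \<Rightarrow> int \<Rightarrow> padic \<Rightarrow> real" where
  "wavelet m s x = indicator (cyl p (Suc m) s) x - indicator (cyl p m (s mod int p ^ m)) x / real p"

text \<open>The constant value of the wavelet on a ball of level greater than \<open>m\<close> with
  residue \<open>r\<close>. It turns integrals over a level into finite sums over residues.\<close>

definition wavelet_val :: "nat \<Rightarrow> int \<Rightarrow> int \<Rightarrow> real" where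
  "wavelet_val m s r = (if r mod int p ^ Suc m = s then 1 else 0)
     - (if r mod int p ^ m = s mod int p ^ m then 1 else 0) / real p"

lemma wavelet_eq_val:
  assumes "m \<le> j" "x \<in> cyl p (Suc j) r"
  shows "wavelet m s x = wavelet_val m s r"
proof -
  have x: "x \<in> Zp p" "x (Suc j) = r" using assms(2) by (auto simp: cyl_def)
  have "r mod int p ^ Suc m = x (Suc m)" "r mod int p ^ m = x m"
    using Zp_mod[OF x(1), of "Suc m" "Suc j"] Zp_mod[OF x(1), of m "Suc j"] assms(1) x(2) by simp_all
  then show ?thesis using x(1) unfolding wavelet_def wavelet_val_def indicator_cyl by simp
qed

lemma wavelet_val_mod:
  assumes "m < j"
  shows "wavelet_val m s (r mod int p ^ j) = wavelet_val m s r"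
proof -
  have "r mod int p ^ j mod int p ^ Suc m = r mod int p ^ Suc m" "r mod int p ^ j mod int p ^ m = r mod int p ^ m"
    using assms by (intro mod_mod_cancel le_imp_power_dvd; simp)+
  then show ?thesis unfolding wavelet_val_def by simp
qed

lemma sum_by_parent:
  "(\<Sum>r\<in>residues_upto p (Suc j). g r) = (\<Sum>t\<in>residues_upto p j. \<Sum>r\<in>children j t. (g r :: real))"
  unfolding children_def
  by (rule sum.group[symmetric]) auto

lemma bounded_measurable_wavelet: "bounded_measurable (Zp_borel p) (wavelet m s)"
proof -
  have ind: "bounded_measurable (Zp_borel p) (indicator (cyl p k t))" for k t
    unfolding bounded_measurable_def by (auto intro!: exI[of _ 1] simp: indicator_def)
  have "bounded_measurable (Zp_borel p) (\<lambda>x. 1 * indicator (cyl p (Suc m) s) x + (- 1 / real p) * indicator (cyl p m (s mod int p ^ m)) x)"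
    by (rule bounded_measurable_add[OF ind ind])
  moreover have "wavelet m s = (\<lambda>x. 1 * indicator (cyl p (Suc m) s) x + (- 1 / real p) * indicator (cyl p m (s mod int p ^ m)) x)"
    by (simp add: wavelet_def fun_eq_iff)
  ultimately show ?thesis by simp
qed

text \<open>The pair \<open>(j, r)\<close> codes the edge from \<open>cyl p (Suc j) r\<close> to its
  predecessor, so that the tree energy can be summed level by level.\<close>

definition edges :: "(nat \<times> int) set" where
  "edges = (SIGMA j:UNIV. residues_upto p (Suc j))"

lemma bij_betw_edges: "bij_betw (\<lambda>(j, r). cyl p (Suc j) r) edges (balls p - {Zp p})"
proof (rule bij_betwI')
  fix x y assume xy: "x \<in> edges" "y \<in> edges"
  obtain j r where x: "x = (j, r)" "r \<in> residues_upto p (Suc j)" using xy(1) unfolding edges_def by blast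
  obtain k s where y: "y = (k, s)" "s \<in> residues_upto p (Suc k)" using xy(2) unfolding edges_def by blast
  show "(case x of (j, r) \<Rightarrow> cyl p (Suc j) r) = (case y of (j, r) \<Rightarrow> cyl p (Suc j) r) \<longleftrightarrow> x = y"
    using cyl_eq_iff[OF x(2) y(2)] by (simp add: x(1) y(1))
next
  fix x assume x: "x \<in> edges"
  obtain j r where x: "x = (j, r)" "r \<in> residues_upto p (Suc j)" using x unfolding edges_def by blast
  show "(case x of (j, r) \<Rightarrow> cyl p (Suc j) r) \<in> balls p - {Zp p}"
    using cyl_in_balls[OF x(2)] cyl_eq_root_iff[OF x(2)] by (simp add: x(1))
next
  fix v assume v: "v \<in> balls p - {Zp p}"
  then obtain n r where n: "v = cyl p n r" "r \<in> residues_upto p n" using ballsE by blast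
  then obtain j where "n = Suc j" using v cyl_eq_root_iff[OF n(2)] by (cases n) auto
  then show "\<exists>x\<in>edges. v = (case x of (j, r) \<Rightarrow> cyl p (Suc j) r)"
    using n by (intro bexI[of _ "(j, r)"]) (auto simp: edges_def)
qed

end

section \<open>Conductances and harmonic extensions of wavelets\<close>

context tree_walk
begin

lemma ancestors_cyl:
  assumes r: "r \<in> residues_upto p n"
  shows "{w \<in> balls p. cyl p n r \<subseteq> w \<and> w \<noteq> Zp p} = (\<lambda>k. cyl p k (r mod int p ^ k)) ` {1..n}"
proof (intro equalityI subsetI)
  fix w assume "w \<in> {w \<in> balls p. cyl p n r \<subseteq> w \<and> w \<noteq> Zp p}"
  then have w: "w \<in> balls p" "cyl p n r \<subseteq> w" "w \<noteq> Zp p" by auto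
  obtain k s where k: "w = cyl p k s" "s \<in> residues_upto p k" by (rule ballsE[OF w(1)])
  have "k \<le> n" "r mod int p ^ k = s" using w(2) cyl_subset_iff[OF r] k by auto
  moreover have "k \<noteq> 0" using w(3) cyl_eq_root_iff[OF k(2)] k(1) by simp
  ultimately show "w \<in> (\<lambda>k. cyl p k (r mod int p ^ k)) ` {1..n}" using k(1) by auto
next
  fix w assume "w \<in> (\<lambda>k. cyl p k (r mod int p ^ k)) ` {1..n}"
  then obtain k where k: "w = cyl p k (r mod int p ^ k)" "1 \<le> k" "k \<le> n" by auto
  show "w \<in> {w \<in> balls p. cyl p n r \<subseteq> w \<and> w \<noteq> Zp p}"
    using k cyl_in_balls[OF residue_mod[of r k]] cyl_eq_root_iff[OF residue_mod[of r k]] cyl_subset_iff[OF r, of k] by simp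
qed

text \<open>The edge at the root contributes \<open>1 / (p * F * c)\<close> to the weight and each
  later edge \<open>1 / (p * F)\<close>; the final factor \<open>q v (pred p v) = F * c\<close>
  cancels what the root edge has left over.\<close>

lemma conductance_cyl:
  assumes r: "r \<in> residues_upto p (Suc j)"
  shows "conductance p q (cyl p (Suc j) r) = 1 / (real p ^ Suc j * F ^ j)"
proof -
  have edge: "q (pred p (cyl p (Suc k) t)) (cyl p (Suc k) t) = (if k = 0 then 1 / real p else c / real p)"
    "q (cyl p (Suc k) t) (pred p (cyl p (Suc k) t)) = F * c"
    if t: "t \<in> residues_upto p (Suc k)" for k t
    unfolding pred_cyl[OF t] walk_prob_cyl[OF residue_mod t] walk_prob_cyl[OF t residue_mod] by simp_all
  have "vertex_weight p q (cyl p (Suc j) r)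
      = (\<Prod>k\<in>{1..Suc j}. q (pred p (cyl p k (r mod int p ^ k))) (cyl p k (r mod int p ^ k))
          / q (cyl p k (r mod int p ^ k)) (pred p (cyl p k (r mod int p ^ k))))"
    unfolding vertex_weight_def ancestors_cyl[OF r]
  proof (rule prod.reindex_cong[OF _ refl refl])
    show "inj_on (\<lambda>k. cyl p k (r mod int p ^ k)) {1..Suc j}"
      by (rule inj_onI) (use cyl_eq_iff[OF residue_mod residue_mod] in blast)
  qed
  also have "\<dots> = (\<Prod>k\<in>{0..j}. (if k = 0 then 1 / real p else c / real p) / (F * c))"
  proof (rule prod.reindex_cong[of Suc])
    show "{1..Suc j} = Suc ` {0..j}" by (simp add: image_Suc_atLeastAtMost)
    fix k assume "k \<in> {0..j}"
    show "q (pred p (cyl p (Suc k) (r mod int p ^ Suc k))) (cyl p (Suc k) (r mod int p ^ Suc k))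
          / q (cyl p (Suc k) (r mod int p ^ Suc k)) (pred p (cyl p (Suc k) (r mod int p ^ Suc k)))
        = (if k = 0 then 1 / real p else c / real p) / (F * c)"
      by (simp only: edge[OF residue_mod])
  qed simp
  also have "\<dots> = 1 / (real p ^ Suc j * F ^ j) / (F * c)"
  proof (induction j)
    case (Suc j)
    have "(\<Prod>k\<in>{0..Suc j}. (if k = 0 then 1 / real p else c / real p) / (F * c))
        = 1 / (real p ^ Suc j * F ^ j) / (F * c) * (c / real p / (F * c))"
      using Suc by (simp add: atLeast0_atMost_Suc)
    also have "\<dots> = 1 / (real p ^ Suc (Suc j) * F ^ Suc j) / (F * c)"
      using F c_pos p_gt_1 by (simp add: field_simps)
    finally show ?case .
  qed simp
  finally show ?thesis
    unfolding conductance_def edge(2)[OF r] using F c_pos by simp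
qed

text \<open>A ball of level greater than \<open>m\<close> sees a constant. One of level at most
  \<open>m\<close> either contains the support of the wavelet or misses it, and the wavelet has mean
  zero.\<close>

lemma integral_cyl_wavelet:
  assumes r: "r \<in> residues_upto p n" and s: "s \<in> residues_upto p (Suc m)"
  shows "(\<integral>x. indicator (cyl p n r) x * wavelet m s x \<partial>\<mu>) = (if m < n then wavelet_val m s r * inverse (real p ^ n) else 0)"
proof -
  have i: "integrable \<mu> (\<lambda>x. indicator (cyl p n r) x * indicator (cyl p k t) x :: real)" for k t
    using integrable_mult_indicator[OF _ integrable_indicator_cyl, of "cyl p n r"] by simp
  have "indicator (cyl p n r) x * wavelet m s x = indicator (cyl p n r) x * indicator (cyl p (Suc m) s) x
      - indicator (cyl p n r) x * indicator (cyl p m (s mod int p ^ m)) x / real p" for x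
    unfolding wavelet_def by (simp only: right_diff_distrib times_divide_eq_right)
  then have "(\<integral>x. indicator (cyl p n r) x * wavelet m s x \<partial>\<mu>)
      = (\<integral>x. indicator (cyl p n r) x * indicator (cyl p (Suc m) s) x \<partial>\<mu>)
      - (\<integral>x. indicator (cyl p n r) x * indicator (cyl p m (s mod int p ^ m)) x \<partial>\<mu>) / real p"
    by (simp only: Bochner_Integration.integral_diff i integrable_divide_zero Bochner_Integration.integral_divide_zero)
  also have "\<dots> = (if m < n then wavelet_val m s r * inverse (real p ^ n) else 0)"
  proof (cases "m < n")
    case True
    then show ?thesis
      unfolding integral_cyl_cyl[OF r s] integral_cyl_cyl[OF r residue_mod]
      by (auto simp: wavelet_val_def left_diff_distrib divide_inverse simp del: power_Suc)
  next
    case False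
    have inv: "inverse (real p ^ Suc m) = inverse (real p ^ m) / real p" by (simp add: field_simps)
    show ?thesis
    proof (cases "n = m")
      case True
      then have "r mod int p ^ m = r" using r by auto
      then show ?thesis unfolding integral_cyl_cyl[OF r s] integral_cyl_cyl[OF r residue_mod] inv
        using True by auto
    next
      case f: False
      then have "s mod int p ^ m mod int p ^ n = s mod int p ^ n"
        using False by (intro mod_mod_cancel le_imp_power_dvd) simp
      then show ?thesis unfolding integral_cyl_cyl[OF r s] integral_cyl_cyl[OF r residue_mod] inv
        using f False by auto
    qed
  qed
  finally show ?thesis .
qed

lemma integrable_wavelet: "integrable \<mu> (wavelet m s)"
  using bounded_measurable_integrable bounded_measurable_cong[OF sets_haar] bounded_measurable_wavelet by blast

definition hext :: "(padic \<Rightarrow> real) \<Rightarrow> nat \<Rightarrow> int \<Rightarrow> real" where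
  "hext \<psi> n r = (\<integral>x. dens n r x * \<psi> x \<partial>\<mu>)"

lemma hext_Suc:
  assumes "integrable \<mu> \<psi>"
  shows "hext \<psi> (Suc n) r = F * hext \<psi> n (r mod int p ^ n)
     + (1 - F) * real p ^ Suc n * (\<integral>x. indicator (cyl p (Suc n) r) x * \<psi> x \<partial>\<mu>)"
  unfolding hext_def by (rule integral_dens_Suc[OF assms])

text \<open>The extension vanishes up to and including the level \<open>m\<close> of the parent,
  since the mean over each such ball is zero. Beyond it the recursion
  \<open>h (n + 1) = F * h n + (1 - F) * wavelet_val m s r\<close> applies, whose solution has the
  factor \<open>1 - F ^ (n - m)\<close>.\<close>

lemma hext_wavelet:
  assumes s: "s \<in> residues_upto p (Suc m)"
  shows "r \<in> residues_upto p n \<Longrightarrow> hext (wavelet m s) n r = (if n \<le> m then 0 else (1 - F ^ (n - m)) * wavelet_val m s r)"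
proof (induction n arbitrary: r)
  case 0
  have "hext (wavelet m s) 0 r = (\<integral>x. indicator (cyl p 0 0) x * wavelet m s x \<partial>\<mu>)"
    unfolding hext_def by (rule Bochner_Integration.integral_cong) (simp_all add: cyl_0)
  also have "\<dots> = 0" by (subst integral_cyl_wavelet[OF _ s]) simp_all
  finally show ?case by simp
next
  case (Suc n)
  have inv: "real p ^ Suc n * inverse (real p ^ Suc n) = 1" by (rule right_inverse) simp
  have "(1 - F) * real p ^ Suc n * (if m < Suc n then wavelet_val m s r * inverse (real p ^ Suc n) else 0)
      = (if m < Suc n then (1 - F) * wavelet_val m s r * (real p ^ Suc n * inverse (real p ^ Suc n)) else 0)"
    by (simp only: mult_ac if_distrib[where f = "\<lambda>x. (1 - F) * (real p ^ Suc n * x)"] mult_zero_right)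
      (simp add: mult_ac del: power_Suc)
  then have eq: "hext (wavelet m s) (Suc n) r = F * hext (wavelet m s) n (r mod int p ^ n)
      + (if m < Suc n then (1 - F) * wavelet_val m s r else 0)"
    unfolding hext_Suc[OF integrable_wavelet] integral_cyl_wavelet[OF Suc.prems s] inv by simp
  show ?case
  proof (cases "n < m")
    case True
    then show ?thesis unfolding eq Suc.IH[OF residue_mod] by simp
  next
    case False
    then consider "n = m" | "m < n" by linarith
    then show ?thesis
    proof cases
      case 1
      then show ?thesis unfolding eq Suc.IH[OF residue_mod] by simp
    next
      case 2
      have "F * ((1 - F ^ (n - m)) * wavelet_val m s r) + (1 - F) * wavelet_val m s r = (1 - F ^ (Suc n - m)) * wavelet_val m s r"
        using 2 by (simp add: Suc_diff_le algebra_simps)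
      then show ?thesis unfolding eq Suc.IH[OF residue_mod] using 2 wavelet_val_mod[OF 2, of s r] by simp
    qed
  qed
qed

lemma hext_wavelet_diff:
  assumes s: "s \<in> residues_upto p (Suc m)" and r: "r \<in> residues_upto p (Suc j)"
  shows "hext (wavelet m s) (Suc j) r - hext (wavelet m s) j (r mod int p ^ j)
    = (if j < m then 0 else F ^ (j - m) * (1 - F) * wavelet_val m s r)"
proof -
  consider "j < m" | "j = m" | "m < j" by linarith
  then show ?thesis
  proof cases
    case 3
    then show ?thesis
      unfolding hext_wavelet[OF s r] hext_wavelet[OF s residue_mod] wavelet_val_mod[OF 3]
      by (simp add: Suc_diff_le algebra_simps)
  qed (unfold hext_wavelet[OF s r] hext_wavelet[OF s residue_mod], simp_all)
qed

lemma sum_wavelet_val_children: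
  assumes s: "s \<in> residues_upto p (Suc m)" and t: "t \<in> residues_upto p m"
  shows "(\<Sum>r\<in>children m t. wavelet_val m s r) = 0"
proof -
  have v: "wavelet_val m s r = (if r = s then 1 else 0) - (if t = s mod int p ^ m then 1 / real p else 0)"
    if r: "r \<in> children m t" for r
  proof -
    have "r mod int p ^ Suc m = r" using childrenD(1)[OF r] by simp
    then show ?thesis unfolding wavelet_val_def childrenD(2)[OF r] by simp
  qed
  have "(\<Sum>r\<in>children m t. wavelet_val m s r)
      = (\<Sum>r\<in>children m t. (if r = s then 1 else 0)) - (\<Sum>r\<in>children m t. (if t = s mod int p ^ m then 1 / real p else 0))"
    unfolding sum_subtractf[symmetric] by (rule sum.cong[OF refl v])
  also have "(\<Sum>r\<in>children m t. (if r = s then 1 else 0 :: real)) = (if s \<in> children m t then 1 else 0)"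
    by simp
  also have "s \<in> children m t \<longleftrightarrow> t = s mod int p ^ m" using s by (auto simp: children_def)
  also have "(\<Sum>r\<in>children m t. (if t = s mod int p ^ m then 1 / real p else 0)) = (if t = s mod int p ^ m then 1 else 0)"
    using card_children[OF t] p_gt_1 by simp
  finally show ?thesis by simp
qed

lemma integral_wavelet_mult:
  assumes "integrable \<mu> \<psi>" "m \<le> j"
  shows "(\<integral>x. wavelet m s x * \<psi> x \<partial>\<mu>)
    = (\<Sum>r\<in>residues_upto p (Suc j). wavelet_val m s r * (\<integral>x. indicator (cyl p (Suc j) r) x * \<psi> x \<partial>\<mu>))"
proof -
  have i: "integrable \<mu> (\<lambda>x. indicator (cyl p (Suc j) r) x * \<psi> x)" for r
    using integrable_mult_indicator[OF _ assms(1), of "cyl p (Suc j) r"] by simp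
  have "(\<integral>x. wavelet m s x * \<psi> x \<partial>\<mu>) = (\<integral>x. (\<Sum>r\<in>residues_upto p (Suc j). wavelet_val m s r * (indicator (cyl p (Suc j) r) x * \<psi> x)) \<partial>\<mu>)"
  proof (rule Bochner_Integration.integral_cong[OF refl])
    fix x assume "x \<in> space \<mu>"
    then have x: "x \<in> Zp p" by simp
    have "(\<Sum>r\<in>residues_upto p (Suc j). wavelet_val m s r * (indicator (cyl p (Suc j) r) x * \<psi> x))
        = (\<Sum>r\<in>residues_upto p (Suc j). if r = x (Suc j) then wavelet_val m s r * \<psi> x else 0)"
      by (rule sum.cong[OF refl]) (simp add: indicator_cyl x)
    also have "\<dots> = wavelet_val m s (x (Suc j)) * \<psi> x"
      using Zp_bounds[OF x, of "Suc j"] by (subst sum.delta) auto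
    also have "wavelet_val m s (x (Suc j)) = wavelet m s x"
      using wavelet_eq_val[OF assms(2), of x "x (Suc j)" s] x by (simp add: cyl_def)
    finally show "wavelet m s x * \<psi> x = (\<Sum>r\<in>residues_upto p (Suc j). wavelet_val m s r * (indicator (cyl p (Suc j) r) x * \<psi> x))"
      by simp
  qed
  also have "\<dots> = (\<Sum>r\<in>residues_upto p (Suc j). wavelet_val m s r * (\<integral>x. indicator (cyl p (Suc j) r) x * \<psi> x \<partial>\<mu>))"
    by (simp only: Bochner_Integration.integral_sum Bochner_Integration.integral_mult_right_zero i Bochner_Integration.integrable_mult_right)
  finally show ?thesis .
qed

text \<open>The harmonic extension of an arbitrary \<open>\<psi>\<close>, averaged over a level
  against the wavelet values, obeys the same scalar recursion as that of a wavelet. It starts from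
  zero at level \<open>m\<close>, where \<open>hext \<psi> m\<close> is the same for siblings and
  their wavelet values cancel. At later levels siblings share the wavelet value, so the
  \<open>p\<close> equal terms compensate the additional factor \<open>p\<close> in the
  denominator.\<close>

lemma sum_wavelet_hext:
  assumes s: "s \<in> residues_upto p (Suc m)" and \<psi>: "integrable \<mu> \<psi>" and j: "m \<le> j"
  defines "B \<equiv> (\<integral>x. wavelet m s x * \<psi> x \<partial>\<mu>)"
  shows "(\<Sum>r\<in>residues_upto p (Suc j). wavelet_val m s r * hext \<psi> j (r mod int p ^ j)) / real p ^ Suc j = (1 - F ^ (j - m)) * B"
    and "(\<Sum>r\<in>residues_upto p (Suc j). wavelet_val m s r * hext \<psi> (Suc j) r) / real p ^ Suc j = (1 - F ^ (Suc j - m)) * B"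
proof -
  let ?U = "\<lambda>j. (\<Sum>r\<in>residues_upto p (Suc j). wavelet_val m s r * hext \<psi> j (r mod int p ^ j)) / real p ^ Suc j"
  let ?T = "\<lambda>j. (\<Sum>r\<in>residues_upto p (Suc j). wavelet_val m s r * hext \<psi> (Suc j) r) / real p ^ Suc j"
  have T: "?T j = F * ?U j + (1 - F) * B" if "m \<le> j" for j
  proof -
    have "(\<Sum>r\<in>residues_upto p (Suc j). wavelet_val m s r * hext \<psi> (Suc j) r)
      = (\<Sum>r\<in>residues_upto p (Suc j). F * (wavelet_val m s r * hext \<psi> j (r mod int p ^ j))
        + (1 - F) * real p ^ Suc j * (wavelet_val m s r * (\<integral>x. indicator (cyl p (Suc j) r) x * \<psi> x \<partial>\<mu>)))"
      unfolding hext_Suc[OF \<psi>] by (simp only: distrib_left mult_ac)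
    also have "\<dots> = F * (\<Sum>r\<in>residues_upto p (Suc j). wavelet_val m s r * hext \<psi> j (r mod int p ^ j))
        + (1 - F) * real p ^ Suc j * B"
      unfolding B_def integral_wavelet_mult[OF \<psi> that] by (simp only: sum.distrib sum_distrib_left)
    finally show ?thesis using p_gt_1 by (simp add: add_divide_distrib del: power_Suc)
  qed
  have U: "?U j = (1 - F ^ (j - m)) * B" if "m \<le> j" for j
    using that
  proof (induction j rule: dec_induct)
    case base
    have "(\<Sum>r\<in>residues_upto p (Suc m). wavelet_val m s r * hext \<psi> m (r mod int p ^ m))
        = (\<Sum>t\<in>residues_upto p m. \<Sum>r\<in>children m t. wavelet_val m s r * hext \<psi> m (r mod int p ^ m))"
      by (rule sum_by_parent)
    also have "\<dots> = (\<Sum>t\<in>residues_upto p m. (\<Sum>r\<in>children m t. wavelet_val m s r) * hext \<psi> m t)"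
      unfolding sum_distrib_right by (intro sum.cong refl) (simp add: childrenD(2))
    also have "\<dots> = 0"
      by (rule sum.neutral) (use sum_wavelet_val_children[OF s] in auto)
    finally show ?case by simp
  next
    case (step j)
    have "(\<Sum>r\<in>residues_upto p (Suc (Suc j)). wavelet_val m s r * hext \<psi> (Suc j) (r mod int p ^ Suc j))
        = (\<Sum>t\<in>residues_upto p (Suc j). \<Sum>r\<in>children (Suc j) t. wavelet_val m s r * hext \<psi> (Suc j) (r mod int p ^ Suc j))"
      by (rule sum_by_parent)
    also have "\<dots> = (\<Sum>t\<in>residues_upto p (Suc j). real p * (wavelet_val m s t * hext \<psi> (Suc j) t))"
    proof (rule sum.cong[OF refl])
      fix t assume t: "t \<in> residues_upto p (Suc j)"
      have "(\<Sum>r\<in>children (Suc j) t. wavelet_val m s r * hext \<psi> (Suc j) (r mod int p ^ Suc j))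
          = (\<Sum>r\<in>children (Suc j) t. wavelet_val m s t * hext \<psi> (Suc j) t)"
      proof (rule sum.cong[OF refl])
        fix r assume r: "r \<in> children (Suc j) t"
        show "wavelet_val m s r * hext \<psi> (Suc j) (r mod int p ^ Suc j) = wavelet_val m s t * hext \<psi> (Suc j) t"
          using wavelet_val_mod[of m "Suc j" s r] step.hyps childrenD(2)[OF r] by simp
      qed
      then show "(\<Sum>r\<in>children (Suc j) t. wavelet_val m s r * hext \<psi> (Suc j) (r mod int p ^ Suc j))
          = real p * (wavelet_val m s t * hext \<psi> (Suc j) t)"
        using card_children[OF t] by simp
    qed
    finally have "?U (Suc j) = ?T j"
      using p_gt_1 by (simp add: sum_distrib_left[symmetric])
    also have "\<dots> = F * ((1 - F ^ (j - m)) * B) + (1 - F) * B"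
      using T[OF step.hyps(1)] step.IH by (simp only:)
    also have "\<dots> = (1 - F ^ (Suc j - m)) * B"
      using step.hyps by (simp add: Suc_diff_le algebra_simps)
    finally show ?case .
  qed
  show "?U j = (1 - F ^ (j - m)) * B" by (rule U[OF j])
  show "?T j = (1 - F ^ (Suc j - m)) * B"
    unfolding T[OF j] U[OF j] using j by (simp add: Suc_diff_le algebra_simps)
qed

definition summand :: "(padic \<Rightarrow> real) \<Rightarrow> (padic \<Rightarrow> real) \<Rightarrow> nat \<times> int \<Rightarrow> real" where
  "summand \<phi> \<psi> = (\<lambda>(j, r). (hext \<phi> (Suc j) r - hext \<phi> j (r mod int p ^ j))
     * (hext \<psi> (Suc j) r - hext \<psi> j (r mod int p ^ j)) * (1 / (real p ^ Suc j * F ^ j)))"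

text \<open>Along the edges of level \<open>j\<close> the wavelet increment is
  \<open>F ^ (j - m) * (1 - F)\<close> times its value. By \<open>sum_wavelet_hext\<close> the
  increments of \<open>\<psi>\<close> pair with these values to the same factor times the integral.
  The conductance contributes \<open>1 / F ^ j\<close>, which leaves a geometric term.\<close>

lemma sum_summand_wavelet:
  assumes s: "s \<in> residues_upto p (Suc m)" and \<psi>: "integrable \<mu> \<psi>"
  shows "(\<Sum>r\<in>residues_upto p (Suc j). summand (wavelet m s) \<psi> (j, r))
    = (1 - F)\<^sup>2 / F ^ m * (\<integral>x. wavelet m s x * \<psi> x \<partial>\<mu>) * (if j < m then 0 else F ^ (j - m))"
proof (cases "j < m")
  case True
  have "summand (wavelet m s) \<psi> (j, r) = 0" if "r \<in> residues_upto p (Suc j)" for r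
    unfolding summand_def prod.case hext_wavelet_diff[OF s that] using True by simp
  then show ?thesis using True by simp
next
  case False
  let ?B = "\<integral>x. wavelet m s x * \<psi> x \<partial>\<mu>"
  have mj: "m \<le> j" using False by simp
  define i where "i = j - m"
  have j: "j = m + i" using mj by (simp add: i_def)
  have "(\<Sum>r\<in>residues_upto p (Suc j). summand (wavelet m s) \<psi> (j, r))
      = (\<Sum>r\<in>residues_upto p (Suc j). F ^ i * (1 - F) / F ^ j * ((wavelet_val m s r * hext \<psi> (Suc j) r
           - wavelet_val m s r * hext \<psi> j (r mod int p ^ j)) / real p ^ Suc j))"
  proof (rule sum.cong[OF refl])
    fix r assume r: "r \<in> residues_upto p (Suc j)"
    show "summand (wavelet m s) \<psi> (j, r) = F ^ i * (1 - F) / F ^ j * ((wavelet_val m s r * hext \<psi> (Suc j) r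
           - wavelet_val m s r * hext \<psi> j (r mod int p ^ j)) / real p ^ Suc j)"
      unfolding summand_def prod.case hext_wavelet_diff[OF s r] i_def using False
      by (simp add: algebra_simps diff_divide_distrib del: power_Suc)
  qed
  also have "\<dots> = F ^ i * (1 - F) / F ^ j * ((\<Sum>r\<in>residues_upto p (Suc j). wavelet_val m s r * hext \<psi> (Suc j) r) / real p ^ Suc j
      - (\<Sum>r\<in>residues_upto p (Suc j). wavelet_val m s r * hext \<psi> j (r mod int p ^ j)) / real p ^ Suc j)"
    by (simp only: sum_distrib_left[symmetric] sum_divide_distrib[symmetric] sum_subtractf diff_divide_distrib)
  also have "\<dots> = F ^ i * (1 - F) / F ^ j * ((1 - F ^ (Suc j - m)) * ?B - (1 - F ^ (j - m)) * ?B)"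
    unfolding sum_wavelet_hext[OF s \<psi> mj] ..
  also have "\<dots> = (1 - F)\<^sup>2 / F ^ m * ?B * F ^ i"
    using F unfolding j by (simp add: power_add field_simps power2_eq_square)
  finally show ?thesis using False by (simp add: i_def)
qed

lemma has_sum_wavelet_levels:
  "((\<lambda>j. if j < m then 0 else F ^ (j - m)) has_sum 1 / (1 - F)) UNIV"
proof (rule sums_nonneg_imp_has_sum)
  have "(\<lambda>j. (if j + m < m then 0 else F ^ (j + m - m))) sums (1 / (1 - F))"
    using geometric_sums[of F] F by simp
  then show "(\<lambda>j. if j < m then 0 else F ^ (j - m)) sums (1 / (1 - F))"
    by (subst (asm) sums_zero_iff_shift) auto
qed (use F in simp)

lemma summable_summand_wavelet:
  assumes s: "s \<in> residues_upto p (Suc m)"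
  shows "summand (wavelet m s) (wavelet m s) summable_on edges"
proof -
  let ?f = "summand (wavelet m s) (wavelet m s)"
  have nonneg: "?f x \<ge> 0" for x
    using F by (cases x) (simp add: summand_def)
  have "(\<lambda>x. norm (?f x)) summable_on edges"
    unfolding edges_def Infinite_Sum.abs_summable_on_Sigma_iff
  proof (intro conjI ballI)
    have "infsum (\<lambda>r. norm (?f (j, r))) (residues_upto p (Suc j))
        = (1 - F)\<^sup>2 / F ^ m * (\<integral>x. wavelet m s x * wavelet m s x \<partial>\<mu>) * (if j < m then 0 else F ^ (j - m))" for j
      using sum_summand_wavelet[OF s integrable_wavelet] nonneg by simp
    moreover have "(\<lambda>j. norm ((1 - F)\<^sup>2 / F ^ m * (\<integral>x. wavelet m s x * wavelet m s x \<partial>\<mu>) * (if j < m then 0 else F ^ (j - m)))) summable_on UNIV"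
    proof -
      have "0 \<le> (\<integral>x. wavelet m s x * wavelet m s x \<partial>\<mu>)" by (rule integral_nonneg_AE) simp
      then have "norm ((1 - F)\<^sup>2 / F ^ m * (\<integral>x. wavelet m s x * wavelet m s x \<partial>\<mu>) * (if j < m then 0 else F ^ (j - m)))
         = (1 - F)\<^sup>2 / F ^ m * (\<integral>x. wavelet m s x * wavelet m s x \<partial>\<mu>) * (if j < m then 0 else F ^ (j - m))" for j
        using F by simp
      then show ?thesis
        by (simp only:) (intro summable_on_cmult_right has_sum_imp_summable[OF has_sum_wavelet_levels])
    qed
    ultimately show "(\<lambda>j. norm (infsum (\<lambda>r. norm (?f (j, r))) (residues_upto p (Suc j)))) summable_on UNIV"
      by (simp only:)
  qed simp
  then show ?thesis by (rule Infinite_Sum.abs_summable_summable)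
qed

text \<open>The inequality between \<open>a * b\<close> and \<open>a^2 + b^2\<close> dominates the
  mixed summands by the two finite energies, so the sum may be rearranged by levels. The geometric
  series then turns \<open>(1 - F)^2\<close> into \<open>1 - F\<close>.\<close>

lemma infsum_summand_wavelet:
  assumes s: "s \<in> residues_upto p (Suc m)" and \<psi>: "integrable \<mu> \<psi>"
    and sm: "summand \<psi> \<psi> summable_on edges"
  shows "infsum (summand (wavelet m s) \<psi>) edges = (1 - F) / F ^ m * (\<integral>x. wavelet m s x * \<psi> x \<partial>\<mu>)"
proof -
  let ?f = "summand (wavelet m s) \<psi>"
  have le: "norm (?f x) \<le> summand (wavelet m s) (wavelet m s) x + summand \<psi> \<psi> x" for x
  proof -
    obtain j r where x: "x = (j, r)" by (cases x)
    have *: "\<bar>a * b * k\<bar> \<le> a * a * k + b * b * k" if "k \<ge> 0" for a b k :: real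
    proof -
      have "0 \<le> (\<bar>a\<bar> - \<bar>b\<bar>)\<^sup>2" by simp
      also have "\<dots> = a * a + b * b - 2 * \<bar>a * b\<bar>"
        by (simp add: power2_diff abs_mult flip: power2_eq_square)
      finally have "2 * \<bar>a * b\<bar> \<le> a * a + b * b" by simp
      then have "\<bar>a * b\<bar> \<le> a * a + b * b" using abs_ge_zero[of "a * b"] by linarith
      then have "\<bar>a * b\<bar> * k \<le> (a * a + b * b) * k" using that by (rule mult_right_mono)
      then show ?thesis using that by (simp add: abs_mult distrib_right)
    qed
    have "0 \<le> 1 / (real p ^ Suc j * F ^ j)" using F by simp
    then show ?thesis unfolding x summand_def prod.case real_norm_def by (rule *)
  qed
  have "(\<lambda>x. norm (?f x)) summable_on edges"
    by (rule summable_on_comparison_test[OF summable_on_add[OF summable_summand_wavelet[OF s] sm]]) (use le in auto)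
  then have "?f summable_on edges" by (rule Infinite_Sum.abs_summable_summable)
  then have "infsum ?f edges = infsum (\<lambda>j. infsum (\<lambda>r. ?f (j, r)) (residues_upto p (Suc j))) UNIV"
    unfolding edges_def by (rule infsum_Sigma_banach[symmetric])
  also have "\<dots> = infsum (\<lambda>j. (1 - F)\<^sup>2 / F ^ m * (\<integral>x. wavelet m s x * \<psi> x \<partial>\<mu>) * (if j < m then 0 else F ^ (j - m))) UNIV"
    using sum_summand_wavelet[OF s \<psi>] by simp
  also have "\<dots> = (1 - F)\<^sup>2 / F ^ m * (\<integral>x. wavelet m s x * \<psi> x \<partial>\<mu>) * (1 / (1 - F))"
    by (intro infsumI has_sum_cmult_right has_sum_wavelet_levels)
  also have "\<dots> = (1 - F) / F ^ m * (\<integral>x. wavelet m s x * \<psi> x \<partial>\<mu>)"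
    using F by (simp add: power2_eq_square)
  finally show ?thesis .
qed

end

section \<open>From the tree energy to the operator of the form\<close>

context boundary_walk
begin

lemma tree_summand_cyl:
  assumes \<phi>: "\<phi> \<in> borel_measurable \<mu>" and \<psi>: "\<psi> \<in> borel_measurable \<mu>" and x: "x \<in> edges"
  shows "tree_summand p q (harmonic_ext (exit_law p P Z) \<phi>) (harmonic_ext (exit_law p P Z) \<psi>)
      (case x of (j, r) \<Rightarrow> cyl p (Suc j) r) = summand \<phi> \<psi> x"
proof -
  obtain j r where j: "x = (j, r)" and r: "r \<in> residues_upto p (Suc j)" using x unfolding edges_def by blast
  show ?thesis
    unfolding j prod.case tree_summand_def conductance_cyl[OF r] pred_cyl[OF r] summand_def hext_def
      harmonic_ext_cyl[OF r \<phi>] harmonic_ext_cyl[OF r \<psi>] harmonic_ext_cyl[OF residue_mod \<phi>] harmonic_ext_cyl[OF residue_mod \<psi>] ..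
qed

lemma HD_domain_iff:
  "\<phi> \<in> HD_domain p q (exit_law p P Z) \<longleftrightarrow> \<phi> \<in> L2 \<mu> \<and> summand \<phi> \<phi> summable_on edges"
proof (cases "\<phi> \<in> L2 \<mu>")
  case True
  then have m: "\<phi> \<in> borel_measurable \<mu>" by (simp add: L2_def)
  have "tree_summand p q (harmonic_ext (exit_law p P Z) \<phi>) (harmonic_ext (exit_law p P Z) \<phi>) summable_on (balls p - {Zp p})
      \<longleftrightarrow> summand \<phi> \<phi> summable_on edges"
    unfolding summable_on_reindex_bij_betw[OF bij_betw_edges, symmetric]
    by (rule summable_on_cong) (rule tree_summand_cyl[OF m m])
  then show ?thesis using True by (simp add: HD_domain_def exit_law_root)
qed (simp add: HD_domain_def exit_law_root)

lemma HD_form_eq: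
  assumes "\<phi> \<in> borel_measurable \<mu>" "\<psi> \<in> borel_measurable \<mu>"
  shows "HD_form p q (exit_law p P Z) \<phi> \<psi> = infsum (summand \<phi> \<psi>) edges"
  unfolding HD_form_def tree_form_def infsum_reindex_bij_betw[OF bij_betw_edges, symmetric]
  by (rule infsum_cong) (rule tree_summand_cyl[OF assms])

lemma L2_integrable:
  fixes \<psi> :: "padic \<Rightarrow> real"
  assumes "\<psi> \<in> L2 \<mu>"
  shows "integrable \<mu> \<psi>"
proof (rule square_integrable_imp_integrable)
  show "\<psi> \<in> borel_measurable \<mu>" "integrable \<mu> (\<lambda>x. (\<psi> x)\<^sup>2)"
    using assms unfolding L2_def by simp_all
qed

lemma bounded_measurable_haar_L2: "bounded_measurable (Zp_borel p) f \<Longrightarrow> f \<in> L2 \<mu>"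
  by (rule bounded_measurable_L2) (simp add: bounded_measurable_cong[OF sets_haar])

abbreviation HD_operator where
  "HD_operator \<equiv> form_operator (exit_law p P Z (Zp p)) (HD_domain p q (exit_law p P Z)) (HD_form p q (exit_law p P Z))"

text \<open>Membership in the form operator demands testing against every \<open>\<psi>\<close> of
  finite energy; this is why \<open>infsum_summand_wavelet\<close> leaves its second function
  general.\<close>

lemma wavelet_in_HD_operator:
  assumes s: "s \<in> residues_upto p (Suc m)"
  shows "(wavelet m s, \<lambda>x. (1 - F) / F ^ m * wavelet m s x) \<in> HD_operator"
proof -
  have wL: "wavelet m s \<in> L2 \<mu>" by (rule bounded_measurable_haar_L2[OF bounded_measurable_wavelet])
  then have wm: "wavelet m s \<in> borel_measurable \<mu>" by (simp add: L2_def)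
  have "wavelet m s \<in> HD_domain p q (exit_law p P Z)"
    using wL summable_summand_wavelet[OF s] by (simp add: HD_domain_iff)
  moreover have "HD_form p q (exit_law p P Z) (wavelet m s) \<psi> = (\<integral>x. (1 - F) / F ^ m * wavelet m s x * \<psi> x \<partial>\<mu>)"
    if "\<psi> \<in> HD_domain p q (exit_law p P Z)" for \<psi>
  proof -
    have \<psi>: "\<psi> \<in> L2 \<mu>" "summand \<psi> \<psi> summable_on edges" using that by (simp_all add: HD_domain_iff)
    then have "\<psi> \<in> borel_measurable \<mu>" by (simp add: L2_def)
    then have "HD_form p q (exit_law p P Z) (wavelet m s) \<psi> = infsum (summand (wavelet m s) \<psi>) edges"
      by (rule HD_form_eq[OF wm])
    also have "\<dots> = (1 - F) / F ^ m * (\<integral>x. wavelet m s x * \<psi> x \<partial>\<mu>)"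
      by (rule infsum_summand_wavelet[OF s L2_integrable[OF \<psi>(1)] \<psi>(2)])
    also have "\<dots> = (\<integral>x. (1 - F) / F ^ m * (wavelet m s x * \<psi> x) \<partial>\<mu>)"
      by (rule Bochner_Integration.integral_mult_right_zero[symmetric])
    finally show ?thesis by (simp only: mult.assoc)
  qed
  ultimately show ?thesis
    unfolding form_operator_def exit_law_root using L2_cmult[OF wL, of "(1 - F) / F ^ m"] by auto
qed

end

section \<open>Fourier coefficients of wavelets\<close>

context padic
begin

lemma measurable_coordinate [measurable]: "(\<lambda>x. x n) \<in> Zp_borel p \<rightarrow>\<^sub>M count_space UNIV"
proof (rule measurable_count_space_eq_countable[THEN iffD2])
  show "countable (UNIV :: int set)" by simp
  have "(\<lambda>x. x n) -` {r} \<inter> space (Zp_borel p) = cyl p n r" for r by (auto simp: cyl_def)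
  then show "(\<lambda>x. x n) \<in> space (Zp_borel p) \<rightarrow> UNIV \<and> (\<forall>r\<in>UNIV. (\<lambda>x. x n) -` {r} \<inter> space (Zp_borel p) \<in> sets (Zp_borel p))"
    by simp
qed

end

locale prime_haar = padic_haar +
  assumes prime_p: "prime p"
begin

text \<open>In lowest terms the denominator divides a power of \<open>p\<close>, hence is one by
  primality; it is not \<open>1\<close> for nonzero \<open>\<xi>\<close>, because representatives
  lie in the half-open unit interval.\<close>

lemma dual_group_cases:
  assumes "\<xi> \<in> dual_group p"
  obtains "\<xi> = 0" | n a where "n \<ge> 1" "quotient_of \<xi> = (a, int p ^ n)" "\<not> int p dvd a"
proof (cases "\<xi> = 0")
  case False
  from assms obtain k N where k: "\<xi> = of_nat k / of_nat p ^ N" "k < p ^ N" by (auto simp: dual_group_def)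
  obtain a b where ab: "quotient_of \<xi> = (a, b)" by (cases "quotient_of \<xi>")
  have b: "b > 0" and co: "coprime a b" and \<xi>: "\<xi> = of_int a / of_int b"
    using quotient_of_denom_pos[OF ab] quotient_of_coprime[OF ab] quotient_of_div[OF ab] by auto
  have pN: "(of_nat p ^ N :: rat) \<noteq> 0" by simp
  have "(of_int a :: rat) * of_nat p ^ N = of_nat k * of_int b"
    using k(1) \<xi> b pN by (simp add: field_simps)
  then have "(of_int (a * int p ^ N) :: rat) = of_int (int k * b)" by simp
  then have eq: "a * int p ^ N = int k * b" by (simp only: of_int_eq_iff)
  then have "b dvd a * int p ^ N" by simp
  then have "b dvd int p ^ N" using co by (simp add: coprime_commute coprime_dvd_mult_right_iff)
  then obtain n where n: "b = int p ^ n"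
    using divides_primepow[of "int p" b N] prime_p b by auto
  have "n \<noteq> 0"
  proof
    assume "n = 0"
    then have "a * int p ^ N = int k" using eq n by simp
    moreover have "int k < int p ^ N" using k(2) by (metis of_nat_less_iff of_nat_power)
    ultimately have "a * int p ^ N < 1 * int p ^ N" "0 \<le> a * int p ^ N" by simp_all
    moreover have "0 < int p ^ N" by simp
    ultimately have "a < 1" "0 \<le> a" by (auto simp: zero_le_mult_iff)
    then have "a = 0" by simp
    then show False using False \<xi> by simp
  qed
  moreover have "\<not> int p dvd a"
  proof
    assume "int p dvd a"
    moreover have "int p dvd b" using n \<open>n \<noteq> 0\<close> by simp
    ultimately have "int p dvd 1" using co by (rule coprime_common_divisor[rotated])
    then show False using p_gt_1 by simp
  qed
  ultimately show ?thesis using that(2)[of n a] ab n by simp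
qed

lemma multiplicity_prime_pow: "multiplicity (int p) (int p ^ n) = n"
  using p_gt_1 by (intro multiplicity_same_power) auto

lemma rat_padic_norm_dual:
  assumes "quotient_of \<xi> = (a, int p ^ n)" "\<not> int p dvd a"
  shows "rat_padic_norm p \<xi> = real p ^ n"
proof -
  have "\<xi> \<noteq> 0" using assms by auto
  then show ?thesis
    using assms p_gt_1 multiplicity_prime_pow[of n]
    by (simp add: rat_padic_norm_def not_dvd_imp_multiplicity_0 powr_realpow)
qed

lemma character_eq:
  assumes "quotient_of \<xi> = (a, int p ^ n)"
  shows "character p \<xi> x = cis (2 * pi * real_of_rat \<xi> * real_of_int (x n))"
  using assms multiplicity_prime_pow[of n] by (simp add: character_def)

lemma cis_mod:
  assumes "quotient_of \<xi> = (a, int p ^ n)"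
  shows "cis (2 * pi * real_of_rat \<xi> * real_of_int (i mod int p ^ n)) = cis (2 * pi * real_of_rat \<xi> * real_of_int i)"
proof -
  have "\<xi> = of_int a / of_int (int p ^ n)" using quotient_of_div[OF assms] .
  then have "real_of_rat \<xi> = real_of_int a / real p ^ n" by (simp add: of_rat_divide of_rat_power)
  then have \<xi>: "real_of_rat \<xi> * real p ^ n = real_of_int a" by simp
  have i: "real_of_int i = real_of_int (i mod int p ^ n) + real p ^ n * real_of_int (i div int p ^ n)"
  proof -
    have "real_of_int i = real_of_int (i mod int p ^ n + int p ^ n * (i div int p ^ n))" by simp
    then show ?thesis by (simp only: of_int_add of_int_mult of_int_power of_int_of_nat_eq)
  qed
  have "2 * pi * real_of_rat \<xi> * real_of_int i
      = 2 * pi * real_of_rat \<xi> * real_of_int (i mod int p ^ n) + 2 * pi * (real_of_rat \<xi> * real p ^ n) * real_of_int (i div int p ^ n)"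
    by (subst i) (simp only: distrib_left mult.assoc)
  also have "\<dots> = 2 * pi * real_of_rat \<xi> * real_of_int (i mod int p ^ n) + 2 * pi * real_of_int (a * (i div int p ^ n))"
    unfolding \<xi> by (simp add: mult.assoc)
  finally have "cis (2 * pi * real_of_rat \<xi> * real_of_int i)
      = cis (2 * pi * real_of_rat \<xi> * real_of_int (i mod int p ^ n)) * cis (2 * pi * real_of_int (a * (i div int p ^ n)))"
    by (simp only: cis_mult)
  then show ?thesis by (simp only: cis_multiple_2pi[OF Ints_of_int] mult_1_right)
qed

text \<open>Otherwise \<open>\<xi> * p^k\<close> would be an integer and \<open>a\<close> a multiple
  of \<open>p^(n - k)\<close>.\<close>

lemma cis_ne_1:
  assumes q: "quotient_of \<xi> = (a, int p ^ n)" and a: "\<not> int p dvd a" and k: "k < n"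
  shows "cis (2 * pi * real_of_rat \<xi> * real_of_int (int p ^ k)) \<noteq> 1"
proof
  assume "cis (2 * pi * real_of_rat \<xi> * real_of_int (int p ^ k)) = 1"
  then have "cos (2 * pi * real_of_rat \<xi> * real_of_int (int p ^ k)) = 1"
    by (metis cis.simps(1) one_complex.simps(1))
  then obtain z :: int where "2 * pi * real_of_rat \<xi> * real_of_int (int p ^ k) = of_int z * 2 * pi"
    by (auto simp: cos_one_2pi_int)
  then have z: "real_of_rat \<xi> * real p ^ k = of_int z" by simp
  have "\<xi> = of_int a / of_int (int p ^ n)" using quotient_of_div[OF q] .
  then have "real_of_rat \<xi> = real_of_int a / real p ^ n" by (simp add: of_rat_divide of_rat_power)
  then have \<xi>: "real_of_rat \<xi> * real p ^ n = real_of_int a" by simp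
  have "real_of_int a * real p ^ k = of_int z * real p ^ n"
    unfolding \<xi>[symmetric] z[symmetric] by (simp only: mult_ac)
  also have "real p ^ n = real p ^ (n - k) * real p ^ k" using k by (simp flip: power_add)
  finally have "real_of_int a = of_int z * real p ^ (n - k)" using p_gt_1 by simp
  then have "real_of_int a = real_of_int (z * int p ^ (n - k))" by simp
  then have "a = z * int p ^ (n - k)" by (simp only: of_int_eq_iff)
  then have "int p dvd a" using k by (simp add: dvd_power)
  then show False using a by simp
qed

lemma measurable_character [measurable]: "character p \<xi> \<in> borel_measurable (Zp_borel p)"
proof -
  have "(\<lambda>x. cis (2 * pi * real_of_rat \<xi> * real_of_int (x (multiplicity (int p) (snd (quotient_of \<xi>)))))) \<in> borel_measurable (Zp_borel p)"
    using measurable_compose[OF measurable_coordinate, of "\<lambda>i. cis (2 * pi * real_of_rat \<xi> * real_of_int i)" borel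
        "multiplicity (int p) (snd (quotient_of \<xi>))"] by simp
  then show ?thesis by (simp add: character_def[abs_def])
qed

lemma norm_character [simp]: "norm (character p \<xi> x) = 1"
  by (simp add: character_def)

lemma integrable_cyl_character:
  "integrable \<mu> (\<lambda>x. complex_of_real (indicator (cyl p k t) x) * cnj (character p \<xi> x))"
proof (rule integrable_const_bound[where B = 1])
  show "AE x in \<mu>. norm (complex_of_real (indicator (cyl p k t) x) * cnj (character p \<xi> x)) \<le> 1"
    by (rule AE_I2) (simp add: norm_mult indicator_def)
  have [measurable]: "cnj \<in> borel_measurable borel"
    by (intro borel_measurable_continuous_onI continuous_intros)
  have "(\<lambda>x. complex_of_real (indicator (cyl p k t) x) * cnj (character p \<xi> x)) \<in> borel_measurable (Zp_borel p)"
    by measurable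
  then show "(\<lambda>x. complex_of_real (indicator (cyl p k t) x) * cnj (character p \<xi> x)) \<in> borel_measurable \<mu>"
    by simp
qed

lemma fourier_cyl_fine:
  assumes q: "quotient_of \<xi> = (a, int p ^ n)" and t: "t \<in> residues_upto p k" and n: "n \<le> k"
  shows "(\<integral>x. complex_of_real (indicator (cyl p k t) x) * cnj (character p \<xi> x) \<partial>\<mu>)
    = of_real (inverse (real p ^ k)) * cnj (cis (2 * pi * real_of_rat \<xi> * real_of_int t))"
proof -
  let ?w = "cnj (cis (2 * pi * real_of_rat \<xi> * real_of_int t))"
  have "complex_of_real (indicator (cyl p k t) x) * cnj (character p \<xi> x) = complex_of_real (indicator (cyl p k t) x) * ?w" for x
  proof (cases "x \<in> cyl p k t")
    case True
    then have x: "x \<in> Zp p" "x k = t" by (auto simp: cyl_def)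
    have "x n = t mod int p ^ n" using Zp_mod[OF x(1) n] x(2) by simp
    then show ?thesis by (simp only: character_eq[OF q] cis_mod[OF q])
  qed simp
  then have "(\<integral>x. complex_of_real (indicator (cyl p k t) x) * cnj (character p \<xi> x) \<partial>\<mu>)
      = (\<integral>x. complex_of_real (indicator (cyl p k t) x) \<partial>\<mu>) * ?w"
    by (simp only: integral_mult_left_zero)
  also have "(\<integral>x. complex_of_real (indicator (cyl p k t) x) \<partial>\<mu>) = of_real (\<integral>x. indicator (cyl p k t) x \<partial>\<mu>)"
    by (rule integral_complex_of_real)
  finally show ?thesis by (simp only: measure_cyl_integral[OF t])
qed

text \<open>Translation by \<open>p^k\<close> preserves the cylinder and the Haar measure but
  multiplies the character by a constant different from one, so the integral must vanish.\<close>

lemma fourier_cyl_coarse: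
  assumes q: "quotient_of \<xi> = (a, int p ^ n)" and a: "\<not> int p dvd a" and t: "t \<in> residues_upto p k" and k: "k < n"
  shows "(\<integral>x. complex_of_real (indicator (cyl p k t) x) * cnj (character p \<xi> x) \<partial>\<mu>) = 0"
proof -
  define h where "h = (\<lambda>j. int p ^ k mod int p ^ j)"
  have h: "h \<in> Zp p" unfolding h_def by (rule residue_in_Zp)
  let ?f = "\<lambda>x. complex_of_real (indicator (cyl p k t) x) * cnj (character p \<xi> x)"
  let ?w = "cnj (cis (2 * pi * real_of_rat \<xi> * real_of_int (int p ^ k)))"
  have hn: "h n = int p ^ k" unfolding h_def using k p_gt_1 by (intro mod_pos_pos_trivial) auto
  have shift: "?f (padic_add p h x) = ?w * ?f x" if x: "x \<in> Zp p" for x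
  proof -
    have "padic_add p h x k = x k" using Zp_residue[OF x, of k] by (simp add: padic_add_def h_def)
    then have ind: "indicator (cyl p k t) (padic_add p h x) = (indicator (cyl p k t) x :: real)"
      unfolding indicator_cyl using padic_add_in_Zp[OF h x] x by simp
    have "character p \<xi> (padic_add p h x) = cis (2 * pi * real_of_rat \<xi> * real_of_int (int p ^ k + x n))"
      unfolding character_eq[OF q] padic_add_def hn by (rule cis_mod[OF q])
    also have "\<dots> = cis (2 * pi * real_of_rat \<xi> * real_of_int (int p ^ k)) * character p \<xi> x"
      unfolding character_eq[OF q] cis_mult by (simp add: algebra_simps)
    finally show ?thesis unfolding ind by (simp add: mult_ac)
  qed
  have m: "?f \<in> borel_measurable (Zp_borel p)"
    using borel_measurable_integrable[OF integrable_cyl_character] measurable_cong_sets[OF sets_haar refl] by blast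
  have "(\<integral>x. ?f x \<partial>\<mu>) = (\<integral>x. ?f x \<partial>distr \<mu> (Zp_borel p) (padic_add p h))"
    using haar h by (simp add: haar_prob_def)
  also have "\<dots> = (\<integral>x. ?f (padic_add p h x) \<partial>\<mu>)"
    using m measurable_padic_add[OF h] by (intro integral_distr) simp_all
  also have "\<dots> = (\<integral>x. ?w * ?f x \<partial>\<mu>)"
    by (rule Bochner_Integration.integral_cong[OF refl]) (simp only: shift space_haar)
  also have "\<dots> = ?w * (\<integral>x. ?f x \<partial>\<mu>)" by (rule integral_mult_right_zero)
  finally have "(1 - ?w) * (\<integral>x. ?f x \<partial>\<mu>) = 0" by (simp add: left_diff_distrib)
  moreover have "?w \<noteq> 1" using cis_ne_1[OF q a k] by (metis complex_cnj_cancel_iff complex_cnj_one)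
  ultimately show ?thesis by simp
qed

text \<open>Let \<open>\<xi>\<close> have denominator \<open>p^n\<close>. For
  \<open>n \<le> m\<close> the character is constant on the parent, and the mean of the wavelet is
  zero; for \<open>n > Suc m\<close> both cylinder integrals vanish by
  \<open>fourier_cyl_coarse\<close>. The hypothesis \<open>ne\<close> excludes just
  \<open>n = Suc m\<close>.\<close>

lemma fourier_wavelet:
  assumes s: "s \<in> residues_upto p (Suc m)" and \<xi>: "\<xi> \<in> dual_group p"
    and ne: "\<xi> = 0 \<or> rat_padic_norm p \<xi> \<noteq> real p ^ Suc m"
  shows "fourier p \<mu> (\<lambda>x. complex_of_real (wavelet m s x)) \<xi> = 0"
proof -
  let ?I = "\<lambda>k t. \<integral>x. complex_of_real (indicator (cyl p k t) x) * cnj (character p \<xi> x) \<partial>\<mu>"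
  let ?t = "s mod int p ^ m"
  have "complex_of_real (wavelet m s x) * cnj (character p \<xi> x)
      = complex_of_real (indicator (cyl p (Suc m) s) x) * cnj (character p \<xi> x)
        - complex_of_real (indicator (cyl p m ?t) x) * cnj (character p \<xi> x) / of_nat p" for x
    unfolding wavelet_def by (simp add: left_diff_distrib)
  then have eq: "fourier p \<mu> (\<lambda>x. complex_of_real (wavelet m s x)) \<xi> = ?I (Suc m) s - ?I m ?t / of_nat p"
    unfolding fourier_def
    by (simp only: Bochner_Integration.integral_diff integrable_cyl_character integrable_divide_zero integral_divide_zero)
  have fine: "?I (Suc m) s - ?I m ?t / of_nat p = 0" if q: "quotient_of \<xi> = (a, int p ^ n)" and n: "n \<le> m" for a n
  proof -
    have "?t mod int p ^ n = s mod int p ^ n"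
      using n by (intro mod_mod_cancel le_imp_power_dvd)
    then have "cis (2 * pi * real_of_rat \<xi> * real_of_int ?t) = cis (2 * pi * real_of_rat \<xi> * real_of_int s)"
      using cis_mod[OF q, of ?t] cis_mod[OF q, of s] by simp
    then have "?I m ?t = of_real (inverse (real p ^ m)) * cnj (cis (2 * pi * real_of_rat \<xi> * real_of_int s))"
      using fourier_cyl_fine[OF q residue_mod n, of s] by (simp only:)
    moreover have "?I (Suc m) s = of_real (inverse (real p ^ Suc m)) * cnj (cis (2 * pi * real_of_rat \<xi> * real_of_int s))"
      using fourier_cyl_fine[OF q s] n by simp
    ultimately show ?thesis by (simp only:) (simp add: divide_inverse)
  qed
  from \<xi> show ?thesis
  proof (cases rule: dual_group_cases)
    case 1
    \<comment> \<open>The trivial character is the case \<open>n = 0\<close>, so \<open>fine\<close>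
      covers it as well.\<close>
    then have "quotient_of \<xi> = (0, int p ^ 0)" by simp
    then show ?thesis unfolding eq by (rule fine) simp
  next
    case (2 n a)
    then have "n \<noteq> Suc m" using ne rat_padic_norm_dual[OF 2(2,3)] by auto
    then consider "n \<le> m" | "Suc m < n" by linarith
    then show ?thesis
    proof cases
      case 1
      then show ?thesis unfolding eq by (rule fine[OF 2(2)])
    next
      case 2
      then show ?thesis unfolding eq using fourier_cyl_coarse[OF \<open>quotient_of \<xi> = (a, int p ^ n)\<close> \<open>\<not> int p dvd a\<close> s]
          fourier_cyl_coarse[OF \<open>quotient_of \<xi> = (a, int p ^ n)\<close> \<open>\<not> int p dvd a\<close> residue_mod, of m s] by simp
    qed
  qed
qed

lemma bounded_complex_L2:
  assumes "bounded_measurable (Zp_borel p) f"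
  shows "(\<lambda>x. complex_of_real (f x)) \<in> L2 \<mu>"
proof -
  have "f \<in> L2 \<mu>" by (rule bounded_measurable_L2) (simp add: bounded_measurable_cong[OF sets_haar] assms)
  then show ?thesis by (auto simp: L2_def)
qed

lemma locally_constant_wavelet: "locally_constant p (\<lambda>x. complex_of_real (wavelet m s x))"
  unfolding locally_constant_def
proof
  fix x assume x: "x \<in> Zp p"
  have "wavelet m s y = wavelet m s x" if "y \<in> Zp.mball x (inverse (real p ^ Suc m))" for y
  proof -
    have "y \<in> Zp.mcball x (inverse (real p ^ Suc m))" using that Zp.mball_subset_mcball by blast
    then have y: "y \<in> cyl p (Suc m) (x (Suc m))" by (simp only: mcball_eq_cyl[OF x])
    have "x \<in> cyl p (Suc m) (x (Suc m))" using x by (simp add: cyl_def)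
    then show ?thesis using wavelet_eq_val[OF order_refl y] wavelet_eq_val[OF order_refl] by metis
  qed
  then have "\<forall>y\<in>Zp.mball x (inverse (real p ^ Suc m)). complex_of_real (wavelet m s y) = complex_of_real (wavelet m s x)"
    by metis
  moreover have "inverse (real p ^ Suc m) > 0" by simp
  ultimately show "\<exists>r>0. \<forall>y\<in>Zp.mball x r. complex_of_real (wavelet m s y) = complex_of_real (wavelet m s x)"
    by blast
qed

text \<open>The Fourier transform of the wavelet lives on frequencies of norm
  \<open>p^(m + 1)\<close>, where the multiplier is constant; elsewhere both sides are zero by
  \<open>fourier_wavelet\<close>.\<close>

lemma wavelet_in_D_alpha:
  assumes s: "s \<in> residues_upto p (Suc m)"
  shows "(\<lambda>x. complex_of_real (wavelet m s x), \<lambda>x. complex_of_real (real p powr (\<alpha> * real (Suc m)) * wavelet m s x))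
    \<in> D_alpha p \<mu> \<alpha>"
proof -
  let ?l = "real p powr (\<alpha> * real (Suc m))"
  have "bounded_measurable (Zp_borel p) (\<lambda>x. ?l * wavelet m s x + 0 * wavelet m s x)"
    by (intro bounded_measurable_add bounded_measurable_wavelet)
  then have "(\<lambda>x. complex_of_real (?l * wavelet m s x)) \<in> L2 \<mu>"
    by (intro bounded_complex_L2) simp
  moreover have "fourier p \<mu> (\<lambda>x. complex_of_real (?l * wavelet m s x)) \<xi>
      = of_real (rat_padic_norm p \<xi> powr \<alpha>) * fourier p \<mu> (\<lambda>x. complex_of_real (wavelet m s x)) \<xi>"
    if \<xi>: "\<xi> \<in> dual_group p" for \<xi>
  proof -
    have lin: "fourier p \<mu> (\<lambda>x. complex_of_real (?l * wavelet m s x)) \<xi> = of_real ?l * fourier p \<mu> (\<lambda>x. complex_of_real (wavelet m s x)) \<xi>"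
      unfolding fourier_def of_real_mult mult.assoc by (rule integral_mult_right_zero)
    show ?thesis
    proof (cases "\<xi> \<noteq> 0 \<and> rat_padic_norm p \<xi> = real p ^ Suc m")
      case True
      have "(real p ^ Suc m) powr \<alpha> = ?l"
        using p_gt_1 by (simp add: powr_realpow[symmetric] powr_powr mult.commute del: power_Suc of_nat_Suc)
      then show ?thesis unfolding lin using True by simp
    next
      case False
      then show ?thesis unfolding lin using fourier_wavelet[OF s \<xi>] by simp
    qed
  qed
  ultimately show ?thesis unfolding D_alpha_def using locally_constant_wavelet by simp
qed

end

section \<open>Heat kernels\<close>

context padic
begin

text \<open>The mass which \<open>exp(- t A)\<close> transports from \<open>x\<close> to \<open>cyl p n s\<close> when \<open>A\<close> has the eigenvalue
  \<open>k m\<close> on the wavelets of level \<open>m\<close>.\<close>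

fun heat :: "(nat \<Rightarrow> real) \<Rightarrow> real \<Rightarrow> nat \<Rightarrow> int \<Rightarrow> padic \<Rightarrow> real" where
  "heat k t 0 s x = 1"
| "heat k t (Suc m) s x = exp (- k m * t) * wavelet m s x + heat k t m (s mod int p ^ m) x / real p"

lemma abs_wavelet_le_1: "\<bar>wavelet m s x\<bar> \<le> 1"
proof -
  have "wavelet m s x \<le> 1 - 0" "0 - 1 \<le> wavelet m s x"
    unfolding wavelet_def using p_gt_1 by (intro diff_mono; simp add: indicator_def)+
  then show ?thesis by simp
qed

end

text \<open>The part of the semigroup shared by both processes after the time change. There are
  \<open>p^(m + 1) - p^m\<close> independent wavelets with parents of level \<open>m\<close>, so
  \<open>heat_trace\<close> amounts to a finite trace.\<close>

locale wavelet_semigroup = padic_haar p \<mu> + transition "Zp_borel p" K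
  for p \<mu> K +
  fixes k :: "nat \<Rightarrow> real"
  assumes heat_trace: "\<And>t. t > 0 \<Longrightarrow> summable (\<lambda>m. real p ^ Suc m * exp (- k m * t))"
    and eigen: "\<And>t m s. t > 0 \<Longrightarrow> s \<in> residues_upto p (Suc m) \<Longrightarrow>
      AE x in \<mu>. kernel_apply K t (wavelet m s) x = exp (- k m * t) * wavelet m s x"
begin

definition good :: "real \<Rightarrow> padic \<Rightarrow> bool" where
  "good t x \<longleftrightarrow> x \<in> Zp p \<and> (\<forall>m. \<forall>s\<in>residues_upto p (Suc m).
     kernel_apply K t (wavelet m s) x = exp (- k m * t) * wavelet m s x)"

lemma AE_good: "t > 0 \<Longrightarrow> AE x in \<mu>. good t x"
proof -
  assume t: "t > 0"
  have "AE x in \<mu>. \<forall>m. \<forall>s\<in>residues_upto p (Suc m). kernel_apply K t (wavelet m s) x = exp (- k m * t) * wavelet m s x"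
    unfolding AE_all_countable using eigen[OF t] by (simp add: AE_ball_countable)
  then show ?thesis using AE_space by eventually_elim (simp add: good_def)
qed

lemma K_Zp: "t > 0 \<Longrightarrow> x \<in> Zp p \<Longrightarrow> prob_space (K t x)" "t > 0 \<Longrightarrow> x \<in> Zp p \<Longrightarrow> sets (K t x) = sets (Zp_borel p)"
  using K_prob K_sets by simp_all

text \<open>At a good point the eigenvalue equation gives the mass of a ball minus
  \<open>1 / p\<close> times the mass of its parent. Starting from total mass one, this recursion
  determines the mass of every ball.\<close>

lemma measure_K_cyl:
  assumes t: "t > 0" and g: "good t x"
  shows "s \<in> residues_upto p n \<Longrightarrow> measure (K t x) (cyl p n s) = heat k t n s x"
proof (induction n arbitrary: s)
  case 0
  have x: "x \<in> Zp p" using g by (simp add: good_def)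
  interpret Kx: prob_space "K t x" using K_Zp(1) t x .
  have "space (K t x) = Zp p" using K_space[OF t] x by simp
  moreover have "s = 0" using 0 by simp
  ultimately show ?case using Kx.prob_space by (simp add: cyl_0)
next
  case (Suc m)
  have x: "x \<in> Zp p" using g by (simp add: good_def)
  interpret Kx: prob_space "K t x" using K_Zp(1) t x .
  have [simp]: "sets (K t x) = sets (Zp_borel p)" "space (K t x) = Zp p"
    using K_Zp(2)[OF t x] K_space[OF t] x by simp_all
  have i: "integrable (K t x) (indicator (cyl p j r) :: padic \<Rightarrow> real)" for j r
    by (simp add: Kx.emeasure_eq_measure)
  have int: "(\<integral>y. indicator (cyl p j r) y \<partial>K t x) = measure (K t x) (cyl p j r)" for j r
    by simp
  have "exp (- k m * t) * wavelet m s x = kernel_apply K t (wavelet m s) x"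
    using g Suc.prems unfolding good_def by metis
  also have "\<dots> = measure (K t x) (cyl p (Suc m) s) - measure (K t x) (cyl p m (s mod int p ^ m)) / real p"
    unfolding kernel_apply_def wavelet_def
    by (simp only: Bochner_Integration.integral_diff integrable_divide_zero i integral_divide_zero int)
  also have "measure (K t x) (cyl p m (s mod int p ^ m)) = heat k t m (s mod int p ^ m) x"
    by (rule Suc.IH[OF residue_mod])
  finally show ?case by simp
qed

text \<open>The density of \<open>K t x\<close> is the limit of \<open>p ^ n * heat k t n (y n) x\<close>.\<close>

lemma good_absolutely_continuous:
  assumes t: "t > 0" and g: "good t x"
  shows "absolutely_continuous \<mu> (K t x)"
proof -
  have x: "x \<in> Zp p" using g by (simp add: good_def)
  interpret Kx: prob_space "K t x" using K_Zp(1) t x .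
  have sK [simp]: "sets (K t x) = sets (Zp_borel p)" by (rule K_Zp(2)[OF t x])
  \<comment> \<open>These are the terms of the heat trace. They bound the increments of the
    approximate densities \<open>d n\<close>, since wavelets are at most one in absolute value, and
    thus give uniform convergence.\<close>
  define b where "b m = real p ^ Suc m * exp (- k m * t)" for m
  define d where "d n y = real p ^ n * heat k t n (y n) x" for n and y :: padic
  have b: "summable b" "\<And>m. b m \<ge> 0" using heat_trace[OF t] by (simp_all add: b_def[abs_def])
  have incr: "d (Suc n) y - d n y = b n * wavelet n (y (Suc n)) x" if "y \<in> Zp p" for n y
    using Zp_mod[OF that, of n "Suc n"] p_gt_1 by (simp add: d_def b_def algebra_simps)
  have incr_le: "\<bar>d (Suc n) y - d n y\<bar> \<le> b n" if "y \<in> Zp p" for n y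
    unfolding incr[OF that] using abs_wavelet_le_1[of n "y (Suc n)" x] b(2)[of n]
    by (simp add: abs_mult mult_left_le)
  have d_sum: "d n y = 1 + (\<Sum>i<n. d (Suc i) y - d i y)" for n y
  proof -
    have "(\<Sum>i<n. d (Suc i) y - d i y) = d n y - d 0 y" by (rule sum_lessThan_telescope)
    moreover have "d 0 y = 1" by (simp add: d_def)
    ultimately show ?thesis by simp
  qed
  have conv: "convergent (\<lambda>n. d n y)" if y: "y \<in> Zp p" for y
  proof -
    have "summable (\<lambda>i. d (Suc i) y - d i y)"
      using incr_le[OF y] by (intro summable_comparison_test'[OF b(1), of 0]) simp
    then have "(\<lambda>n. 1 + (\<Sum>i<n. d (Suc i) y - d i y)) \<longlonglongrightarrow> 1 + (\<Sum>i. d (Suc i) y - d i y)"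
      by (intro tendsto_intros summable_LIMSEQ)
    then show ?thesis unfolding d_sum[symmetric] by (rule convergentI)
  qed
  define D where "D y = lim (\<lambda>n. d n y)" for y
  have lim: "(\<lambda>n. d n y) \<longlonglongrightarrow> D y" if "y \<in> Zp p" for y
    unfolding D_def using conv[OF that] by (simp add: convergent_LIMSEQ_iff)
  have heat_eq: "heat k t n s x = measure (K t x) (cyl p n s)" if "s \<in> residues_upto p n" for n s
    using measure_K_cyl[OF t g that] by simp
  have d_nonneg: "d n y \<ge> 0" if "y \<in> Zp p" for n y
    unfolding d_def heat_eq[OF Zp_bounds[OF that]] by simp
  have D_nonneg: "D y \<ge> 0" if "y \<in> Zp p" for y
    by (rule LIMSEQ_le_const[OF lim[OF that]]) (use d_nonneg[OF that] in blast)
  have d_le: "d n y \<le> 1 + suminf b" if "y \<in> Zp p" for n y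
  proof -
    have "(\<Sum>i<n. d (Suc i) y - d i y) \<le> (\<Sum>i<n. b i)"
      by (rule sum_mono) (use incr_le[OF that] abs_le_D1 in blast)
    also have "\<dots> \<le> suminf b" by (rule sum_le_suminf[OF b(1)]) (simp_all add: b(2))
    finally show ?thesis using d_sum[of n y] by linarith
  qed
  have d_meas [measurable]: "d n \<in> borel_measurable (Zp_borel p)" for n
    unfolding d_def[abs_def]
    using measurable_compose[OF measurable_coordinate, of "\<lambda>i. real p ^ n * heat k t n i x" borel n] by simp
  have D_meas: "D \<in> borel_measurable (Zp_borel p)"
    by (rule borel_measurable_LIMSEQ_real[of _ d]) (use lim d_meas in auto)
  \<comment> \<open>Integration of \<open>d n\<close> reproduces the mass of every ball of level at
    most \<open>n\<close> exactly, so for a fixed ball the sequence of integrals is eventually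
    constant.\<close>
  have dint: "(\<integral>y. d n y * indicator (cyl p j r) y \<partial>\<mu>) = measure (K t x) (cyl p j r)"
    if j: "j \<le> n" and r: "r \<in> residues_upto p j" for n j r
  proof -
    have i: "integrable \<mu> (\<lambda>y. indicator (cyl p n s) y * indicator (cyl p j r) y :: real)" for s
      using integrable_mult_indicator[OF _ integrable_indicator_cyl, of "cyl p n s"] by simp
    have "(\<integral>y. d n y * indicator (cyl p j r) y \<partial>\<mu>)
        = (\<integral>y. (\<Sum>s\<in>residues_upto p n. real p ^ n * measure (K t x) (cyl p n s) * (indicator (cyl p n s) y * indicator (cyl p j r) y)) \<partial>\<mu>)"
    proof (rule Bochner_Integration.integral_cong[OF refl])
      fix y assume "y \<in> space \<mu>"
      then have y: "y \<in> Zp p" by simp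
      have "(\<Sum>s\<in>residues_upto p n. real p ^ n * measure (K t x) (cyl p n s) * (indicator (cyl p n s) y * indicator (cyl p j r) y))
          = (\<Sum>s\<in>residues_upto p n. if s = y n then real p ^ n * measure (K t x) (cyl p n s) * indicator (cyl p j r) y else 0)"
        by (rule sum.cong[OF refl]) (simp add: indicator_cyl y)
      also have "\<dots> = real p ^ n * measure (K t x) (cyl p n (y n)) * indicator (cyl p j r) y"
        using Zp_bounds[OF y, of n] by (subst sum.delta) auto
      finally show "d n y * indicator (cyl p j r) y
          = (\<Sum>s\<in>residues_upto p n. real p ^ n * measure (K t x) (cyl p n s) * (indicator (cyl p n s) y * indicator (cyl p j r) y))"
        unfolding d_def heat_eq[OF Zp_bounds[OF y]] by simp
    qed
    also have "\<dots> = (\<Sum>s\<in>residues_upto p n. real p ^ n * measure (K t x) (cyl p n s) * (\<integral>y. indicator (cyl p n s) y * indicator (cyl p j r) y \<partial>\<mu>))"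
      by (simp only: Bochner_Integration.integral_sum Bochner_Integration.integral_mult_right_zero i Bochner_Integration.integrable_mult_right)
    also have "\<dots> = (\<Sum>s\<in>residues_upto p n. if s mod int p ^ j = r then measure (K t x) (cyl p n s) else 0)"
    proof (rule sum.cong[OF refl])
      fix s assume s: "s \<in> residues_upto p n"
      show "real p ^ n * measure (K t x) (cyl p n s) * (\<integral>y. indicator (cyl p n s) y * indicator (cyl p j r) y \<partial>\<mu>)
          = (if s mod int p ^ j = r then measure (K t x) (cyl p n s) else 0)"
        unfolding integral_cyl_cyl[OF s r] using j by simp
    qed
    also have "\<dots> = (\<Sum>s\<in>{s \<in> residues_upto p n. s mod int p ^ j = r}. measure (K t x) (cyl p n s))"
      by (rule sum.inter_filter[symmetric]) simp
    also have "\<dots> = measure (K t x) (\<Union>s\<in>{s \<in> residues_upto p n. s mod int p ^ j = r}. cyl p n s)"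
    proof (rule Kx.finite_measure_finite_Union[symmetric])
      show "finite {s \<in> residues_upto p n. s mod int p ^ j = r}"
        by (rule finite_subset[of _ "residues_upto p n"]) auto
    qed (auto simp: disjoint_cyl)
    finally show ?thesis unfolding cyl_split[OF j, symmetric] .
  qed
  have Dint: "(\<integral>y. D y * indicator (cyl p j r) y \<partial>\<mu>) = measure (K t x) (cyl p j r)"
    and Dintegrable: "integrable \<mu> (\<lambda>y. D y * indicator (cyl p j r) y)"
    if r: "r \<in> residues_upto p j" for j r
  proof -
    have m: "(\<lambda>y. D y * indicator (cyl p j r) y) \<in> borel_measurable \<mu>"
      "\<And>n. (\<lambda>y. d n y * indicator (cyl p j r) y) \<in> borel_measurable \<mu>"
      using D_meas by measurable
    have w: "integrable \<mu> (\<lambda>y. 1 + suminf b)" by simp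
    have l: "AE y in \<mu>. (\<lambda>n. d n y * indicator (cyl p j r) y) \<longlonglongrightarrow> D y * indicator (cyl p j r) y"
      by (rule AE_I2) (intro tendsto_intros lim, simp)
    have bd: "AE y in \<mu>. norm (d n y * indicator (cyl p j r) y) \<le> 1 + suminf b" for n
    proof (rule AE_I2)
      fix y assume "y \<in> space \<mu>"
      then have y: "y \<in> Zp p" by simp
      show "norm (d n y * indicator (cyl p j r) y) \<le> 1 + suminf b"
        using d_nonneg[OF y, of n] d_le[OF y, of n] by (auto simp: indicator_def)
    qed
    show "integrable \<mu> (\<lambda>y. D y * indicator (cyl p j r) y)"
      by (rule integrable_dominated_convergence[OF m w l bd])
    have "(\<lambda>n. \<integral>y. d n y * indicator (cyl p j r) y \<partial>\<mu>) \<longlonglongrightarrow> (\<integral>y. D y * indicator (cyl p j r) y \<partial>\<mu>)"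
      by (rule integral_dominated_convergence[OF m w l bd])
    moreover have "\<forall>\<^sub>F n in sequentially. (\<integral>y. d n y * indicator (cyl p j r) y \<partial>\<mu>) = measure (K t x) (cyl p j r)"
      using eventually_ge_at_top[of j] by eventually_elim (rule dint[OF _ r])
    ultimately show "(\<integral>y. D y * indicator (cyl p j r) y \<partial>\<mu>) = measure (K t x) (cyl p j r)"
      by (rule LIMSEQ_unique[OF _ tendsto_eventually])
  qed
  have "K t x = density \<mu> (\<lambda>y. ennreal (D y))"
  proof (rule Zp_measure_eqI)
    show "finite_measure (K t x)" by (rule Kx.finite_measure_axioms)
    fix n r assume r: "r \<in> residues_upto p n"
    have "emeasure (K t x) (cyl p n r) = ennreal (\<integral>y. D y * indicator (cyl p n r) y \<partial>\<mu>)"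
      using Dint[OF r] by (simp add: Kx.emeasure_eq_measure)
    also have "\<dots> = (\<integral>\<^sup>+y. ennreal (D y * indicator (cyl p n r) y) \<partial>\<mu>)"
      using D_nonneg by (intro nn_integral_eq_integral[symmetric] Dintegrable[OF r] AE_I2) simp
    also have "\<dots> = (\<integral>\<^sup>+y. ennreal (D y) * indicator (cyl p n r) y \<partial>\<mu>)"
      by (intro nn_integral_cong) (simp add: indicator_def)
    also have "\<dots> = emeasure (density \<mu> (\<lambda>y. ennreal (D y))) (cyl p n r)"
      using D_meas by (subst emeasure_density) auto
    finally show "emeasure (K t x) (cyl p n r) = emeasure (density \<mu> (\<lambda>y. ennreal (D y))) (cyl p n r)" .
  qed simp_all
  then show ?thesis using D_meas absolutely_continuousI_density[of "\<lambda>y. ennreal (D y)" \<mu>] by simp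
qed

end

section \<open>Agreement of two semigroups from almost every starting point\<close>

lemma rational_between_0:
  assumes "t > 0"
  obtains r :: real where "r \<in> \<rat>" "0 < r" "r < t"
  using Rats_dense_in_real[OF assms] by blast

text \<open>The quantifiers over times stand inside the almost everywhere: one null set serves all
  times. The second conjunct supplies the comparison at random positions used in
  \<open>fdd_unique\<close>.\<close>

lemma wavelet_semigroups_agree:
  assumes "wavelet_semigroup p \<mu> K k" "wavelet_semigroup p \<mu> K' k"
  shows "AE x in \<mu>. (\<forall>t>0. K t x = K' t x) \<and> (\<forall>s>0. \<forall>t>0. AE y in K s x. K t y = K' t y)"
proof -
  interpret A: wavelet_semigroup p \<mu> K k by fact
  interpret B: wavelet_semigroup p \<mu> K' k by fact
  have eq: "K t x = K' t x" if t: "t > 0" and g: "A.good t x" "B.good t x" for t x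
  proof (rule A.Zp_measure_eqI)
    have x: "x \<in> Zp p" using g(1) by (simp add: A.good_def)
    interpret Kx: prob_space "K t x" using A.K_Zp(1)[OF t x] .
    interpret Kx': prob_space "K' t x" using B.K_Zp(1)[OF t x] .
    show "sets (K t x) = sets (Zp_borel p)" "sets (K' t x) = sets (Zp_borel p)"
      using A.K_Zp(2)[OF t x] B.K_Zp(2)[OF t x] .
    show "finite_measure (K t x)" by (rule Kx.finite_measure_axioms)
    show "emeasure (K t x) (cyl p n r) = emeasure (K' t x) (cyl p n r)" if "r \<in> residues_upto p n" for n r
      using A.measure_K_cyl[OF t g(1) that] B.measure_K_cyl[OF t g(2) that]
      by (simp add: Kx.emeasure_eq_measure Kx'.emeasure_eq_measure)
  qed
  have ae_eq: "AE x in \<mu>. K t x = K' t x" if "t > 0" for t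
    using A.AE_good[OF that] B.AE_good[OF that] by eventually_elim (rule eq[OF that])
  have cQ: "countable {r::real. r \<in> \<rat> \<and> 0 < r}"
    by (rule countable_subset[OF _ countable_rat]) auto
  \<comment> \<open>Countably many times allow a common null set; arbitrary times are reached from
    these by the Chapman-Kolmogorov equation.\<close>
  have "AE x in \<mu>. \<forall>r\<in>{r::real. r \<in> \<rat> \<and> 0 < r}. A.good r x \<and> B.good r x"
    unfolding AE_ball_countable[OF cQ]
  proof
    fix r :: real assume "r \<in> {r. r \<in> \<rat> \<and> 0 < r}"
    then have r: "r > 0" by simp
    show "AE x in \<mu>. A.good r x \<and> B.good r x"
      using A.AE_good[OF r] B.AE_good[OF r] by eventually_elim simp
  qed
  then show ?thesis using AE_space
  proof eventually_elim
    case (elim x)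
    have x: "x \<in> Zp p" using elim(2) by simp
    have good: "A.good r x" "B.good r x" if "r \<in> \<rat>" "r > 0" for r using elim(1) that by auto
    have ac_rat: "AE y in K r x. P y" if r: "r \<in> \<rat>" "r > 0" and P: "AE y in \<mu>. P y" for r P
      using absolutely_continuous_AE[OF _ A.good_absolutely_continuous[OF r(2) good(1)[OF r]] P] A.K_Zp(2)[OF r(2) x] by simp
    have "K t x = K' t x" if t: "t > 0" for t
    proof -
      obtain r where r: "r \<in> \<rat>" "0 < r" "r < t" using rational_between_0[OF t] .
      have tr: "t - r > 0" using r by simp
      have Kr: "K r x = K' r x" using eq[OF r(2) good[OF r(1,2)]] .
      have "emeasure (K t x) B = emeasure (K' t x) B" if "B \<in> sets (Zp_borel p)" for B
      proof -
        have "emeasure (K t x) B = (\<integral>\<^sup>+y. emeasure (K (t - r) y) B \<partial>K r x)"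
          using A.emeasure_K_add[OF r(2) tr _ that, of x] x by simp
        \<comment> \<open>The kernels at the one time \<open>t - r\<close> differ on a null set
          only, and \<open>K r x\<close> does not charge it.\<close>
        also have "\<dots> = (\<integral>\<^sup>+y. emeasure (K' (t - r) y) B \<partial>K r x)"
          using ac_rat[OF r(1,2) ae_eq[OF tr]] by (intro nn_integral_cong_AE) auto
        also have "\<dots> = emeasure (K' t x) B"
          using B.emeasure_K_add[OF r(2) tr _ that, of x] x Kr by simp
        finally show ?thesis .
      qed
      then show ?thesis using A.K_Zp(2)[OF t x] B.K_Zp(2)[OF t x] by (intro measure_eqI) auto
    qed
    moreover have "AE y in K s x. K t y = K' t y" if s: "s > 0" and t: "t > 0" for s t
    proof -
      obtain r where r: "r \<in> \<rat>" "0 < r" "r < s" using rational_between_0[OF s] .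
      have sr: "s - r > 0" using r by simp
      \<comment> \<open>A null set \<open>N\<close> has zero mass under \<open>K (s - r) y\<close>
        for almost every \<open>y\<close>, hence for \<open>K r x\<close>-almost every
        \<open>y\<close>; averaging over \<open>y\<close> gives zero mass under
        \<open>K s x\<close>.\<close>
      have "absolutely_continuous \<mu> (K s x)"
        unfolding absolutely_continuous_def
      proof
        fix N assume N: "N \<in> null_sets \<mu>"
        then have NS: "N \<in> sets (Zp_borel p)" by (auto simp: null_sets_def)
        have "AE y in \<mu>. emeasure (K (s - r) y) N = 0"
          using A.AE_good[OF sr]
        proof eventually_elim
          case (elim y)
          then show ?case using A.good_absolutely_continuous[OF sr elim] N
            unfolding absolutely_continuous_def by (auto simp: null_sets_def)
        qed
        then have "AE y in K r x. emeasure (K (s - r) y) N = 0" by (rule ac_rat[OF r(1,2)])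
        then have "(\<integral>\<^sup>+y. emeasure (K (s - r) y) N \<partial>K r x) = (\<integral>\<^sup>+y. 0 \<partial>K r x)"
          by (rule nn_integral_cong_AE)
        then have "emeasure (K s x) N = 0"
          using A.emeasure_K_add[OF r(2) sr _ NS, of x] x by simp
        then show "N \<in> null_sets (K s x)" using NS A.K_Zp(2)[OF s x] by (auto simp: null_sets_def)
      qed
      from absolutely_continuous_AE[OF _ this ae_eq[OF t]] show ?thesis using A.K_Zp(2)[OF s x] by simp
    qed
    ultimately show ?case by blast
  qed
qed

lemma transition_function_time_change:
  fixes C :: real
  assumes "transition_function S K" "C > 0"
  shows "transition_function S (\<lambda>t. K (t / C))"
  using assms by (auto simp: transition_function_def add_divide_distrib)

text \<open>The bound \<open>exp y \<ge> (y / N)^N\<close> with \<open>N\<close> at least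
  \<open>2 / \<alpha>\<close> makes the exponential grow at least like
  \<open>p^(2 * (m + 1))\<close>. This beats the factor \<open>p^(m + 1)\<close> and leaves a
  geometric series.\<close>

lemma heat_trace_summable:
  fixes p :: nat and \<alpha> t :: real
  assumes p: "p > 1" and \<alpha>: "\<alpha> > 0" and t: "t > 0"
  shows "summable (\<lambda>m. real p ^ Suc m * exp (- (real p powr (\<alpha> * real (Suc m))) * t))"
proof -
  obtain N :: nat where "2 / \<alpha> < real N" using reals_Archimedean2 by blast
  then have N: "2 \<le> \<alpha> * real N" "N > 0" using \<alpha> by (auto simp: field_simps intro: gr0I)
  have "summable (\<lambda>m. (real N / t) ^ N * (1 / real p) ^ Suc m)"
    using p by (intro summable_mult summable_Suc_iff[THEN iffD2] summable_geometric) simp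
  then show ?thesis
  proof (rule summable_comparison_test'[where N = 0])
    fix m :: nat
    let ?y = "real p powr (\<alpha> * real (Suc m)) * t"
    have y: "?y > 0" using p t by simp
    have "(?y / real N) ^ N \<le> exp (?y / real N) ^ N"
    proof (rule power_mono)
      show "?y / real N \<le> exp (?y / real N)" using exp_ge_add_one_self[of "?y / real N"] by linarith
      show "0 \<le> ?y / real N" using y by simp
    qed
    also have "\<dots> = exp ?y" using N(2) by (rule exp_divide_power_eq)
    finally have e: "(?y / real N) ^ N \<le> exp ?y" .
    have "real p ^ (2 * Suc m) = real p powr (2 * real (Suc m))"
      using p by (subst powr_realpow[symmetric]) simp_all
    also have "\<dots> \<le> real p powr (\<alpha> * real N * real (Suc m))"
      using p N(1) by (intro powr_mono mult_right_mono) auto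
    also have "\<dots> = (real p powr (\<alpha> * real (Suc m))) ^ N"
      using p by (simp add: powr_realpow[symmetric] powr_powr mult_ac del: of_nat_Suc)
    finally have "real p ^ (2 * Suc m) * (t / real N) ^ N \<le> (real p powr (\<alpha> * real (Suc m))) ^ N * (t / real N) ^ N"
      using t by (intro mult_right_mono) auto
    also have "\<dots> = (?y / real N) ^ N" by (simp add: power_mult_distrib power_divide)
    also have "\<dots> \<le> exp ?y" by (rule e)
    finally have "exp (- ?y) \<le> inverse (real p ^ (2 * Suc m) * (t / real N) ^ N)"
      using p t N(2) unfolding exp_minus by (intro le_imp_inverse_le) auto
    then have "real p ^ Suc m * exp (- ?y) \<le> real p ^ Suc m * inverse (real p ^ (2 * Suc m) * (t / real N) ^ N)"
      by (intro mult_left_mono) auto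
    also have "\<dots> = (real N / t) ^ N * (1 / real p) ^ Suc m"
    proof -
      have "real p ^ (2 * Suc m) = real p ^ Suc m * real p ^ Suc m" by (simp only: mult_2 power_add)
      then show ?thesis using p t N(2) by (simp add: power_divide field_simps)
    qed
    finally show "norm (real p ^ Suc m * exp (- (real p powr (\<alpha> * real (Suc m))) * t)) \<le> (real N / t) ^ N * (1 / real p) ^ Suc m"
      by simp
  qed
qed

section \<open>The two processes\<close>

context padic
begin

lemma continuous_indicator_cyl:
  "continuous_map (Zp_topology p) euclideanreal (indicator (cyl p n r))"
  unfolding continuous_map_def
proof (intro conjI allI impI)
  show "(indicator (cyl p n r) :: padic \<Rightarrow> real) \<in> topspace (Zp_topology p) \<rightarrow> topspace euclideanreal"
    by simp
  fix U :: "real set" assume "openin euclidean U"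
  have "openin (Zp_topology p) {x \<in> Zp p. indicator (cyl p n r) x \<in> U}"
    unfolding Zp.openin_mtopology
  proof (intro conjI allI impI)
    fix x assume x: "x \<in> {x \<in> Zp p. indicator (cyl p n r) x \<in> U}"
    obtain e where e: "e > 0" "Zp.mball x e \<subseteq> cyl p n (x n)"
      using openin_cyl[of n "x n"] x unfolding Zp.openin_mtopology by (auto simp: cyl_def)
    have "cyl p n (x n) \<subseteq> {x \<in> Zp p. indicator (cyl p n r) x \<in> U}"
      using x by (auto simp: indicator_cyl) (auto simp: cyl_def)
    then show "\<exists>e>0. Zp.mball x e \<subseteq> {x \<in> Zp p. indicator (cyl p n r) x \<in> U}"
      using e by blast
  qed auto
  then show "openin (Zp_topology p) {x \<in> topspace (Zp_topology p). indicator (cyl p n r) x \<in> U}"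
    by simp
qed

end

section \<open>Pointwise agreement of Feller kernels\<close>

context padic_haar
begin

text \<open>The set where two continuous functions differ is open. If nonempty, it contains a
  cylinder, which has positive Haar measure.\<close>

lemma continuous_AE_eq:
  fixes f g :: "padic \<Rightarrow> real"
  assumes f: "continuous_map (Zp_topology p) euclideanreal f" and g: "continuous_map (Zp_topology p) euclideanreal g"
    and ae: "AE x in \<mu>. f x = g x" and x: "x \<in> Zp p"
  shows "f x = g x"
proof (rule ccontr)
  assume ne: "f x \<noteq> g x"
  have "continuous_map (Zp_topology p) euclideanreal (\<lambda>x. f x - g x)"
    using f g by (rule continuous_map_diff)
  then have "openin (Zp_topology p) {x \<in> topspace (Zp_topology p). f x - g x \<in> - {0}}"
    by (rule openin_continuous_map_preimage) (simp add: open_Compl)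
  then have op: "openin (Zp_topology p) {x \<in> Zp p. f x \<noteq> g x}" by simp
  obtain n where n: "cyl p n (x n) \<subseteq> {x \<in> Zp p. f x \<noteq> g x}"
    by (rule open_contains_cyl[OF op, of x]) (use ne x in auto)
  have "AE y in \<mu>. y \<notin> cyl p n (x n)" using ae by eventually_elim (use n in auto)
  then have "emeasure \<mu> (cyl p n (x n)) = 0"
    by (subst (asm) AE_iff_measurable[of "cyl p n (x n)"]) (use cyl_sub_Zp in auto)
  then have "measure \<mu> (cyl p n (x n)) = 0" by (simp add: measure_def)
  then show False using measure_cyl[OF Zp_bounds[OF x, of n]] p_gt_1 by simp
qed

text \<open>Cylinders are open and closed, so their indicators are continuous and the Feller
  property applies to them directly; their integrals determine the measures.\<close>

lemma feller_kernels_agree: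
  assumes K: "transition_function (Zp_borel p) K" "transition_function (Zp_borel p) K'"
    and fe: "feller p K" "feller p K'"
    and ae: "\<And>t. t > 0 \<Longrightarrow> AE x in \<mu>. K t x = K' t x"
    and t: "t > 0" and x: "x \<in> Zp p"
  shows "K t x = K' t x"
proof (rule Zp_measure_eqI)
  interpret A: transition "Zp_borel p" K by unfold_locales (rule K)
  interpret B: transition "Zp_borel p" K' by unfold_locales (rule K)
  interpret Kx: prob_space "K t x" using A.K_prob[OF t] x by simp
  interpret Kx': prob_space "K' t x" using B.K_prob[OF t] x by simp
  show s: "sets (K t x) = sets (Zp_borel p)" "sets (K' t x) = sets (Zp_borel p)"
    using A.K_sets[OF t] B.K_sets[OF t] x by simp_all
  show "finite_measure (K t x)" by (rule Kx.finite_measure_axioms)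
  fix n r
  let ?f = "indicator (cyl p n r) :: padic \<Rightarrow> real"
  have "continuous_map (Zp_topology p) euclideanreal (kernel_apply K t ?f)"
    "continuous_map (Zp_topology p) euclideanreal (kernel_apply K' t ?f)"
    using fe t continuous_indicator_cyl unfolding feller_def by blast+
  moreover have "AE x in \<mu>. kernel_apply K t ?f x = kernel_apply K' t ?f x"
    using ae[OF t] by eventually_elim (simp add: kernel_apply_def)
  ultimately have "kernel_apply K t ?f x = kernel_apply K' t ?f x"
    using x by (rule continuous_AE_eq)
  then have "measure (K t x) (cyl p n r) = measure (K' t x) (cyl p n r)"
    using s sets_eq_imp_space_eq[OF s(1)] sets_eq_imp_space_eq[OF s(2)] by (simp add: kernel_apply_def)
  then show "emeasure (K t x) (cyl p n r) = emeasure (K' t x) (cyl p n r)"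
    by (simp add: Kx.emeasure_eq_measure Kx'.emeasure_eq_measure)
qed

end

lemma feller_time_change: "C > 0 \<Longrightarrow> feller p K \<Longrightarrow> feller p (\<lambda>t. K (t / C))" for C :: real
  by (auto simp: feller_def kernel_apply_def[abs_def])

lemma (in boundary_walk) boundary_semigroup_wavelet:
  assumes tf: "transition_function (Zp_borel p) K" and ex: "is_exp_semigroup \<mu> K HD_operator"
    and t: "t > 0" and s: "s \<in> residues_upto p (Suc m)"
  shows "AE x in \<mu>. kernel_apply K t (wavelet m s) x = exp (- ((1 - F) / F ^ m) * t) * wavelet m s x"
proof -
  interpret contraction_semigroup "Zp_borel p" K \<mu>
  proof (unfold_locales)
    show "transition_function (Zp_borel p) K" by fact
    show "sets \<mu> = sets (Zp_borel p)" by simp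
    show "L2_norm \<mu> (kernel_apply K t f) \<le> L2_norm \<mu> f"
      if "t > 0" "bounded_measurable (Zp_borel p) f" for t f
      using ex that bounded_measurable_haar_L2 unfolding is_exp_semigroup_def by blast
  qed
  show ?thesis
  proof (rule eigenfunction_semigroup[OF t _ bounded_measurable_wavelet])
    show "0 \<le> (1 - F) / F ^ m" using F by simp
    have "HD_operator = {(f, g). f \<in> L2 \<mu> \<and> g \<in> L2 \<mu> \<and>
        ((\<lambda>t. L2_norm \<mu> (\<lambda>x. (f x - kernel_apply K t f x) /\<^sub>R t - g x)) \<longlongrightarrow> 0) (at_right 0)}"
      using ex unfolding is_exp_semigroup_def by blast
    with wavelet_in_HD_operator[OF s]
    show "((\<lambda>t. L2_norm \<mu> (\<lambda>x. (wavelet m s x - kernel_apply K t (wavelet m s) x) /\<^sub>R t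
        - (1 - F) / F ^ m * wavelet m s x)) \<longlongrightarrow> 0) (at_right 0)"
      by simp
  qed
qed

lemma kernel_apply_of_real:
  "kernel_apply K t (\<lambda>x. complex_of_real (f x)) x = complex_of_real (kernel_apply K t f x)"
  unfolding kernel_apply_def by (rule integral_complex_of_real)

lemma L2_norm_of_real: "L2_norm \<mu> (\<lambda>x. complex_of_real (f x)) = L2_norm \<mu> f"
  by (simp add: L2_norm_def)

lemma operator_closure_extends:
  assumes "(f, g) \<in> A" "f \<in> L2 \<mu>" "g \<in> L2 \<mu>"
  shows "(f, g) \<in> operator_closure \<mu> A"
  unfolding operator_closure_def mem_Collect_eq prod.case
proof (intro conjI exI)
  show "\<forall>n::nat. ((\<lambda>_. f) n, (\<lambda>_. g) n) \<in> A" using assms(1) by simp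
qed (use assms in \<open>simp_all add: L2_norm_def\<close>)

lemma (in prime_haar) D_alpha_semigroup_wavelet:
  assumes tf: "transition_function (Zp_borel p) K" and ex: "is_exp_semigroup \<mu> K (operator_closure \<mu> (D_alpha p \<mu> \<alpha>))"
    and t: "t > 0" and s: "s \<in> residues_upto p (Suc m)"
  shows "AE x in \<mu>. kernel_apply K t (wavelet m s) x = exp (- (real p powr (\<alpha> * real (Suc m))) * t) * wavelet m s x"
proof -
  let ?l = "real p powr (\<alpha> * real (Suc m))"
  interpret contraction_semigroup "Zp_borel p" K \<mu>
  proof (unfold_locales)
    show "transition_function (Zp_borel p) K" by fact
    show "sets \<mu> = sets (Zp_borel p)" by simp
    fix t f assume t: "(t :: real) > 0" and f: "bounded_measurable (Zp_borel p) f"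
    \<comment> \<open>The hypothesis is about complex functions. The kernel commutes with the
      embedding of the reals, which preserves the norm, so the contraction bound passes to real
      functions.\<close>
    have "L2_norm \<mu> (kernel_apply K t (\<lambda>x. complex_of_real (f x))) \<le> L2_norm \<mu> (\<lambda>x. complex_of_real (f x))"
      using ex t bounded_complex_L2[OF f] unfolding is_exp_semigroup_def by blast
    then show "L2_norm \<mu> (kernel_apply K t f) \<le> L2_norm \<mu> f"
      by (simp only: kernel_apply_of_real[abs_def] L2_norm_of_real)
  qed
  show ?thesis
  proof (rule eigenfunction_semigroup[OF t _ bounded_measurable_wavelet])
    show "0 \<le> ?l" by simp
    let ?f = "\<lambda>x. complex_of_real (wavelet m s x)" and ?g = "\<lambda>x. complex_of_real (?l * wavelet m s x)"
    have A: "operator_closure \<mu> (D_alpha p \<mu> \<alpha>) = {(f, g). f \<in> L2 \<mu> \<and> g \<in> L2 \<mu> \<and>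
        ((\<lambda>t. L2_norm \<mu> (\<lambda>x. (f x - kernel_apply K t f x) /\<^sub>R t - g x)) \<longlongrightarrow> 0) (at_right 0)}"
      using ex unfolding is_exp_semigroup_def by blast
    have "(?f, ?g) \<in> operator_closure \<mu> (D_alpha p \<mu> \<alpha>)"
    proof (rule operator_closure_extends)
      show D: "(?f, ?g) \<in> D_alpha p \<mu> \<alpha>" by (rule wavelet_in_D_alpha[OF s])
      show "?f \<in> L2 \<mu>" by (rule bounded_complex_L2[OF bounded_measurable_wavelet])
      show "?g \<in> L2 \<mu>" using D by (simp add: D_alpha_def)
    qed
    then have "((\<lambda>t. L2_norm \<mu> (\<lambda>x. (?f x - kernel_apply K t ?f x) /\<^sub>R t - ?g x)) \<longlongrightarrow> 0) (at_right 0)"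
      unfolding A by simp
    moreover have "(?f x - kernel_apply K t ?f x) /\<^sub>R t - ?g x
        = complex_of_real ((wavelet m s x - kernel_apply K t (wavelet m s) x) /\<^sub>R t - ?l * wavelet m s x)" for t x
      unfolding kernel_apply_of_real by (simp add: scaleR_conv_of_real)
    ultimately show "((\<lambda>t. L2_norm \<mu> (\<lambda>x. (wavelet m s x - kernel_apply K t (wavelet m s) x) /\<^sub>R t
        - ?l * wavelet m s x)) \<longlongrightarrow> 0) (at_right 0)"
      by (simp only: L2_norm_of_real)
  qed
qed

text \<open>The semigroups fix the kernels only up to null sets of starting points, so in general
  the laws can be compared from almost every point. Feller versions are determined at every point,
  which gives the second conjunct.\<close>

theorem proposition8p3:
  fixes p :: nat and \<alpha> c C :: real and \<mu> :: "padic measure"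
    and P :: "vertex \<Rightarrow> 'v measure" and Z :: "nat \<Rightarrow> 'v \<Rightarrow> vertex"
    and K K\<^sub>\<alpha> :: "real \<Rightarrow> padic \<Rightarrow> padic measure"
    and Q :: "padic \<Rightarrow> 'w measure" and X :: "real \<Rightarrow> 'w \<Rightarrow> padic"
    and Q\<^sub>\<alpha> :: "padic \<Rightarrow> 'u measure" and X\<^sub>\<alpha> :: "real \<Rightarrow> 'u \<Rightarrow> padic"
  assumes "prime p" and "\<alpha> > 0"
    and "c = inverse (1 + real p powr (- \<alpha>))"
    and "C = (real p powr (- \<alpha>)) * (1 - real p powr (- \<alpha>))"
    and "haar_prob p \<mu>"
    and "random_walk p (walk_prob p c) P Z"
    and "boundary_process p (walk_prob p c) P Z K Q X"
    and "driven_by_D_alpha p \<mu> \<alpha> K\<^sub>\<alpha> Q\<^sub>\<alpha> X\<^sub>\<alpha>"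
  shows "(AE x in \<mu>. process_law (Zp_borel p) (Q x) (\<lambda>t. X (t / C)) =
                     process_law (Zp_borel p) (Q\<^sub>\<alpha> x) X\<^sub>\<alpha>) \<and>
         (feller p K \<and> feller p K\<^sub>\<alpha> \<longrightarrow>
            (\<forall>x\<in>Zp p. process_law (Zp_borel p) (Q x) (\<lambda>t. X (t / C)) =
                      process_law (Zp_borel p) (Q\<^sub>\<alpha> x) X\<^sub>\<alpha>))"
proof -
  have p1: "p > 1" using assms(1) by (rule prime_gt_1_nat)
  define F where "F = real p powr (- \<alpha>)"
  have F: "0 < F" "F < 1" using p1 assms(2) by (simp_all add: F_def powr_less_one)
  have C: "C = F * (1 - F)" "C > 0" using F assms(4) by (simp_all add: F_def)
  interpret prime_haar p \<mu>
    by unfold_locales (use p1 assms in auto)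
  interpret boundary_walk p \<mu> F c P Z
    by unfold_locales (use F assms in \<open>auto simp: F_def field_simps\<close>)
  define k where "k m = real p powr (\<alpha> * real (Suc m))" for m
  \<comment> \<open>Here \<open>k m = F^(-(m + 1))\<close> is the eigenvalue of the operator driving
    the second process. The form eigenvalue is larger by the factor \<open>C\<close> for every
    \<open>m\<close>, which is why one linear change of time suffices.\<close>
  have Fk: "(1 - F) / F ^ m = C * k m" for m
  proof -
    have "F ^ Suc m * k m = 1"
      using p1 by (simp add: F_def k_def powr_realpow[symmetric] powr_powr del: of_nat_Suc power_Suc flip: powr_add)
    then have "k m = 1 / F ^ Suc m" using F by (simp add: field_simps)
    then have "C * k m = (1 - F) * (F / F ^ Suc m)" unfolding C(1) by simp
    then show ?thesis using F by simp
  qed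
  have mp: "markov_process (Zp_borel p) K Q X" and ex: "is_exp_semigroup \<mu> K HD_operator"
    using assms(7) by (simp_all add: boundary_process_def Let_def exit_law_root)
  have mp\<alpha>: "markov_process (Zp_borel p) K\<^sub>\<alpha> Q\<^sub>\<alpha> X\<^sub>\<alpha>"
    and ex\<alpha>: "is_exp_semigroup \<mu> K\<^sub>\<alpha> (operator_closure \<mu> (D_alpha p \<mu> \<alpha>))"
    using assms(8) by (simp_all add: driven_by_D_alpha_def)
  have tf: "transition_function (Zp_borel p) K" and tf\<alpha>: "transition_function (Zp_borel p) K\<^sub>\<alpha>"
    using mp mp\<alpha> by (simp_all add: markov_process_def)
  let ?K = "\<lambda>t. K (t / C)"
  have tfC: "transition_function (Zp_borel p) ?K" by (rule transition_function_time_change[OF tf C(2)])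
  have tr: "summable (\<lambda>m. real p ^ Suc m * exp (- k m * t))" if "t > 0" for t
    unfolding k_def using p1 assms(2) that by (rule heat_trace_summable)
  have eig: "AE x in \<mu>. kernel_apply ?K t (wavelet m s) x = exp (- k m * t) * wavelet m s x"
    if "t > 0" "s \<in> residues_upto p (Suc m)" for t m s
  proof -
    have "AE x in \<mu>. kernel_apply K (t / C) (wavelet m s) x = exp (- (C * k m) * (t / C)) * wavelet m s x"
      using boundary_semigroup_wavelet[OF tf ex _ that(2), of "t / C"] that(1) C(2) unfolding Fk by simp
    then show ?thesis using C(2) by (simp add: kernel_apply_def)
  qed
  have W: "wavelet_semigroup p \<mu> ?K k"
    by (unfold_locales; fact tfC tr eig)
  have W\<alpha>: "wavelet_semigroup p \<mu> K\<^sub>\<alpha> k"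
    using tf\<alpha> tr D_alpha_semigroup_wavelet[OF tf\<alpha> ex\<alpha>] by unfold_locales (auto simp: k_def)
  note agree = wavelet_semigroups_agree[OF W W\<alpha>]
  have law: "process_law (Zp_borel p) (Q x) (\<lambda>t. X (t / C)) = process_law (Zp_borel p) (Q\<^sub>\<alpha> x) X\<^sub>\<alpha>"
    if x: "x \<in> Zp p" and eq: "\<And>t. t > 0 \<Longrightarrow> ?K t x = K\<^sub>\<alpha> t x"
      and ae: "\<And>s t. s > 0 \<Longrightarrow> t > 0 \<Longrightarrow> AE y in ?K s x. ?K t y = K\<^sub>\<alpha> t y" for x
  proof (rule process_law_unique[OF _ _ tfC eq ae])
    show "markov_fdd (Zp_borel p) ?K x (Q x) (\<lambda>t. X (t / C))"
      using markov_process_fdd[OF mp] x C(2) by (intro markov_fdd_time_change) auto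
    show "markov_fdd (Zp_borel p) K\<^sub>\<alpha> x (Q\<^sub>\<alpha> x) X\<^sub>\<alpha>"
      using markov_process_fdd[OF mp\<alpha>] x by simp
  qed
  show ?thesis
  proof (intro conjI impI ballI)
    show "AE x in \<mu>. process_law (Zp_borel p) (Q x) (\<lambda>t. X (t / C)) = process_law (Zp_borel p) (Q\<^sub>\<alpha> x) X\<^sub>\<alpha>"
      using agree AE_space
    proof eventually_elim
      case (elim x)
      then show ?case by (intro law) auto
    qed
  next
    fix x assume fe: "feller p K \<and> feller p K\<^sub>\<alpha>" and x: "x \<in> Zp p"
    have ae: "AE x in \<mu>. ?K t x = K\<^sub>\<alpha> t x" if "t > 0" for t
      using agree by eventually_elim (use that in blast)
    have eq: "?K t y = K\<^sub>\<alpha> t y" if "t > 0" "y \<in> Zp p" for t y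
      using feller_kernels_agree[OF tfC tf\<alpha> feller_time_change[OF C(2)] _ ae that] fe by blast
    show "process_law (Zp_borel p) (Q x) (\<lambda>t. X (t / C)) = process_law (Zp_borel p) (Q\<^sub>\<alpha> x) X\<^sub>\<alpha>"
    proof (rule law[OF x])
      show "?K t x = K\<^sub>\<alpha> t x" if "t > 0" for t by (rule eq[OF that x])
      interpret W: wavelet_semigroup p \<mu> ?K k by (rule W)
      \<comment> \<open>For Feller kernels equality holds at every \<open>y\<close>, so no absolute
        continuity has to be invoked at this point.\<close>
      show "AE y in ?K s x. ?K t y = K\<^sub>\<alpha> t y" if "s > 0" "t > 0" for s t
        using W.K_space[OF that(1), of x] x eq[OF that(2)] by (intro AE_I2) simp
    qed
  qed
qed

end
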